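(* For each integer $m\geq 3$, the cartesian product $K_m\square K_2$ is unmixed and vertex decomposable, and so Cohen-Macaulay.
   Context: $K_n$ is the complete graph on $n$ vertices. The cartesian product $G\square H$ has vertex set $V(G)\times V(H)$, and $(u,u')$, $(v,v')$ are adjacent if and only if either $u=v$ and $u'$ is adjacent to $v'$ in $H$, or $u'=v'$ and $u$ is adjacent to $v$ in $G$. A graph is unmixed if all its maximal independent sets of vertices have the same size. For a vertex $x$ of $G$, $N_G(x)$ is the set of vertices adjacent to $x$ and $N_G[x]=N_G(x)\cup\{x\}$; $G\setminus S$ is the induced subgraph on $V(G)\setminus S$ and $G\setminus x=G\setminus\{x\}$. A vertex $x$ is a shedding vertex of $G$ if no independent set of vertices in $G\setminus N_G[x]$ is a maximal independent set of vertices in $G\setminus x$. A graph $G$ is vertex decomposable if (recursively) either it is totally disconnected (has no edges; the empty graph is included) or it has a shedding vertex $x$ such that $G\setminus x$ and $G\setminus N_G[x]$ are both vertex decomposable. The independence complex $\Delta_G$ is the simplicial complex on $V(G)$ whose faces are the independent sets of $G$; $G$ is Cohen-Macaulay if $\Delta_G$ is Cohen-Macaulay, i.e. its Stanley-Reisner ring over a field $k$ (fixed, arbitrary) is a Cohen-Macaulay ring. *)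

theory Defs
  imports
    "HOL-Algebra.QuotRing"
    "HOL-Algebra.Ring_Divisibility"
    "HOL-Library.Poly_Mapping"
    "HOL-Library.Extended_Nat"
    "Graph_Theory.Kuratowski"
begin

section \<open>Graphs\<close>

text \<open>
  Finite simple graphs are those of \<^locale>\<open>graph\<close>: finite, symmetric, loop-free digraphs
  without parallel arcs. Adjacency of \<open>u\<close> and \<open>v\<close> is \<open>u \<rightarrow>\<^bsub>G\<^esub> v\<close>; \<open>K\<^bsub>n\<^esub> G\<close>
  (\<^const>\<open>complete_digraph\<close>) says that \<open>G\<close> is a complete graph on \<open>n\<close> vertices.
\<close>

definition cartesian_product ::
    "('a, 'b) pre_digraph \<Rightarrow> ('c, 'd) pre_digraph \<Rightarrow> ('a \<times> 'c, ('a \<times> 'c) \<times> ('a \<times> 'c)) pre_digraph"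
    (infixr \<open>\<box>\<close> 70)
  where
  "G \<box> H = \<lparr> verts = verts G \<times> verts H,
     arcs = {((u, u'), (v, v')) | u u' v v'.
        u \<in> verts G \<and> v \<in> verts G \<and> u' \<in> verts H \<and> v' \<in> verts H \<and>
        (u = v \<and> u' \<rightarrow>\<^bsub>H\<^esub> v' \<or> u' = v' \<and> u \<rightarrow>\<^bsub>G\<^esub> v)},
     tail = fst, head = snd \<rparr>"

definition neighbours :: "('a, 'b) pre_digraph \<Rightarrow> 'a \<Rightarrow> 'a set" where
  "neighbours G x = {y \<in> verts G. x \<rightarrow>\<^bsub>G\<^esub> y}"

definition closed_neighbours :: "('a, 'b) pre_digraph \<Rightarrow> 'a \<Rightarrow> 'a set" where
  "closed_neighbours G x = neighbours G x \<union> {x}"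

definition delete_verts :: "('a, 'b) pre_digraph \<Rightarrow> 'a set \<Rightarrow> ('a, 'b) pre_digraph" where
  "delete_verts G S = G \<restriction> (verts G - S)"

definition independent_set :: "('a, 'b) pre_digraph \<Rightarrow> 'a set \<Rightarrow> bool" where
  "independent_set G S \<longleftrightarrow> S \<subseteq> verts G \<and> (\<forall>u\<in>S. \<forall>v\<in>S. \<not> u \<rightarrow>\<^bsub>G\<^esub> v)"

definition maximal_independent_set :: "('a, 'b) pre_digraph \<Rightarrow> 'a set \<Rightarrow> bool" where
  "maximal_independent_set G S \<longleftrightarrow>
     independent_set G S \<and> (\<forall>T. independent_set G T \<and> S \<subseteq> T \<longrightarrow> T = S)"

definition unmixed :: "('a, 'b) pre_digraph \<Rightarrow> bool" where
  "unmixed G \<longleftrightarrow>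
     (\<forall>S T. maximal_independent_set G S \<and> maximal_independent_set G T \<longrightarrow> card S = card T)"

definition shedding_vertex :: "('a, 'b) pre_digraph \<Rightarrow> 'a \<Rightarrow> bool" where
  "shedding_vertex G x \<longleftrightarrow> x \<in> verts G \<and>
     \<not> (\<exists>S. independent_set (delete_verts G (closed_neighbours G x)) S \<and>
            maximal_independent_set (delete_verts G {x}) S)"

inductive vertex_decomposable :: "('a, 'b) pre_digraph \<Rightarrow> bool" where
  totally_disconnected: "arcs G = {} \<Longrightarrow> vertex_decomposable G"
| shedding: "\<lbrakk>shedding_vertex G x; vertex_decomposable (delete_verts G {x});
     vertex_decomposable (delete_verts G (closed_neighbours G x))\<rbrakk> \<Longrightarrow> vertex_decomposable G"

definition independence_complex :: "('a, 'b) pre_digraph \<Rightarrow> 'a set set" where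
  "independence_complex G = {F. independent_set G F}"


section \<open>Cohen-Macaulay rings\<close>

text \<open>Fractions \<open>r/s\<close> and \<open>r'/s'\<close> agree iff \<open>t (s' r - s r') = 0\<close> for some \<open>t \<in> S\<close>.\<close>

definition frac_rel :: "('a, 'b) ring_scheme \<Rightarrow> 'a set \<Rightarrow> (('a \<times> 'a) \<times> ('a \<times> 'a)) set" where
  "frac_rel R S = {((r, s), (r', s')) | r s r' s'.
     r \<in> carrier R \<and> s \<in> S \<and> r' \<in> carrier R \<and> s' \<in> S \<and>
     (\<exists>t\<in>S. t \<otimes>\<^bsub>R\<^esub> (s' \<otimes>\<^bsub>R\<^esub> r) = t \<otimes>\<^bsub>R\<^esub> (s \<otimes>\<^bsub>R\<^esub> r'))}"

text \<open>
  The union over representatives in the two operations is a union of copies of one and the same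
  class whenever \<open>R\<close> is a commutative ring and \<open>S\<close> is multiplicatively closed.
\<close>

definition localization :: "('a, 'b) ring_scheme \<Rightarrow> 'a set \<Rightarrow> ('a \<times> 'a) set ring" where
  "localization R S = \<lparr>
     carrier = (carrier R \<times> S) // frac_rel R S,
     mult = (\<lambda>X Y. \<Union>(r, s)\<in>X. \<Union>(r', s')\<in>Y.
       frac_rel R S `` {(r \<otimes>\<^bsub>R\<^esub> r', s \<otimes>\<^bsub>R\<^esub> s')}),
     one = frac_rel R S `` {(\<one>\<^bsub>R\<^esub>, \<one>\<^bsub>R\<^esub>)},
     zero = frac_rel R S `` {(\<zero>\<^bsub>R\<^esub>, \<one>\<^bsub>R\<^esub>)},
     add = (\<lambda>X Y. \<Union>(r, s)\<in>X. \<Union>(r', s')\<in>Y.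
       frac_rel R S `` {(s' \<otimes>\<^bsub>R\<^esub> r \<oplus>\<^bsub>R\<^esub> s \<otimes>\<^bsub>R\<^esub> r', s \<otimes>\<^bsub>R\<^esub> s')}) \<rparr>"

definition localization_at :: "('a, 'b) ring_scheme \<Rightarrow> 'a set \<Rightarrow> ('a \<times> 'a) set ring" where
  "localization_at R P = localization R (carrier R - P)"

definition krull_dim :: "('a, 'b) ring_scheme \<Rightarrow> enat" where
  "krull_dim R = Sup {enat n | n. \<exists>P :: nat \<Rightarrow> 'a set.
     (\<forall>i\<le>n. primeideal (P i) R) \<and> (\<forall>i<n. P i \<subset> P (Suc i))}"

definition nonzerodivisor :: "('a, 'b) ring_scheme \<Rightarrow> 'a \<Rightarrow> bool" where
  "nonzerodivisor R a \<longleftrightarrow> a \<in> carrier R \<and>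
     (\<forall>r\<in>carrier R. a \<otimes>\<^bsub>R\<^esub> r = \<zero>\<^bsub>R\<^esub> \<longrightarrow> r = \<zero>\<^bsub>R\<^esub>)"

definition regular_sequence :: "('a, 'b) ring_scheme \<Rightarrow> 'a list \<Rightarrow> bool" where
  "regular_sequence R as \<longleftrightarrow> set as \<subseteq> carrier R \<and>
     (\<forall>i<length as. let I = Idl\<^bsub>R\<^esub> (set (take i as)) in
        nonzerodivisor (R Quot I) (I +>\<^bsub>R\<^esub> (as ! i))) \<and>
     Idl\<^bsub>R\<^esub> (set as) \<noteq> carrier R"

definition depth_in :: "('a, 'b) ring_scheme \<Rightarrow> 'a set \<Rightarrow> enat" where
  "depth_in R I = Sup {enat (length as) | as. regular_sequence R as \<and> set as \<subseteq> I}"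

text \<open>A Noetherian local ring whose depth (with respect to its maximal ideal) is its dimension.\<close>

definition cohen_macaulay_local_ring :: "('a, 'b) ring_scheme \<Rightarrow> bool" where
  "cohen_macaulay_local_ring R \<longleftrightarrow> cring R \<and> noetherian_ring R \<and>
     (\<exists>M. (\<forall>N. maximalideal N R \<longleftrightarrow> N = M) \<and> depth_in R M = krull_dim R)"

definition cohen_macaulay_ring :: "('a, 'b) ring_scheme \<Rightarrow> bool" where
  "cohen_macaulay_ring R \<longleftrightarrow> cring R \<and> noetherian_ring R \<and>
     (\<forall>M. maximalideal M R \<longrightarrow> cohen_macaulay_local_ring (localization_at R M))"


section \<open>Stanley-Reisner rings\<close>

text \<open>
  A polynomial maps exponent vectors (\<open>'v \<Rightarrow>\<^sub>0 nat\<close>) to coefficients; multiplication in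
  \<^theory>\<open>HOL-Library.Poly_Mapping\<close> is convolution, so the type operations are those of
  \<open>'k[x\<^sub>v | v]\<close> and the carrier is \<open>'k[x\<^sub>v | v \<in> V]\<close>.
\<close>

definition polynomial_ring :: "'v set \<Rightarrow> (('v \<Rightarrow>\<^sub>0 nat) \<Rightarrow>\<^sub>0 'k::field) ring" where
  "polynomial_ring V = \<lparr> carrier = {p. \<forall>m\<in>Poly_Mapping.keys p. Poly_Mapping.keys m \<subseteq> V},
     mult = (*), one = 1, zero = 0, add = (+) \<rparr>"

definition variable :: "'v \<Rightarrow> (('v \<Rightarrow>\<^sub>0 nat) \<Rightarrow>\<^sub>0 'k::field)" where
  "variable v = Poly_Mapping.single (Poly_Mapping.single v 1) 1"

definition stanley_reisner_ideal :: "'v set \<Rightarrow> 'v set set \<Rightarrow> (('v \<Rightarrow>\<^sub>0 nat) \<Rightarrow>\<^sub>0 'k::field) set" where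
  "stanley_reisner_ideal V \<Delta> =
     Idl\<^bsub>polynomial_ring V\<^esub> {\<Prod>v\<in>F. variable v | F. finite F \<and> F \<subseteq> V \<and> F \<notin> \<Delta>}"

definition stanley_reisner_ring ::
    "'k::field itself \<Rightarrow> 'v set \<Rightarrow> 'v set set \<Rightarrow> (('v \<Rightarrow>\<^sub>0 nat) \<Rightarrow>\<^sub>0 'k) set ring" where
  "stanley_reisner_ring _ V \<Delta> = polynomial_ring V Quot stanley_reisner_ideal V \<Delta>"

definition cohen_macaulay_complex :: "'k::field itself \<Rightarrow> 'v set \<Rightarrow> 'v set set \<Rightarrow> bool" where
  "cohen_macaulay_complex k V \<Delta> \<longleftrightarrow> cohen_macaulay_ring (stanley_reisner_ring k V \<Delta>)"

definition cohen_macaulay_graph :: "'k::field itself \<Rightarrow> ('a, 'b) pre_digraph \<Rightarrow> bool" where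
  "cohen_macaulay_graph k G \<longleftrightarrow> cohen_macaulay_complex k (verts G) (independence_complex G)"

end

theory Submission
  imports Defs "HOL-Computational_Algebra.Polynomial"
begin

text \<open>
  Let \<open>U\<close> be the vertex set of \<open>K\<^sub>m\<close> and \<open>h0\<close>, \<open>h1\<close> the two vertices of \<open>K\<^sub>2\<close>. The rows
  \<open>U \<times> {h0}\<close> and \<open>U \<times> {h1}\<close> of the product are cliques, and \<open>(i, h0)\<close>, \<open>(j, h1)\<close> are adjacent
  exactly when \<open>i = j\<close>. The independence complex is therefore one-dimensional: it is the crown
  graph, the complete bipartite graph on the two rows minus a perfect matching
  (\<open>independence_complex_P\<close>). All its facets \<open>{(i, h0), (j, h1)}\<close> with \<open>i \<noteq> j\<close> have two elements,
  which is unmixedness.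

  Vertex decomposability: a vertex \<open>(u, h0)\<close> of the subgraph induced on \<open>X \<times> {h0} \<union> Y \<times> {h1}\<close> is
  adjacent to its whole row, so removing its closed neighbourhood leaves part of one row, a complete
  graph. It is shedding as soon as every independent set left over, that is, the empty set or one
  vertex \<open>(v, h1)\<close>, can be enlarged by some \<open>(w, h0)\<close> with \<open>w \<noteq> u\<close> and \<open>w \<noteq> v\<close>. Fix distinct
  \<open>a\<close>, \<open>b\<close>, \<open>c\<close> in \<open>U\<close>. The first row can be reduced to \<open>{a, b}\<close>, then the second one to \<open>{c}\<close>, and
  finally \<open>a\<close> can be deleted (\<open>vertex_decomposable_rows\<close>).

  For the Cohen-Macaulay property let \<open>R = k[V]/I\<close> be the Stanley-Reisner ring. Restricting a
  polynomial to a facet, \<open>(i, h0) \<mapsto> X\<close>, \<open>(j, h1) \<mapsto> Y\<close> and every other variable to zero, gives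
  homomorphisms \<open>R \<rightarrow> k[X, Y]\<close>, one for each pair \<open>i \<noteq> j\<close>, which are jointly injective. A family
  \<open>(F\<^sub>i\<^sub>j)\<close> comes from \<open>R\<close> iff \<open>F\<^sub>i\<^sub>j(X, 0)\<close> does not depend on \<open>j\<close> and \<open>F\<^sub>i\<^sub>j(0, Y)\<close> does not
  depend on \<open>i\<close> (\<open>ex_polynomial_with_restrictions\<close>). This is where \<open>m \<ge> 3\<close> enters: the crown graph
  is then connected, so that the two conditions force all constant terms to agree. For \<open>m = 2\<close> the
  complex consists of two disjoint edges and \<open>R\<close> is not Cohen-Macaulay.

  The sums \<open>a\<close> and \<open>b\<close> of the variables of the two rows restrict to \<open>X\<close> and \<open>Y\<close> on every facet.
  If \<open>p\<close> and \<open>q\<close> are nonzero polynomials in one variable, then \<open>p(a), q(b)\<close> satisfies the two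
  cancellation conditions of a regular sequence: from \<open>q(Y) F\<^sub>i\<^sub>j = p(X) G\<^sub>i\<^sub>j\<close> one gets
  \<open>F\<^sub>i\<^sub>j = p(X) H\<^sub>i\<^sub>j\<close> and \<open>G\<^sub>i\<^sub>j = q(Y) H\<^sub>i\<^sub>j\<close>, and the family \<open>H\<close> inherits the first compatibility
  condition from \<open>F\<close> and the second one from \<open>G\<close>. Moreover a prime \<open>P\<close> of \<open>R\<close> contains all but at
  most one variable of each row, so \<open>k[a, b] \<rightarrow> R/P\<close> is onto. Consequently

  \<^item> chains of primes of \<open>R\<close> can be observed in \<open>k[X, Y]\<close>, whose dimension is at most two because any
    three elements are algebraically dependent (\<open>krull_dim_bivariate_le\<close>);
  \<^item> every maximal ideal contains some \<open>p(a)\<close> and some \<open>q(b)\<close>, by a version of Zariski's lemma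
    (\<open>maximal_ideal_contains_univariate\<close>).

  So each maximal ideal of \<open>R\<close> contains a regular sequence of length two, while \<open>dim R \<le> 2\<close>. Regular
  sequences survive localization, localization does not raise the dimension, and the depth never
  exceeds the dimension; hence every localization at a maximal ideal has depth and dimension two
  (\<open>cohen_macaulay_ringI\<close>). That \<open>R\<close> is Noetherian is Hilbert's basis theorem.
\<close>

section \<open>Ideals, quotients and regular sequences\<close>

lemma (in cring) ideal_from_closure:
  assumes "I \<subseteq> carrier R" "\<zero> \<in> I"
    and add: "\<And>x y. \<lbrakk>x \<in> I; y \<in> I\<rbrakk> \<Longrightarrow> x \<oplus> y \<in> I"
    and mult: "\<And>a x. \<lbrakk>a \<in> carrier R; x \<in> I\<rbrakk> \<Longrightarrow> a \<otimes> x \<in> I"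
  shows "ideal I R"
proof (rule idealI[OF ring_axioms])
  show "subgroup I (add_monoid R)"
  proof
    fix x assume x: "x \<in> I"
    then have "(\<ominus> \<one>) \<otimes> x \<in> I" using mult by simp
    moreover have "(\<ominus> \<one>) \<otimes> x = \<ominus> x" using x assms(1) by (metis l_minus l_one one_closed subsetD)
    ultimately show "inv\<^bsub>add_monoid R\<^esub> x \<in> I" by (simp add: a_inv_def)
  qed (use assms in auto)
next
  fix a x assume "a \<in> I" "x \<in> carrier R"
  then show "x \<otimes> a \<in> I" "a \<otimes> x \<in> I" using mult assms(1) m_comm by (metis subsetD)+
qed

lemma carrier_Quot: "carrier (R Quot I) = (\<lambda>r. I +>\<^bsub>R\<^esub> r) ` carrier R"
  by (auto simp: FactRing_simps)

lemma (in cring) nonzerodivisor_Quot_iff: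
  assumes I: "ideal I R" and a: "a \<in> carrier R"
  shows "nonzerodivisor (R Quot I) (I +> a) \<longleftrightarrow> (\<forall>r\<in>carrier R. a \<otimes> r \<in> I \<longrightarrow> r \<in> I)"
proof -
  interpret I: ideal I R by fact
  have coset0: "I +> r = I \<longleftrightarrow> r \<in> I" if "r \<in> carrier R" for r
    using that I.rcos_const_imp_mem a_rcos_zero[OF I] by blast
  note carrier_Quot[of R I]
  moreover have "(I +> a) \<otimes>\<^bsub>R Quot I\<^esub> (I +> r) = I +> (a \<otimes> r)" if "r \<in> carrier R" for r
    using that a by (simp add: FactRing_def I.rcoset_mult_add)
  moreover have "\<zero>\<^bsub>R Quot I\<^esub> = I" by (simp add: FactRing_def)
  ultimately show ?thesis
    unfolding nonzerodivisor_def using a coset0 by auto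
qed

text \<open>
  Cancellation modulo \<open>I\<close> is a statement about representatives, so regularity can be checked without
  leaving \<open>R\<close>.
\<close>
lemma (in cring) regular_sequence_iff:
  "regular_sequence R as \<longleftrightarrow> set as \<subseteq> carrier R \<and>
     (\<forall>i<length as. \<forall>r\<in>carrier R. as ! i \<otimes> r \<in> Idl (set (take i as)) \<longrightarrow>
        r \<in> Idl (set (take i as))) \<and>
     Idl (set as) \<noteq> carrier R"
proof -
  have "nonzerodivisor (R Quot (Idl (set (take i as)))) (Idl (set (take i as)) +> as ! i) \<longleftrightarrow>
      (\<forall>r\<in>carrier R. as ! i \<otimes> r \<in> Idl (set (take i as)) \<longrightarrow> r \<in> Idl (set (take i as)))"
    if "set as \<subseteq> carrier R" "i < length as" for i
    using that set_take_subset[of i as] nth_mem[of i as]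
    by (intro nonzerodivisor_Quot_iff genideal_ideal) auto
  then show ?thesis unfolding regular_sequence_def Let_def by auto
qed

section \<open>Depth is at most dimension\<close>

text \<open>
  An ideal that is maximal among those containing \<open>I\<close> and avoiding the multiplicative set \<open>T\<close> is
  prime: if \<open>a, b \<notin> P\<close>, then both \<open>P + (a)\<close> and \<open>P + (b)\<close> meet \<open>T\<close>, hence so does \<open>P + (a b)\<close>.
\<close>
lemma (in cring) prime_ideal_avoiding:
  assumes I: "ideal I R" and T: "T \<subseteq> carrier R" "\<one> \<in> T"
    and T_mult: "\<And>s t. \<lbrakk>s \<in> T; t \<in> T\<rbrakk> \<Longrightarrow> s \<otimes> t \<in> T"
    and disj: "I \<inter> T = {}"
  obtains P where "primeideal P R" "I \<subseteq> P" "P \<inter> T = {}"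
proof -
  let ?A = "{J. ideal J R \<and> I \<subseteq> J \<and> J \<inter> T = {}}"
  have "\<exists>M\<in>?A. \<forall>X\<in>?A. M \<subseteq> X \<longrightarrow> X = M"
  proof (rule subset_Zorn_nonempty)
    show "?A \<noteq> {}" using I disj by blast
  next
    fix C assume C: "C \<noteq> {}" "subset.chain ?A C"
    then have "subset.chain {J. ideal J R} C" unfolding pred_on.chain_def by blast
    from chain_Union_is_ideal[OF this] have "ideal (\<Union>C) R" using C(1) by simp
    then show "\<Union>C \<in> ?A" using C unfolding pred_on.chain_def by blast
  qed
  then obtain P where P: "ideal P R" "I \<subseteq> P" "P \<inter> T = {}"
    and max: "\<And>J. \<lbrakk>ideal J R; P \<subseteq> J; J \<inter> T = {}\<rbrakk> \<Longrightarrow> J = P"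
    by auto
  interpret P: ideal P R by (rule P(1))
  have meets: "\<exists>p\<in>P. \<exists>r\<in>carrier R. p \<oplus> r \<otimes> a \<in> T" if a: "a \<in> carrier R" "a \<notin> P" for a
  proof -
    let ?J = "P <+>\<^bsub>R\<^esub> PIdl a"
    have J: "ideal ?J R" using add_ideals P(1) cgenideal_ideal a(1) by blast
    have sub: "P \<subseteq> ?J"
    proof
      fix p assume "p \<in> P"
      moreover have "\<zero> \<in> PIdl a" using cgenideal_ideal[OF a(1)]
        by (simp add: additive_subgroup.zero_closed ideal.axioms(1))
      moreover have "p = p \<oplus> \<zero>" using \<open>p \<in> P\<close> P.Icarr by simp
      ultimately show "p \<in> ?J" unfolding set_add_def' by blast
    qed
    have "a \<in> ?J"
    proof -
      have "\<zero> \<in> P" "a \<in> PIdl a" "a = \<zero> \<oplus> a" using a cgenideal_self by auto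
      then show ?thesis unfolding set_add_def' by blast
    qed
    then have "?J \<inter> T \<noteq> {}" using max[OF J sub] a(2) by blast
    then show ?thesis unfolding set_add_def' cgenideal_def by blast
  qed
  have "primeideal P R"
  proof (rule primeidealI[OF P(1) is_cring])
    show "carrier R \<noteq> P" using P(3) T by blast
  next
    fix a b assume ab: "a \<in> carrier R" "b \<in> carrier R" "a \<otimes> b \<in> P"
    show "a \<in> P \<or> b \<in> P"
    proof (rule ccontr)
      assume "\<not> ?thesis"
      then obtain p r q s where pr: "p \<in> P" "r \<in> carrier R" "p \<oplus> r \<otimes> a \<in> T"
        and qs: "q \<in> P" "s \<in> carrier R" "q \<oplus> s \<otimes> b \<in> T"
        using meets ab by meson
      note carr = ab(1,2) pr(2) qs(2) P.Icarr[OF pr(1)] P.Icarr[OF qs(1)]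
      have "(p \<oplus> r \<otimes> a) \<otimes> (q \<oplus> s \<otimes> b) \<in> T" using pr qs T_mult by blast
      moreover have "(p \<oplus> r \<otimes> a) \<otimes> (q \<oplus> s \<otimes> b) =
          (q \<oplus> s \<otimes> b) \<otimes> p \<oplus> ((r \<otimes> a) \<otimes> q \<oplus> (r \<otimes> s) \<otimes> (a \<otimes> b))"
        using carr by algebra
      moreover have "\<dots> \<in> P"
        using P.I_l_closed[OF pr(1), of "q \<oplus> s \<otimes> b"] P.I_l_closed[OF qs(1), of "r \<otimes> a"]
          P.I_l_closed[OF ab(3), of "r \<otimes> s"] carr by simp
      ultimately show False using P(3) by auto
    qed
  qed
  with P that show thesis by blast
qed

text \<open>
  An element that is regular modulo \<open>I\<close> lies in no minimal prime of \<open>I\<close>. To obtain \<open>Q\<close> directly, avoid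
  the products \<open>a\<^sup>n s\<close> with \<open>s \<notin> P\<close>: one of them in \<open>I\<close> would, after cancelling \<open>a\<^sup>n\<close>, put \<open>s\<close> into
  \<open>I \<subseteq> P\<close>. Taking \<open>n = 0\<close> gives \<open>Q \<subseteq> P\<close>, and \<open>s = \<one>\<close>, \<open>n = 1\<close> gives \<open>a \<notin> Q\<close>.
\<close>
lemma (in cring) prime_below_avoiding_nonzerodivisor:
  assumes I: "ideal I R" and P: "primeideal P R" "I \<subseteq> P"
    and a: "a \<in> carrier R" and reg: "\<And>r. \<lbrakk>r \<in> carrier R; a \<otimes> r \<in> I\<rbrakk> \<Longrightarrow> r \<in> I"
  obtains Q where "primeideal Q R" "I \<subseteq> Q" "Q \<subseteq> P" "a \<notin> Q"
proof -
  interpret P: primeideal P R by (rule P(1))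
  let ?T = "{a [^] (n::nat) \<otimes> s | n s. s \<in> carrier R \<and> s \<notin> P}"
  have one: "\<one> \<notin> P" using P.I_notcarr P.one_imp_carrier by auto
  have memT: "a [^] (n::nat) \<otimes> s \<in> ?T" if "s \<in> carrier R" "s \<notin> P" for n s using that by blast
  have T1: "\<one> \<in> ?T" using memT[of \<one> 0] one by simp
  have cancel: "s \<in> I" if "s \<in> carrier R" "a [^] (n::nat) \<otimes> s \<in> I" for n s
    using that
  proof (induction n)
    case (Suc n)
    have "a [^] Suc n \<otimes> s = a \<otimes> (a [^] n \<otimes> s)" using a Suc.prems(1)
      by (simp add: m_ac)
    then show ?case using Suc reg a by (metis m_closed nat_pow_closed)
  qed simp
  obtain Q where Q: "primeideal Q R" "I \<subseteq> Q" "Q \<inter> ?T = {}"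
  proof (rule prime_ideal_avoiding[OF I, of ?T])
    show "?T \<subseteq> carrier R" using a by auto
    fix x y assume "x \<in> ?T" "y \<in> ?T"
    then obtain n m s t where "x = a [^] (n::nat) \<otimes> s" "y = a [^] (m::nat) \<otimes> t"
      and st: "s \<in> carrier R" "s \<notin> P" "t \<in> carrier R" "t \<notin> P" by blast
    then have "x \<otimes> y = a [^] (n + m) \<otimes> (s \<otimes> t)"
      using a by (simp add: nat_pow_mult[symmetric] m_ac)
    then show "x \<otimes> y \<in> ?T" using st P.I_prime by (metis (mono_tags, lifting) m_closed memT)
  next
    show "I \<inter> ?T = {}" using cancel P(2) by blast
  qed (use T1 in auto)
  interpret Q: primeideal Q R by (rule Q(1))
  have "Q \<subseteq> P"
  proof
    fix q assume q: "q \<in> Q"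
    show "q \<in> P"
    proof (rule ccontr)
      assume "q \<notin> P"
      with memT[of q 0] q Q.Icarr have "q \<in> ?T" by simp
      with q Q(3) show False by blast
    qed
  qed
  moreover have "a \<notin> Q" using memT[of \<one> 1] one a Q(3) by auto
  ultimately show thesis using that Q by blast
qed

text \<open>
  The chain is built downwards. Start with a prime over the ideal of the whole sequence; a prime
  over the first \<open>j + 1\<close> elements contains one over the first \<open>j\<close> elements that misses the next
  element, so each inclusion is strict.
\<close>
lemma (in cring) regular_sequence_prime_chain:
  assumes "regular_sequence R as"
  shows "\<exists>P :: nat \<Rightarrow> 'a set. (\<forall>i\<le>length as. primeideal (P i) R) \<and> (\<forall>i<length as. P i \<subset> P (Suc i))"
proof -
  let ?n = "length as" and ?I = "\<lambda>i. Idl (set (take i as))"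
  have carr: "set as \<subseteq> carrier R" and proper: "Idl (set as) \<noteq> carrier R"
    and reg: "\<And>i r. \<lbrakk>i < ?n; r \<in> carrier R; as ! i \<otimes> r \<in> ?I i\<rbrakk> \<Longrightarrow> r \<in> ?I i"
    using assms regular_sequence_iff by blast+
  have sub: "set (take i as) \<subseteq> carrier R" for i using carr set_take_subset by fast
  have I: "ideal (?I i) R" for i by (rule genideal_ideal[OF sub])
  have "\<exists>Q :: nat \<Rightarrow> 'a set. (\<forall>i\<le>k. primeideal (Q i) R) \<and> (\<forall>i<k. Q (Suc i) \<subset> Q i) \<and> ?I (?n - k) \<subseteq> Q k"
    if "k \<le> ?n" for k using that
  proof (induction k)
    case 0
    interpret In: ideal "Idl (set as)" R by (rule genideal_ideal[OF carr])
    have "\<one> \<notin> Idl (set as)" using proper In.one_imp_carrier by blast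
    then obtain P where "primeideal P R" "Idl (set as) \<subseteq> P" "P \<inter> {\<one>} = {}"
      using prime_ideal_avoiding[OF In.is_ideal, of "{\<one>}"] by auto
    then show ?case by (intro exI[of _ "\<lambda>_. P"]) simp
  next
    case (Suc k)
    then obtain Q where Q: "\<And>i. i \<le> k \<Longrightarrow> primeideal (Q i) R" "\<And>i. i < k \<Longrightarrow> Q (Suc i) \<subset> Q i"
      "?I (?n - k) \<subseteq> Q k" by auto
    define j where "j = ?n - Suc k"
    have j: "j < ?n" "?n - k = Suc j" using Suc.prems by (auto simp: j_def)
    have aj: "as ! j \<in> carrier R" using carr nth_mem[OF j(1)] by blast
    have take_Suc: "set (take (Suc j) as) = insert (as ! j) (set (take j as))"
      using j(1) by (simp add: take_Suc_conv_app_nth)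
    have "?I j \<subseteq> ?I (Suc j)" by (rule subset_Idl_subset[OF sub]) (simp add: take_Suc subset_insertI)
    moreover have "as ! j \<in> ?I (Suc j)" using genideal_self[OF sub[of "Suc j"]] take_Suc by simp
    ultimately have IQ: "?I j \<subseteq> Q k" "as ! j \<in> Q k" using Q(3) j by auto
    obtain P where P: "primeideal P R" "?I j \<subseteq> P" "P \<subseteq> Q k" "as ! j \<notin> P"
      using prime_below_avoiding_nonzerodivisor[OF I Q(1)[OF order_refl] IQ(1) aj] reg j(1) by blast
    then have "P \<subset> Q k" using IQ(2) by blast
    then show ?case
      using P Q by (intro exI[of _ "Q(Suc k := P)"]) (auto simp: j_def less_Suc_eq le_Suc_eq)
  qed
  from this[of ?n] obtain Q where Q: "\<And>i. i \<le> ?n \<Longrightarrow> primeideal (Q i) R"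
    "\<And>i. i < ?n \<Longrightarrow> Q (Suc i) \<subset> Q i" by auto
  have "Q (?n - i) \<subset> Q (?n - Suc i)" if "i < ?n" for i
    using Q(2)[of "?n - Suc i"] that by (simp add: Suc_diff_Suc)
  then show ?thesis using Q(1) by (intro exI[of _ "\<lambda>i. Q (?n - i)"]) auto
qed

lemma (in cring) depth_in_le_krull_dim: "depth_in R I \<le> krull_dim R"
  unfolding depth_in_def
proof (rule Sup_least, clarify)
  fix as assume "regular_sequence R as"
  from regular_sequence_prime_chain[OF this]
  show "enat (length as) \<le> krull_dim R"
    unfolding krull_dim_def by (intro Sup_upper) blast
qed

text \<open>
  Primes always contract to primes. The hypothesis is what keeps the contracted chain strict; it
  holds both for localizations and for the map from polynomials in two variables used below.
\<close>
lemma krull_dim_le_if_contractions_strict: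
  fixes R :: "('a, 'b) ring_scheme" and S :: "('c, 'd) ring_scheme"
  assumes hom: "ring_hom_ring R S h" and R: "cring R"
    and strict: "\<And>P Q. \<lbrakk>primeideal P S; primeideal Q S; P \<subset> Q\<rbrakk> \<Longrightarrow> \<exists>r\<in>carrier R. h r \<in> Q \<and> h r \<notin> P"
  shows "krull_dim S \<le> krull_dim R"
  unfolding krull_dim_def
proof (rule Sup_least, clarify)
  interpret ring_hom_ring R S h by (rule hom)
  fix n and P :: "nat \<Rightarrow> 'c set"
  assume P: "\<forall>i\<le>n. primeideal (P i) S" "\<forall>i<n. P i \<subset> P (Suc i)"
  let ?Q = "\<lambda>i. {r \<in> carrier R. h r \<in> P i}"
  have "primeideal (?Q i) R" if "i \<le> n" for i
    using primeideal_vimage[OF R] P(1) that by blast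
  moreover have "?Q i \<subset> ?Q (Suc i)" if i: "i < n" for i
  proof -
    have "primeideal (P i) S" "primeideal (P (Suc i)) S" "P i \<subset> P (Suc i)" using P i by auto
    from strict[OF this] obtain r where r: "r \<in> carrier R" "h r \<in> P (Suc i)" "h r \<notin> P i"
      by (elim bexE conjE)
    have "?Q i \<subseteq> ?Q (Suc i)" using \<open>P i \<subset> P (Suc i)\<close> by auto
    moreover have "r \<in> ?Q (Suc i)" "r \<notin> ?Q i" using r by simp_all
    ultimately show ?thesis by blast
  qed
  ultimately have "\<exists>Q :: nat \<Rightarrow> 'a set. (\<forall>i\<le>n. primeideal (Q i) R) \<and> (\<forall>i<n. Q i \<subset> Q (Suc i))"
    by (intro exI[of _ ?Q] conjI allI impI)
  then show "enat n \<le> Sup {enat n | n. \<exists>P :: nat \<Rightarrow> 'a set. (\<forall>i\<le>n. primeideal (P i) R) \<and> (\<forall>i<n. P i \<subset> P (Suc i))}"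
    by (intro Sup_upper) blast
qed

section \<open>Localization\<close>

text \<open>
  Once the ring axioms of \<open>L = S\<^sup>-\<^sup>1 R\<close> are available, everything about \<open>L\<close> follows from three
  facts about \<open>to_frac : R \<rightarrow> L\<close>: it turns \<open>S\<close> into units, every element of \<open>L\<close> acquires a numerator
  after multiplication by the image of some \<open>s \<in> S\<close>, and elements are identified only if some
  \<open>t \<in> S\<close> identifies them.
\<close>
locale localized_cring = cring R for R (structure) +
  fixes S
  assumes S_sub: "S \<subseteq> carrier R" and one_S: "\<one> \<in> S"
    and mult_S: "\<lbrakk>s \<in> S; t \<in> S\<rbrakk> \<Longrightarrow> s \<otimes> t \<in> S"
begin

abbreviation frac :: "'a \<Rightarrow> 'a \<Rightarrow> ('a \<times> 'a) set" where
  "frac r s \<equiv> frac_rel R S `` {(r, s)}"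

abbreviation L :: "('a \<times> 'a) set ring" where
  "L \<equiv> localization R S"

lemma S_carr: "s \<in> S \<Longrightarrow> s \<in> carrier R"
  using S_sub by blast

lemma equiv_frac_rel: "equiv (carrier R \<times> S) (frac_rel R S)"
proof (rule equivI)
  show "frac_rel R S \<subseteq> (carrier R \<times> S) \<times> (carrier R \<times> S)"
    unfolding frac_rel_def by auto
  show "refl_on (carrier R \<times> S) (frac_rel R S)"
    unfolding refl_on_def frac_rel_def using one_S by auto
  show "sym (frac_rel R S)"
    unfolding sym_def frac_rel_def by (auto intro: sym)
  show "trans (frac_rel R S)"
  proof (rule transI, clarify)
    fix r s r' s' r'' s''
    assume "((r, s), (r', s')) \<in> frac_rel R S" "((r', s'), (r'', s'')) \<in> frac_rel R S"
    then obtain t u where carr: "r \<in> carrier R" "r' \<in> carrier R" "r'' \<in> carrier R"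
      and S: "s \<in> S" "s' \<in> S" "s'' \<in> S" "t \<in> S" "u \<in> S"
      and t: "t \<otimes> (s' \<otimes> r) = t \<otimes> (s \<otimes> r')" and u: "u \<otimes> (s'' \<otimes> r') = u \<otimes> (s' \<otimes> r'')"
      unfolding frac_rel_def by auto
    note carr = carr S[THEN S_carr]
    have "(t \<otimes> u \<otimes> s') \<otimes> (s'' \<otimes> r) = u \<otimes> s'' \<otimes> (t \<otimes> (s' \<otimes> r))"
      using carr by (simp add: m_ac)
    also have "\<dots> = t \<otimes> s \<otimes> (u \<otimes> (s'' \<otimes> r'))" using carr by (simp add: t) (simp add: m_ac)
    also have "\<dots> = (t \<otimes> u \<otimes> s') \<otimes> (s \<otimes> r'')" using carr by (simp add: u) (simp add: m_ac)
    finally have "(t \<otimes> u \<otimes> s') \<otimes> (s'' \<otimes> r) = (t \<otimes> u \<otimes> s') \<otimes> (s \<otimes> r'')" .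
    moreover have "t \<otimes> u \<otimes> s' \<in> S" using S mult_S by blast
    ultimately show "((r, s), (r'', s'')) \<in> frac_rel R S"
      unfolding frac_rel_def using carr S by blast
  qed
qed

lemma frac_eq_iff:
  assumes "r \<in> carrier R" "s \<in> S" "r' \<in> carrier R" "s' \<in> S"
  shows "frac r s = frac r' s' \<longleftrightarrow> (\<exists>t\<in>S. t \<otimes> (s' \<otimes> r) = t \<otimes> (s \<otimes> r'))"
  using assms eq_equiv_class_iff[OF equiv_frac_rel, of "(r, s)" "(r', s')"]
  by (auto simp: frac_rel_def)

lemma frac_eqI:
  assumes "r \<in> carrier R" "s \<in> S" "r' \<in> carrier R" "s' \<in> S" "s' \<otimes> r = s \<otimes> r'"
  shows "frac r s = frac r' s'"
  using assms frac_eq_iff one_S by (metis l_one m_closed S_carr)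

lemma frac_cases:
  assumes "x \<in> carrier L"
  obtains r s where "r \<in> carrier R" "s \<in> S" "x = frac r s"
  using assms by (auto simp: localization_def quotient_def)

lemma frac_closed: "\<lbrakk>r \<in> carrier R; s \<in> S\<rbrakk> \<Longrightarrow> frac r s \<in> carrier L"
  by (auto simp: localization_def quotient_def)

text \<open>
  The operations of the localization are unions over all representatives of the operands. Such a
  union collapses when every representative contributes the same class.
\<close>
lemma frac_UN:
  assumes r: "r \<in> carrier R" "s \<in> S"
    and f: "\<And>r' s'. \<lbrakk>r' \<in> carrier R; s' \<in> S; frac r' s' = frac r s\<rbrakk> \<Longrightarrow> f (r', s') = c"
  shows "(\<Union>p\<in>frac r s. f p) = c"
proof -
  have f_const: "f p = c" if "p \<in> frac r s" for p
  proof -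
    obtain r' s' where p: "p = (r', s')" by (cases p)
    with that have *: "((r, s), (r', s')) \<in> frac_rel R S" by simp
    then have "r' \<in> carrier R" "s' \<in> S" unfolding frac_rel_def by blast+
    moreover have "frac r' s' = frac r s" using equiv_class_eq[OF equiv_frac_rel *] by (rule sym)
    ultimately show ?thesis unfolding p by (rule f)
  qed
  have "(r, s) \<in> frac r s" by (rule equiv_class_self[OF equiv_frac_rel]) (simp add: r)
  then have "frac r s \<noteq> {}" by (rule ex_in_conv[THEN iffD1, OF exI])
  then show ?thesis by (rule SUP_eq_const[of "frac r s" f c]) (erule f_const)
qed

lemma frac_mult:
  assumes "r \<in> carrier R" "s \<in> S" "r' \<in> carrier R" "s' \<in> S"
  shows "frac r s \<otimes>\<^bsub>L\<^esub> frac r' s' = frac (r \<otimes> r') (s \<otimes> s')"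
proof -
  have wd: "frac (a \<otimes> a') (b \<otimes> b') = frac (r \<otimes> r') (s \<otimes> s')"
    if ab: "a \<in> carrier R" "b \<in> S" "frac a b = frac r s"
      and ab': "a' \<in> carrier R" "b' \<in> S" "frac a' b' = frac r' s'" for a b a' b'
  proof -
    obtain t where t: "t \<in> S" "t \<otimes> (s \<otimes> a) = t \<otimes> (b \<otimes> r)"
      using ab(3) unfolding frac_eq_iff[OF ab(1,2) assms(1,2)] by blast
    obtain u where u: "u \<in> S" "u \<otimes> (s' \<otimes> a') = u \<otimes> (b' \<otimes> r')"
      using ab'(3) unfolding frac_eq_iff[OF ab'(1,2) assms(3,4)] by blast
    note tu = t(1) u(1) t(2) u(2)
    note carr = assms(1,3) assms(2,4)[THEN S_carr] ab(1) ab'(1) S_carr[OF ab(2)] S_carr[OF ab'(2)]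
      tu(1,2)[THEN S_carr]
    have "(t \<otimes> u) \<otimes> ((s \<otimes> s') \<otimes> (a \<otimes> a')) = (t \<otimes> (s \<otimes> a)) \<otimes> (u \<otimes> (s' \<otimes> a'))"
      using carr by (simp add: m_ac)
    also have "\<dots> = (t \<otimes> u) \<otimes> ((b \<otimes> b') \<otimes> (r \<otimes> r'))"
      unfolding tu using carr by (simp add: m_ac)
    finally have eq: "(t \<otimes> u) \<otimes> ((s \<otimes> s') \<otimes> (a \<otimes> a')) = (t \<otimes> u) \<otimes> ((b \<otimes> b') \<otimes> (r \<otimes> r'))" .
    show ?thesis
      using assms ab(1,2) ab'(1,2) mult_S
      by (intro frac_eq_iff[THEN iffD2] bexI[of _ "t \<otimes> u"] eq mult_S tu a_closed m_closed)
        (simp_all add: S_carr)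
  qed
  have "frac r s \<otimes>\<^bsub>L\<^esub> frac r' s' =
      (\<Union>(a, b)\<in>frac r s. \<Union>(a', b')\<in>frac r' s'. frac (a \<otimes> a') (b \<otimes> b'))"
    by (simp add: localization_def)
  also have "\<dots> = frac (r \<otimes> r') (s \<otimes> s')"
  proof (rule frac_UN[OF assms(1,2)], unfold prod.case)
    fix a b assume ab: "a \<in> carrier R" "b \<in> S" "frac a b = frac r s"
    show "(\<Union>(a', b')\<in>frac r' s'. frac (a \<otimes> a') (b \<otimes> b')) = frac (r \<otimes> r') (s \<otimes> s')"
      by (rule frac_UN[OF assms(3,4)], unfold prod.case) (rule wd[OF ab])
  qed
  finally show ?thesis .
qed

lemma frac_add:
  assumes "r \<in> carrier R" "s \<in> S" "r' \<in> carrier R" "s' \<in> S"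
  shows "frac r s \<oplus>\<^bsub>L\<^esub> frac r' s' = frac (s' \<otimes> r \<oplus> s \<otimes> r') (s \<otimes> s')"
proof -
  have wd: "frac (b' \<otimes> a \<oplus> b \<otimes> a') (b \<otimes> b') = frac (s' \<otimes> r \<oplus> s \<otimes> r') (s \<otimes> s')"
    if ab: "a \<in> carrier R" "b \<in> S" "frac a b = frac r s"
      and ab': "a' \<in> carrier R" "b' \<in> S" "frac a' b' = frac r' s'" for a b a' b'
  proof -
    obtain t where t: "t \<in> S" "t \<otimes> (s \<otimes> a) = t \<otimes> (b \<otimes> r)"
      using ab(3) unfolding frac_eq_iff[OF ab(1,2) assms(1,2)] by blast
    obtain u where u: "u \<in> S" "u \<otimes> (s' \<otimes> a') = u \<otimes> (b' \<otimes> r')"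
      using ab'(3) unfolding frac_eq_iff[OF ab'(1,2) assms(3,4)] by blast
    note tu = t(1) u(1) t(2) u(2)
    note carr = assms(1,3) assms(2,4)[THEN S_carr] ab(1) ab'(1) S_carr[OF ab(2)] S_carr[OF ab'(2)]
      tu(1,2)[THEN S_carr]
    have "(t \<otimes> u) \<otimes> ((s \<otimes> s') \<otimes> (b' \<otimes> a \<oplus> b \<otimes> a')) =
        (u \<otimes> (s' \<otimes> b')) \<otimes> (t \<otimes> (s \<otimes> a)) \<oplus> (t \<otimes> (s \<otimes> b)) \<otimes> (u \<otimes> (s' \<otimes> a'))"
      using carr by (simp add: r_distr m_ac)
    also have "\<dots> = (t \<otimes> u) \<otimes> ((b \<otimes> b') \<otimes> (s' \<otimes> r \<oplus> s \<otimes> r'))"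
      unfolding tu using carr by (simp add: r_distr m_ac)
    finally have eq: "(t \<otimes> u) \<otimes> ((s \<otimes> s') \<otimes> (b' \<otimes> a \<oplus> b \<otimes> a')) =
        (t \<otimes> u) \<otimes> ((b \<otimes> b') \<otimes> (s' \<otimes> r \<oplus> s \<otimes> r'))" .
    show ?thesis
      using assms ab(1,2) ab'(1,2) mult_S S_carr
      by (intro frac_eq_iff[THEN iffD2] bexI[of _ "t \<otimes> u"] eq mult_S tu a_closed m_closed)
        (simp_all add: S_carr)
  qed
  have "frac r s \<oplus>\<^bsub>L\<^esub> frac r' s' =
      (\<Union>(a, b)\<in>frac r s. \<Union>(a', b')\<in>frac r' s'. frac (b' \<otimes> a \<oplus> b \<otimes> a') (b \<otimes> b'))"
    by (simp add: localization_def)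
  also have "\<dots> = frac (s' \<otimes> r \<oplus> s \<otimes> r') (s \<otimes> s')"
  proof (rule frac_UN[OF assms(1,2)], unfold prod.case)
    fix a b assume ab: "a \<in> carrier R" "b \<in> S" "frac a b = frac r s"
    show "(\<Union>(a', b')\<in>frac r' s'. frac (b' \<otimes> a \<oplus> b \<otimes> a') (b \<otimes> b')) = frac (s' \<otimes> r \<oplus> s \<otimes> r') (s \<otimes> s')"
      by (rule frac_UN[OF assms(3,4)], unfold prod.case) (rule wd[OF ab])
  qed
  finally show ?thesis .
qed

lemma frac_one: "\<one>\<^bsub>L\<^esub> = frac \<one> \<one>" and frac_zero: "\<zero>\<^bsub>L\<^esub> = frac \<zero> \<one>"
  by (simp_all add: localization_def)

lemma localization_cring: "cring L"
proof (rule cringI)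
  show "abelian_group L"
  proof (rule abelian_groupI)
    fix x assume "x \<in> carrier L"
    then obtain r s where x: "r \<in> carrier R" "s \<in> S" "x = frac r s" by (rule frac_cases)
    then have "frac (\<ominus> r) s \<oplus>\<^bsub>L\<^esub> x = \<zero>\<^bsub>L\<^esub>"
      by (simp add: frac_add frac_zero) (rule frac_eqI; simp add: mult_S one_S S_carr r_minus l_neg)
    then show "\<exists>y\<in>carrier L. y \<oplus>\<^bsub>L\<^esub> x = \<zero>\<^bsub>L\<^esub>" using frac_closed x by blast
    show "\<zero>\<^bsub>L\<^esub> \<oplus>\<^bsub>L\<^esub> x = x" unfolding frac_zero x(3) using x one_S
      by (simp add: frac_add S_carr)
    fix y assume "y \<in> carrier L"
    then obtain r' s' where y: "r' \<in> carrier R" "s' \<in> S" "y = frac r' s'" by (rule frac_cases)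
    show "x \<oplus>\<^bsub>L\<^esub> y \<in> carrier L" unfolding x(3) y(3) using x y
      by (simp add: frac_add frac_closed mult_S S_carr)
    show "x \<oplus>\<^bsub>L\<^esub> y = y \<oplus>\<^bsub>L\<^esub> x" unfolding x(3) y(3) using x y
      by (simp add: frac_add S_carr m_comm a_comm)
    fix z assume "z \<in> carrier L"
    then obtain r'' s'' where z: "r'' \<in> carrier R" "s'' \<in> S" "z = frac r'' s''" by (rule frac_cases)
    show "x \<oplus>\<^bsub>L\<^esub> y \<oplus>\<^bsub>L\<^esub> z = x \<oplus>\<^bsub>L\<^esub> (y \<oplus>\<^bsub>L\<^esub> z)" unfolding x(3) y(3) z(3) using x y z
      by (simp add: frac_add mult_S S_carr)
        (rule frac_eqI; simp add: mult_S S_carr r_distr m_ac a_ac)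
  next
    show "\<zero>\<^bsub>L\<^esub> \<in> carrier L" unfolding frac_zero using one_S by (simp add: frac_closed)
  qed
  show "Group.comm_monoid L"
  proof (rule comm_monoidI)
    show "\<one>\<^bsub>L\<^esub> \<in> carrier L" unfolding frac_one using one_S by (simp add: frac_closed)
    fix x assume "x \<in> carrier L"
    then obtain r s where x: "r \<in> carrier R" "s \<in> S" "x = frac r s" by (rule frac_cases)
    show "\<one>\<^bsub>L\<^esub> \<otimes>\<^bsub>L\<^esub> x = x" unfolding frac_one x(3) using x one_S
      by (simp add: frac_mult S_carr)
    fix y assume "y \<in> carrier L"
    then obtain r' s' where y: "r' \<in> carrier R" "s' \<in> S" "y = frac r' s'" by (rule frac_cases)
    show "x \<otimes>\<^bsub>L\<^esub> y \<in> carrier L" unfolding x(3) y(3) using x y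
      by (simp add: frac_mult frac_closed mult_S)
    show "x \<otimes>\<^bsub>L\<^esub> y = y \<otimes>\<^bsub>L\<^esub> x" unfolding x(3) y(3) using x y
      by (simp add: frac_mult S_carr m_comm)
    fix z assume "z \<in> carrier L"
    then obtain r'' s'' where z: "r'' \<in> carrier R" "s'' \<in> S" "z = frac r'' s''" by (rule frac_cases)
    show "x \<otimes>\<^bsub>L\<^esub> y \<otimes>\<^bsub>L\<^esub> z = x \<otimes>\<^bsub>L\<^esub> (y \<otimes>\<^bsub>L\<^esub> z)" unfolding x(3) y(3) z(3) using x y z
      by (simp add: frac_mult mult_S S_carr m_assoc)
  qed
next
  fix x y z assume "x \<in> carrier L" "y \<in> carrier L" "z \<in> carrier L"
  then obtain r s r' s' r'' s'' where
    x: "r \<in> carrier R" "s \<in> S" "x = frac r s" and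
    y: "r' \<in> carrier R" "s' \<in> S" "y = frac r' s'" and
    z: "r'' \<in> carrier R" "s'' \<in> S" "z = frac r'' s''" by (meson frac_cases)
  show "(x \<oplus>\<^bsub>L\<^esub> y) \<otimes>\<^bsub>L\<^esub> z = x \<otimes>\<^bsub>L\<^esub> z \<oplus>\<^bsub>L\<^esub> y \<otimes>\<^bsub>L\<^esub> z"
    unfolding x(3) y(3) z(3) using x y z
    by (simp add: frac_mult frac_add mult_S S_carr)
      (rule frac_eqI; simp add: mult_S S_carr r_distr l_distr m_ac)
qed

definition to_frac :: "'a \<Rightarrow> ('a \<times> 'a) set" where
  "to_frac r = frac r \<one>"

sublocale L: cring L
  by (rule localization_cring)

lemma to_frac_hom: "to_frac \<in> ring_hom R L"
  by (rule ring_hom_memI)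
    (auto simp: to_frac_def frac_closed frac_mult frac_add frac_one one_S)

sublocale to_frac: ring_hom_ring R L to_frac
  by unfold_locales (rule to_frac_hom)

lemma to_frac_Units:
  assumes "s \<in> S" shows "to_frac s \<in> Units L"
proof -
  have "frac \<one> s \<otimes>\<^bsub>L\<^esub> to_frac s = \<one>\<^bsub>L\<^esub>" unfolding to_frac_def frac_one
    using assms one_S by (simp add: frac_mult S_carr) (rule frac_eqI; simp add: S_carr)
  then show ?thesis
    using assms frac_closed[of \<one> s] S_carr L.m_comm[of "frac \<one> s" "to_frac s"] to_frac.hom_closed
    unfolding Units_def by blast
qed

lemma denominator:
  assumes "z \<in> carrier L"
  obtains r s where "r \<in> carrier R" "s \<in> S" "z \<otimes>\<^bsub>L\<^esub> to_frac s = to_frac r"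
proof -
  obtain r s where z: "r \<in> carrier R" "s \<in> S" "z = frac r s" using assms by (rule frac_cases)
  have "z \<otimes>\<^bsub>L\<^esub> to_frac s = to_frac r" unfolding to_frac_def z(3)
    using z one_S by (simp add: frac_mult S_carr) (rule frac_eqI; simp add: S_carr m_ac)
  with z that show thesis by blast
qed

lemma to_frac_eq_iff:
  assumes "r \<in> carrier R" "r' \<in> carrier R"
  shows "to_frac r = to_frac r' \<longleftrightarrow> (\<exists>t\<in>S. t \<otimes> r = t \<otimes> r')"
  using assms one_S unfolding to_frac_def by (simp add: frac_eq_iff)

end

text \<open>
  A proper ideal contains no unit, so it lies inside \<open>N\<close>.
\<close>
lemma (in cring) unique_maximalideal:
  assumes N: "ideal N R" "\<one> \<notin> N" and units: "\<And>z. z \<in> carrier R - N \<Longrightarrow> z \<in> Units R"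
  shows "maximalideal K R \<longleftrightarrow> K = N"
proof -
  interpret N: ideal N R by (rule N(1))
  have proper_sub: "J \<subseteq> N" if J: "ideal J R" "J \<noteq> carrier R" for J
  proof
    fix z assume z: "z \<in> J"
    interpret J: ideal J R by (rule J(1))
    show "z \<in> N"
    proof (rule ccontr)
      assume "z \<notin> N"
      then have u: "z \<in> Units R" using units z J.Icarr by blast
      then have "inv z \<otimes> z \<in> J" by (intro J.I_l_closed[OF z] Units_inv_closed)
      then have "\<one> \<in> J" by (simp add: u)
      then show False using J.one_imp_carrier J(2) by blast
    qed
  qed
  have NR: "N \<noteq> carrier R" using N(2) by auto
  have max: "maximalideal N R"
    by (rule maximalidealI[OF N(1)]) (use NR proper_sub in auto)
  moreover have "K = N" if K: "maximalideal K R"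
  proof -
    interpret K: maximalideal K R by (rule K)
    show ?thesis using K.I_maximal[OF N(1)] proper_sub[OF K.is_ideal] K.I_notcarr NR N.a_subset by blast
  qed
  ultimately show ?thesis by blast
qed

context localized_cring
begin

lemma ideal_mem_denominator_iff:
  assumes J: "ideal J L" and z: "z \<in> carrier L" and s: "s \<in> S"
  shows "z \<otimes>\<^bsub>L\<^esub> to_frac s \<in> J \<longleftrightarrow> z \<in> J"
proof
  interpret J: ideal J L by (rule J)
  have u: "to_frac s \<in> Units L" by (rule to_frac_Units[OF s])
  assume "z \<otimes>\<^bsub>L\<^esub> to_frac s \<in> J"
  then have "z \<otimes>\<^bsub>L\<^esub> to_frac s \<otimes>\<^bsub>L\<^esub> inv\<^bsub>L\<^esub> to_frac s \<in> J" using u J.I_r_closed L.Units_inv_closed by blast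
  then show "z \<in> J" using u z by (simp add: L.m_assoc L.Units_closed)
next
  interpret J: ideal J L by (rule J)
  assume "z \<in> J"
  then show "z \<otimes>\<^bsub>L\<^esub> to_frac s \<in> J" using J.I_r_closed s S_carr to_frac.hom_closed by blast
qed

text \<open>
  Ideals of a localization are determined by their contractions, since each element has a numerator
  that differs from it by a unit.
\<close>
lemma ideal_le_if_contraction_le:
  assumes "ideal J L" "ideal K L"
    and sub: "\<And>r. \<lbrakk>r \<in> carrier R; to_frac r \<in> J\<rbrakk> \<Longrightarrow> to_frac r \<in> K"
  shows "J \<subseteq> K"
proof
  fix z assume z: "z \<in> J"
  then have zL: "z \<in> carrier L" using assms(1) ideal.Icarr by fast
  obtain r s where rs: "r \<in> carrier R" "s \<in> S" "z \<otimes>\<^bsub>L\<^esub> to_frac s = to_frac r"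
    using denominator[OF zL] .
  then show "z \<in> K"
    using ideal_mem_denominator_iff[OF assms(1) zL rs(2)] ideal_mem_denominator_iff[OF assms(2) zL rs(2)]
      sub[OF rs(1)] z by simp
qed

lemma krull_dim_localization_le: "krull_dim L \<le> krull_dim R"
proof (rule krull_dim_le_if_contractions_strict[OF to_frac.ring_hom_ring_axioms is_cring])
  fix P Q assume P: "primeideal P L" and Q: "primeideal Q L" and "P \<subset> Q"
  then have "\<not> Q \<subseteq> P" by blast
  then show "\<exists>r\<in>carrier R. to_frac r \<in> Q \<and> to_frac r \<notin> P"
    using ideal_le_if_contraction_le[OF primeideal.axioms(1)[OF Q] primeideal.axioms(1)[OF P]] by blast
qed

text \<open>
  The ideal generated in \<open>L\<close> by the image of \<open>A\<close> consists of the fractions with numerator in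
  \<open>Idl A\<close>; this is the set \<open>?K\<close> of the proof.
\<close>
lemma to_frac_mem_Idl_iff:
  assumes A: "A \<subseteq> carrier R" and r: "r \<in> carrier R"
  shows "to_frac r \<in> Idl\<^bsub>L\<^esub> (to_frac ` A) \<longleftrightarrow> (\<exists>t\<in>S. t \<otimes> r \<in> Idl A)"
proof
  have iA: "to_frac ` A \<subseteq> carrier L" using A to_frac.hom_closed by blast
  interpret J: ideal "Idl\<^bsub>L\<^esub> (to_frac ` A)" L by (rule L.genideal_ideal[OF iA])
  interpret I: ideal "Idl A" R by (rule genideal_ideal[OF A])
  {
    assume "\<exists>t\<in>S. t \<otimes> r \<in> Idl A"
    then obtain t where t: "t \<in> S" "t \<otimes> r \<in> Idl A" by blast
    have "Idl A \<subseteq> {r \<in> carrier R. to_frac r \<in> Idl\<^bsub>L\<^esub> (to_frac ` A)}"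
      by (rule genideal_minimal[OF to_frac.ideal_vimage[OF J.is_ideal]])
        (use A L.genideal_self[OF iA] in blast)
    then have "to_frac (t \<otimes> r) \<in> Idl\<^bsub>L\<^esub> (to_frac ` A)" using t(2) by blast
    then have "to_frac r \<otimes>\<^bsub>L\<^esub> to_frac t \<in> Idl\<^bsub>L\<^esub> (to_frac ` A)"
      using t(1) r S_carr by (simp add: L.m_comm)
    then show "to_frac r \<in> Idl\<^bsub>L\<^esub> (to_frac ` A)"
      using ideal_mem_denominator_iff[OF J.is_ideal] r t(1) to_frac.hom_closed by blast
  }
  let ?K = "{z \<in> carrier L. \<exists>r\<in>Idl A. \<exists>s\<in>S. z \<otimes>\<^bsub>L\<^esub> to_frac s = to_frac r}"
  have KI: "z \<in> ?K" if "z \<in> carrier L" "r \<in> Idl A" "s \<in> S" "z \<otimes>\<^bsub>L\<^esub> to_frac s = to_frac r" for z r s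
    using that by blast
  have K: "ideal ?K L"
  proof (rule L.ideal_from_closure)
    show "\<zero>\<^bsub>L\<^esub> \<in> ?K" by (rule KI[of _ \<zero> \<one>]) (simp_all add: one_S)
  next
    fix x y assume "x \<in> ?K" "y \<in> ?K"
    then obtain r s r' s' where x: "x \<in> carrier L" "r \<in> Idl A" "s \<in> S" "x \<otimes>\<^bsub>L\<^esub> to_frac s = to_frac r"
      and y: "y \<in> carrier L" "r' \<in> Idl A" "s' \<in> S" "y \<otimes>\<^bsub>L\<^esub> to_frac s' = to_frac r'" by blast
    note carr = I.Icarr[OF x(2)] I.Icarr[OF y(2)] S_carr[OF x(3)] S_carr[OF y(3)]
    have "(x \<oplus>\<^bsub>L\<^esub> y) \<otimes>\<^bsub>L\<^esub> to_frac (s \<otimes> s') =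
        (x \<otimes>\<^bsub>L\<^esub> to_frac s) \<otimes>\<^bsub>L\<^esub> to_frac s' \<oplus>\<^bsub>L\<^esub> (y \<otimes>\<^bsub>L\<^esub> to_frac s') \<otimes>\<^bsub>L\<^esub> to_frac s"
      using x(1) y(1) carr by (simp add: L.l_distr L.m_assoc L.m_comm[of "to_frac s'"])
    also have "\<dots> = to_frac (r \<otimes> s' \<oplus> r' \<otimes> s)"
      unfolding x(4) y(4) using carr by simp
    finally show "x \<oplus>\<^bsub>L\<^esub> y \<in> ?K"
      using x y carr mult_S by (intro KI[of _ "r \<otimes> s' \<oplus> r' \<otimes> s" "s \<otimes> s'"]) (auto intro: I.I_r_closed)
  next
    fix a x assume a: "a \<in> carrier L" and "x \<in> ?K"
    then obtain r s where x: "x \<in> carrier L" "r \<in> Idl A" "s \<in> S" "x \<otimes>\<^bsub>L\<^esub> to_frac s = to_frac r"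
      by blast
    obtain r' s' where r': "r' \<in> carrier R" "s' \<in> S" "a \<otimes>\<^bsub>L\<^esub> to_frac s' = to_frac r'"
      using denominator[OF a] .
    note carr = I.Icarr[OF x(2)] r'(1) S_carr[OF x(3)] S_carr[OF r'(2)]
    have "(a \<otimes>\<^bsub>L\<^esub> x) \<otimes>\<^bsub>L\<^esub> to_frac (s' \<otimes> s) = (a \<otimes>\<^bsub>L\<^esub> to_frac s') \<otimes>\<^bsub>L\<^esub> (x \<otimes>\<^bsub>L\<^esub> to_frac s)"
      using x(1) a carr by (simp add: L.m_ac)
    also have "\<dots> = to_frac (r' \<otimes> r)" unfolding r'(3) x(4) using carr by simp
    finally show "a \<otimes>\<^bsub>L\<^esub> x \<in> ?K"
      using x r' a carr mult_S by (intro KI[of _ "r' \<otimes> r" "s' \<otimes> s"]) (auto intro: I.I_l_closed)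
  qed auto
  assume "to_frac r \<in> Idl\<^bsub>L\<^esub> (to_frac ` A)"
  moreover have "to_frac ` A \<subseteq> ?K"
  proof (rule image_subsetI)
    fix a assume a: "a \<in> A"
    show "to_frac a \<in> ?K"
      using a A genideal_self[OF A] by (intro KI[of _ a \<one>]) (auto simp: one_S)
  qed
  ultimately have "to_frac r \<in> ?K" using L.genideal_minimal[OF K] by blast
  then obtain r' s where r': "r' \<in> Idl A" "s \<in> S" "to_frac r \<otimes>\<^bsub>L\<^esub> to_frac s = to_frac r'" by blast
  note carr = r I.Icarr[OF r'(1)] S_carr[OF r'(2)]
  from r'(3) have "to_frac (r \<otimes> s) = to_frac r'" using carr by simp
  then obtain t where t: "t \<in> S" "t \<otimes> (r \<otimes> s) = t \<otimes> r'" using to_frac_eq_iff[of "r \<otimes> s" r'] carr by blast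
  have "(t \<otimes> s) \<otimes> r = t \<otimes> r'" using t carr S_carr by (simp add: m_ac)
  moreover have "t \<otimes> r' \<in> Idl A" using I.I_l_closed[OF r'(1)] t(1) S_carr by blast
  ultimately show "\<exists>t\<in>S. t \<otimes> r \<in> Idl A" using mult_S[OF t(1) r'(2)] by metis
qed

lemma noetherian_localization:
  assumes "noetherian_ring R" shows "noetherian_ring L"
proof (rule L.noetherian_ringI)
  fix J assume J: "ideal J L"
  let ?I = "{r \<in> carrier R. to_frac r \<in> J}"
  obtain A where A: "A \<subseteq> carrier R" "finite A" "?I = Idl A"
    using noetherian_ring.finetely_gen[OF assms to_frac.ideal_vimage[OF J]] by blast
  have iA: "to_frac ` A \<subseteq> carrier L" using A(1) to_frac.hom_closed by blast
  have AI: "A \<subseteq> ?I" using genideal_self[OF A(1)] unfolding A(3) .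
  have "J = Idl\<^bsub>L\<^esub> (to_frac ` A)"
  proof
    show "Idl\<^bsub>L\<^esub> (to_frac ` A) \<subseteq> J"
      by (rule L.genideal_minimal[OF J]) (use AI in blast)
    show "J \<subseteq> Idl\<^bsub>L\<^esub> (to_frac ` A)"
    proof (rule ideal_le_if_contraction_le[OF J L.genideal_ideal[OF iA]])
      fix r assume r: "r \<in> carrier R" "to_frac r \<in> J"
      then have "\<one> \<otimes> r \<in> Idl A" unfolding A(3)[symmetric] by simp
      then show "to_frac r \<in> Idl\<^bsub>L\<^esub> (to_frac ` A)"
        using to_frac_mem_Idl_iff[OF A(1) r(1)] one_S by blast
    qed
  qed
  then show "\<exists>A\<subseteq>carrier L. finite A \<and> J = Idl\<^bsub>L\<^esub> A" using iA A(2) by blast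
qed

lemma regular_sequence_localization:
  assumes reg: "regular_sequence R as" and disj: "Idl (set as) \<inter> S = {}"
  shows "regular_sequence L (map to_frac as)"
proof -
  have carr: "set as \<subseteq> carrier R"
    and nzd: "\<And>i r. \<lbrakk>i < length as; r \<in> carrier R; as ! i \<otimes> r \<in> Idl (set (take i as))\<rbrakk> \<Longrightarrow>
      r \<in> Idl (set (take i as))"
    using reg regular_sequence_iff by blast+
  show ?thesis
    unfolding L.regular_sequence_iff
  proof (intro conjI allI impI ballI)
    show "set (map to_frac as) \<subseteq> carrier L" using carr to_frac.hom_closed by auto
    show "Idl\<^bsub>L\<^esub> (set (map to_frac as)) \<noteq> carrier L"
    proof
      assume "Idl\<^bsub>L\<^esub> (set (map to_frac as)) = carrier L"
      then have "to_frac \<one> \<in> Idl\<^bsub>L\<^esub> (to_frac ` set as)" by simp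
      then obtain t where t: "t \<in> S" "t \<otimes> \<one> \<in> Idl (set as)"
        using to_frac_mem_Idl_iff[OF carr one_closed] by blast
      with disj S_carr show False by auto
    qed
  next
    fix i z assume i: "i < length (map to_frac as)" and z: "z \<in> carrier L"
    let ?A = "set (take i as)"
    have set_take: "set (take i (map to_frac as)) = to_frac ` ?A" by (simp add: take_map)
    have A: "?A \<subseteq> carrier R" using carr set_take_subset by fast
    have ai: "as ! i \<in> carrier R" using carr i by auto
    have J: "ideal (Idl\<^bsub>L\<^esub> (to_frac ` ?A)) L"
      by (rule L.genideal_ideal) (use A to_frac.hom_closed in blast)
    assume "map to_frac as ! i \<otimes>\<^bsub>L\<^esub> z \<in> Idl\<^bsub>L\<^esub> (set (take i (map to_frac as)))"
    then have az: "to_frac (as ! i) \<otimes>\<^bsub>L\<^esub> z \<in> Idl\<^bsub>L\<^esub> (to_frac ` ?A)" unfolding set_take using i by simp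
    obtain r s where rs: "r \<in> carrier R" "s \<in> S" "z \<otimes>\<^bsub>L\<^esub> to_frac s = to_frac r"
      using denominator[OF z] .
    have "to_frac (as ! i) \<otimes>\<^bsub>L\<^esub> z \<otimes>\<^bsub>L\<^esub> to_frac s \<in> Idl\<^bsub>L\<^esub> (to_frac ` ?A)"
      using ideal_mem_denominator_iff[OF J _ rs(2)] az ai z by simp
    then have "to_frac (as ! i \<otimes> r) \<in> Idl\<^bsub>L\<^esub> (to_frac ` ?A)"
      using ai z rs S_carr by (simp add: L.m_assoc)
    then obtain t where t: "t \<in> S" "t \<otimes> (as ! i \<otimes> r) \<in> Idl ?A"
      using to_frac_mem_Idl_iff[OF A] ai rs(1) by blast
    have "as ! i \<otimes> (t \<otimes> r) \<in> Idl ?A"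
      using t ai rs(1) S_carr by (simp add: m_lcomm)
    then have "t \<otimes> r \<in> Idl ?A" using nzd i t(1) rs(1) S_carr by auto
    then have "to_frac r \<in> Idl\<^bsub>L\<^esub> (to_frac ` ?A)" using to_frac_mem_Idl_iff[OF A rs(1)] t(1) by blast
    then show "z \<in> Idl\<^bsub>L\<^esub> (set (take i (map to_frac as)))"
      unfolding set_take using ideal_mem_denominator_iff[OF J z rs(2)] rs(3) by simp
  qed
qed

end

section \<open>A criterion for Cohen-Macaulay rings\<close>

lemma (in cring) localization_at_prime:
  assumes "primeideal M R" shows "localized_cring R (carrier R - M)"
proof -
  interpret M: primeideal M R by (rule assms)
  show ?thesis
  proof
    show "\<one> \<in> carrier R - M" using M.I_notcarr M.one_imp_carrier by blast
  qed (use M.I_prime in auto)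
qed

text \<open>
  With \<open>n\<close> the length of the sequence, \<open>n \<le> depth \<le> dim (R\<^sub>M) \<le> dim R \<le> n\<close>.
\<close>
lemma (in cring) localization_at_maximal_cohen_macaulay:
  assumes noeth: "noetherian_ring R" and M: "primeideal M R"
    and reg: "regular_sequence R as" "set as \<subseteq> M"
    and dim: "krull_dim R \<le> enat (length as)"
  shows "cohen_macaulay_local_ring (localization_at R M)"
proof -
  interpret M: primeideal M R by (rule M)
  interpret loc: localized_cring R "carrier R - M" by (rule localization_at_prime[OF M])
  let ?L = "localization R (carrier R - M)"
  define N where "N = Idl\<^bsub>?L\<^esub> (loc.to_frac ` M)"
  have M_carr: "M \<subseteq> carrier R" by (rule M.a_subset)
  have iM: "loc.to_frac ` M \<subseteq> carrier ?L" using M_carr loc.to_frac.hom_closed by blast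
  have N: "ideal N ?L" unfolding N_def by (rule loc.L.genideal_ideal[OF iM])
  have IdlM: "Idl M = M"
    using genideal_minimal[OF M.is_ideal order_refl] genideal_self[OF M_carr] by blast
  have mem_N: "loc.to_frac r \<in> N \<longleftrightarrow> r \<in> M" if r: "r \<in> carrier R" for r
  proof -
    have "loc.to_frac r \<in> N \<longleftrightarrow> (\<exists>t\<in>carrier R - M. t \<otimes> r \<in> M)"
      unfolding N_def loc.to_frac_mem_Idl_iff[OF M_carr r] IdlM ..
    also have "\<dots> \<longleftrightarrow> r \<in> M"
      using M.I_prime[OF _ r] M.I_l_closed[of r] loc.one_S by blast
    finally show ?thesis .
  qed
  have one: "\<one>\<^bsub>?L\<^esub> \<notin> N" using mem_N[OF one_closed] loc.one_S by simp
  have units: "z \<in> Units ?L" if z: "z \<in> carrier ?L - N" for z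
  proof -
    have zL: "z \<in> carrier ?L" using z by blast
    obtain r s where rs: "r \<in> carrier R" "s \<in> carrier R - M"
      "z \<otimes>\<^bsub>?L\<^esub> loc.to_frac s = loc.to_frac r" using loc.denominator[OF zL] .
    have "r \<notin> M" using loc.ideal_mem_denominator_iff[OF N zL rs(2)] rs(3) mem_N[OF rs(1)] z by simp
    then have "loc.to_frac r \<in> Units ?L" using loc.to_frac_Units rs(1) by blast
    then show ?thesis using loc.L.unit_factor[of z "loc.to_frac s"] rs zL loc.to_frac.hom_closed by auto
  qed
  have regL: "regular_sequence ?L (map loc.to_frac as)"
  proof (rule loc.regular_sequence_localization[OF reg(1)])
    show "Idl (set as) \<inter> (carrier R - M) = {}" using genideal_minimal[OF M.is_ideal reg(2)] by blast
  qed
  have "set (map loc.to_frac as) \<subseteq> N" using mem_N reg(2) M_carr by auto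
  with regL have "enat (length as) \<le> depth_in ?L N"
    unfolding depth_in_def by (intro Sup_upper) (force intro: exI[of _ "map loc.to_frac as"])
  then have "depth_in ?L N = krull_dim ?L"
    using loc.krull_dim_localization_le dim loc.L.depth_in_le_krull_dim[of N] by (auto intro: antisym)
  then show ?thesis
    unfolding cohen_macaulay_local_ring_def localization_at_def
    using loc.localization_cring loc.noetherian_localization[OF noeth]
      loc.L.unique_maximalideal[OF N one units] by blast
qed

theorem (in cring) cohen_macaulay_ringI:
  assumes "noetherian_ring R" "krull_dim R \<le> enat d"
    and "\<And>M. maximalideal M R \<Longrightarrow> \<exists>as. length as = d \<and> set as \<subseteq> M \<and> regular_sequence R as"
  shows "cohen_macaulay_ring R"
  unfolding cohen_macaulay_ring_def
  using assms is_cring localization_at_maximal_cohen_macaulay maximalideal_prime by metis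

section \<open>Hilbert's basis theorem\<close>

text \<open>
  Polynomial rings are treated as subrings of a type of class \<open>comm_ring_1\<close>, so that their elements
  can be manipulated with the operations of the type.
\<close>
definition ring_on :: "'r::comm_ring_1 set \<Rightarrow> 'r ring" where
  "ring_on A = \<lparr>carrier = A, mult = (*), one = 1, zero = 0, add = (+)\<rparr>"

definition is_subring :: "'r::comm_ring_1 set \<Rightarrow> bool" where
  "is_subring A \<longleftrightarrow> 1 \<in> A \<and> (\<forall>x\<in>A. \<forall>y\<in>A. x - y \<in> A \<and> x * y \<in> A)"

lemma ring_on_simps [simp]:
  "carrier (ring_on A) = A" "mult (ring_on A) = (*)" "one (ring_on A) = 1"
  "zero (ring_on A) = 0" "add (ring_on A) = (+)"
  by (simp_all add: ring_on_def)

lemma is_subringD: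
  assumes "is_subring A"
  shows "1 \<in> A" "0 \<in> A" "x \<in> A \<Longrightarrow> y \<in> A \<Longrightarrow> x - y \<in> A" "x \<in> A \<Longrightarrow> y \<in> A \<Longrightarrow> x * y \<in> A"
    "x \<in> A \<Longrightarrow> - x \<in> A" "x \<in> A \<Longrightarrow> y \<in> A \<Longrightarrow> x + y \<in> A"
proof -
  show *: "1 \<in> A" "\<And>x y. x \<in> A \<Longrightarrow> y \<in> A \<Longrightarrow> x - y \<in> A" "\<And>x y. x \<in> A \<Longrightarrow> y \<in> A \<Longrightarrow> x * y \<in> A"
    using assms by (auto simp: is_subring_def)
  show 0: "0 \<in> A" using *(2)[OF *(1) *(1)] by simp
  show neg: "\<And>x. x \<in> A \<Longrightarrow> - x \<in> A" using *(2)[OF 0] by simp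
  show "x \<in> A \<Longrightarrow> y \<in> A \<Longrightarrow> x + y \<in> A" using *(2)[of x "- y"] neg by simp
qed

lemma is_subring_sum: "is_subring A \<Longrightarrow> (\<And>i. i \<in> I \<Longrightarrow> f i \<in> A) \<Longrightarrow> sum f I \<in> A"
  by (induction I rule: infinite_finite_induct) (auto simp: is_subringD)

lemma is_subring_prod: "is_subring A \<Longrightarrow> (\<And>i. i \<in> I \<Longrightarrow> f i \<in> A) \<Longrightarrow> prod f I \<in> A"
  by (induction I rule: infinite_finite_induct) (auto simp: is_subringD)

lemma is_subring_power: "is_subring A \<Longrightarrow> x \<in> A \<Longrightarrow> x ^ n \<in> A"
  by (induction n) (auto simp: is_subringD)

lemma cring_ring_on:
  assumes A: "is_subring A" shows "cring (ring_on A)"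
proof (rule cringI)
  show "abelian_group (ring_on A)"
  proof (rule abelian_groupI)
    fix x assume "x \<in> carrier (ring_on A)"
    then show "\<exists>y\<in>carrier (ring_on A). y \<oplus>\<^bsub>ring_on A\<^esub> x = \<zero>\<^bsub>ring_on A\<^esub>"
      using is_subringD(5)[OF A] by (intro bexI[of _ "- x"]) auto
  qed (auto simp: is_subringD[OF A] algebra_simps)
  show "Group.comm_monoid (ring_on A)"
    by (rule comm_monoidI) (auto simp: is_subringD[OF A] algebra_simps)
qed (auto simp: algebra_simps)

lemma ideal_ring_on_iff:
  assumes A: "is_subring A"
  shows "ideal J (ring_on A) \<longleftrightarrow>
    J \<subseteq> A \<and> 0 \<in> J \<and> (\<forall>x\<in>J. \<forall>y\<in>J. x + y \<in> J) \<and> (\<forall>a\<in>A. \<forall>x\<in>J. a * x \<in> J)" (is "_ \<longleftrightarrow> ?R")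
proof
  interpret cring "ring_on A" by (rule cring_ring_on[OF A])
  show ?R if J: "ideal J (ring_on A)"
  proof -
    interpret ideal J "ring_on A" by (rule J)
    show ?thesis using a_subset zero_closed a_closed I_l_closed
        additive_subgroup.zero_closed[OF is_additive_subgroup] by auto
  qed
  show "ideal J (ring_on A)" if ?R
    by (rule ideal_from_closure) (use that in auto)
qed

text \<open>
  An ideal of \<open>S\<close> is generated by the images of generators of its contraction.
\<close>
lemma noetherian_ring_image:
  assumes hom: "ring_hom_ring R S h" and surj: "h ` carrier R = carrier S"
    and noeth: "noetherian_ring R"
  shows "noetherian_ring S"
proof -
  interpret ring_hom_ring R S h by (rule hom)
  show ?thesis
  proof (rule S.noetherian_ringI)
    fix J assume J: "ideal J S"
    let ?I = "{r \<in> carrier R. h r \<in> J}"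
    obtain T where T: "T \<subseteq> carrier R" "finite T" "?I = Idl\<^bsub>R\<^esub> T"
      using noetherian_ring.finetely_gen[OF noeth ideal_vimage[OF J]] by blast
    have hT: "h ` T \<subseteq> carrier S" using T(1) by auto
    have TI: "T \<subseteq> ?I" unfolding T(3) by (rule R.genideal_self[OF T(1)])
    have "J = Idl\<^bsub>S\<^esub> (h ` T)"
    proof
      show "Idl\<^bsub>S\<^esub> (h ` T) \<subseteq> J" by (rule S.genideal_minimal[OF J]) (use TI in blast)
      have "T \<subseteq> {r \<in> carrier R. h r \<in> Idl\<^bsub>S\<^esub> (h ` T)}"
        using T(1) S.genideal_self[OF hT] by auto
      then have sub: "Idl\<^bsub>R\<^esub> T \<subseteq> {r \<in> carrier R. h r \<in> Idl\<^bsub>S\<^esub> (h ` T)}"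
        by (rule R.genideal_minimal[OF ideal_vimage[OF S.genideal_ideal[OF hT]]])
      show "J \<subseteq> Idl\<^bsub>S\<^esub> (h ` T)"
      proof
        fix z assume z: "z \<in> J"
        then have "z \<in> h ` carrier R" unfolding surj by (rule ideal.Icarr[OF J])
        then obtain r where r: "r \<in> carrier R" "z = h r" by (rule imageE) simp
        then have "r \<in> Idl\<^bsub>R\<^esub> T" unfolding T(3)[symmetric] using z by simp
        then have "r \<in> {r \<in> carrier R. h r \<in> Idl\<^bsub>S\<^esub> (h ` T)}" by (rule subsetD[OF sub])
        then show "z \<in> Idl\<^bsub>S\<^esub> (h ` T)" using r(2) by simp
      qed
    qed
    then show "\<exists>A\<subseteq>carrier S. finite A \<and> J = Idl\<^bsub>S\<^esub> A" using hT T(2) by blast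
  qed
qed

abbreviation polys_over :: "'r::comm_ring_1 set \<Rightarrow> 'r poly set" where
  "polys_over A \<equiv> {p. \<forall>i. coeff p i \<in> A}"

lemma is_subring_polys_over:
  assumes "is_subring A" shows "is_subring (polys_over A)"
  unfolding is_subring_def
  by (auto intro!: is_subring_sum[OF assms] simp: is_subringD[OF assms] coeff_mult coeff_pCons one_pCons split: nat.splits)

text \<open>
  For an ideal \<open>J\<close> of \<open>A[X]\<close> the coefficients \<open>L n\<close> of \<open>X\<^sup>n\<close> in members of \<open>J\<close> of degree at most \<open>n\<close>
  form an increasing chain of ideals of \<open>A\<close>, which stops at some \<open>N\<close>. Lifting finite generating sets of
  \<open>L 0, \<dots>, L N\<close> to \<open>J\<close> gives generators of \<open>J\<close>: modulo the ideal \<open>?K\<close> they generate, the leading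
  term of a member of \<open>J\<close> can always be removed.
\<close>
lemma hilbert_basis:
  fixes A :: "'r::comm_ring_1 set"
  assumes A: "is_subring A" and noeth: "noetherian_ring (ring_on A)"
  shows "noetherian_ring (ring_on (polys_over A))"
proof -
  interpret A: cring "ring_on A" by (rule cring_ring_on[OF A])
  have AX: "is_subring (polys_over A)" by (rule is_subring_polys_over[OF A])
  interpret AX: cring "ring_on (polys_over A)" by (rule cring_ring_on[OF AX])
  have monomA: "monom a n \<in> polys_over A" if "a \<in> A" for a n
    using that is_subringD(2)[OF A] by simp
  have fg: "\<exists>T. finite T \<and> T \<subseteq> J \<and> J = Idl\<^bsub>ring_on A\<^esub> T" if idl: "ideal J (ring_on A)" for J
  proof -
    obtain T where T: "T \<subseteq> A" "finite T" "J = Idl\<^bsub>ring_on A\<^esub> T"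
      using noetherian_ring.finetely_gen[OF noeth idl] by auto
    with A.genideal_self[of T] show ?thesis by auto
  qed
  show ?thesis
  proof (rule AX.noetherian_ringI)
    fix J assume J: "ideal J (ring_on (polys_over A))"
    have J': "J \<subseteq> polys_over A" "0 \<in> J" "\<And>p q. p \<in> J \<Longrightarrow> q \<in> J \<Longrightarrow> p + q \<in> J"
      "\<And>a p. a \<in> polys_over A \<Longrightarrow> p \<in> J \<Longrightarrow> a * p \<in> J"
      using J unfolding ideal_ring_on_iff[OF AX] by auto
    define L where "L n = {coeff p n | p. p \<in> J \<and> degree p \<le> n}" for n
    have LI: "coeff p n \<in> L n" if "p \<in> J" "degree p \<le> n" for p n
      using that unfolding L_def by blast
    have lead_ideal: "ideal {coeff p n | p. p \<in> K \<and> degree p \<le> n} (ring_on A)"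
      if K: "ideal K (ring_on (polys_over A))" for K n
    proof -
      have K': "K \<subseteq> polys_over A" "0 \<in> K" "\<And>p q. p \<in> K \<Longrightarrow> q \<in> K \<Longrightarrow> p + q \<in> K"
        "\<And>a p. a \<in> polys_over A \<Longrightarrow> p \<in> K \<Longrightarrow> a * p \<in> K"
        using K unfolding ideal_ring_on_iff[OF AX] by auto
      show ?thesis
        unfolding ideal_ring_on_iff[OF A]
      proof (intro conjI ballI)
        show "{coeff p n | p. p \<in> K \<and> degree p \<le> n} \<subseteq> A" using K'(1) by blast
        show "0 \<in> {coeff p n | p. p \<in> K \<and> degree p \<le> n}"
          using K'(2) by (intro CollectI exI[of _ 0]) simp
      next
        fix x y assume "x \<in> {coeff p n | p. p \<in> K \<and> degree p \<le> n}" "y \<in> {coeff p n | p. p \<in> K \<and> degree p \<le> n}"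
        then obtain p q where "x = coeff p n" "p \<in> K" "degree p \<le> n" "y = coeff q n" "q \<in> K" "degree q \<le> n"
          by blast
        then show "x + y \<in> {coeff p n | p. p \<in> K \<and> degree p \<le> n}"
          using K'(3) by (intro CollectI exI[of _ "p + q"]) (auto intro: degree_add_le)
      next
        fix a x assume a: "a \<in> A" and "x \<in> {coeff p n | p. p \<in> K \<and> degree p \<le> n}"
        then obtain p where "x = coeff p n" "p \<in> K" "degree p \<le> n" by blast
        moreover have "[:a:] * p \<in> K" if "p \<in> K" for p
          by (rule K'(4)[OF _ that]) (use a is_subringD(2)[OF A] in \<open>auto simp: coeff_pCons split: nat.splits\<close>)
        ultimately show "a * x \<in> {coeff p n | p. p \<in> K \<and> degree p \<le> n}"
          by (intro CollectI exI[of _ "[:a:] * p"]) (auto intro: order_trans[OF degree_smult_le])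
      qed
    qed
    have L_ideal: "ideal (L n) (ring_on A)" for n
      unfolding L_def by (rule lead_ideal[OF J])
    have L_Suc: "L n \<subseteq> L (Suc n)" for n
    proof
      fix c assume "c \<in> L n"
      then obtain p where p: "p \<in> J" "degree p \<le> n" "c = coeff p n" unfolding L_def by blast
      have "monom 1 1 * p \<in> J" by (rule J'(4)[OF monomA p(1)]) (rule is_subringD(1)[OF A])
      moreover have "degree (monom 1 1 * p) \<le> Suc n"
        using degree_mult_le[of "monom 1 1" p] p(2) by (simp add: degree_monom_eq)
      moreover have "coeff (monom 1 1 * p) (Suc n) = c" by (simp add: coeff_monom_mult p(3))
      ultimately show "c \<in> L (Suc n)" using LI by metis
    qed
    then have L_mono: "L m \<subseteq> L n" if "m \<le> n" for m n using that by (rule lift_Suc_mono_le)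
    obtain N where N: "\<And>n. N \<le> n \<Longrightarrow> L n = L N"
    proof -
      have "ideal (\<Union>n. L n) (ring_on A)"
      proof -
        have "subset.chain {I. ideal I (ring_on A)} (range L)"
          unfolding pred_on.chain_def using L_ideal L_mono nat_le_linear by blast
        from A.chain_Union_is_ideal[OF this] show ?thesis by simp
      qed
      from fg[OF this] obtain T where T: "finite T" "T \<subseteq> (\<Union>n. L n)" "(\<Union>n. L n) = Idl\<^bsub>ring_on A\<^esub> T"
        by (elim exE conjE)
      have "\<exists>N. T \<subseteq> L N"
        using T(1,2)
      proof (induction T rule: finite_induct)
        case (insert t T)
        then obtain m n where "T \<subseteq> L m" "t \<in> L n" by blast
        then have "insert t T \<subseteq> L (max m n)" using L_mono[of m "max m n"] L_mono[of n "max m n"] by auto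
        then show ?case by blast
      qed simp
      then obtain N where "T \<subseteq> L N" by blast
      then have "(\<Union>n. L n) \<subseteq> L N" unfolding T(3) by (rule A.genideal_minimal[OF L_ideal])
      then show thesis using that[of N] L_mono by blast
    qed
    obtain T where T: "\<And>n. finite (T n)" "\<And>n. T n \<subseteq> L n" "\<And>n. L n = Idl\<^bsub>ring_on A\<^esub> (T n)"
      using fg[OF L_ideal] by metis
    define g where "g n t = (SOME p. p \<in> J \<and> degree p \<le> n \<and> coeff p n = t)" for n t
    have g: "g n t \<in> J \<and> degree (g n t) \<le> n \<and> coeff (g n t) n = t" if "t \<in> T n" for n t
      unfolding g_def by (rule someI_ex) (use that T(2)[of n] in \<open>auto simp: L_def\<close>)
    define G where "G = (\<Union>n\<le>N. g n ` T n)"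
    have G: "finite G" "G \<subseteq> J" "G \<subseteq> polys_over A"
      using T(1) g J'(1) unfolding G_def by (simp, blast, blast)
    let ?K = "Idl\<^bsub>ring_on (polys_over A)\<^esub> G"
    have K_ideal: "ideal ?K (ring_on (polys_over A))"
      by (rule AX.genideal_ideal) (use G(3) in simp)
    have GK: "G \<subseteq> ?K" by (rule AX.genideal_self) (use G(3) in simp)
    have KJ: "?K \<subseteq> J" by (rule AX.genideal_minimal[OF J G(2)])
    have K': "0 \<in> ?K" "\<And>p q. p \<in> ?K \<Longrightarrow> q \<in> ?K \<Longrightarrow> p + q \<in> ?K"
        "\<And>a p. a \<in> polys_over A \<Longrightarrow> p \<in> ?K \<Longrightarrow> a * p \<in> ?K"
      using K_ideal unfolding ideal_ring_on_iff[OF AX] by auto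
    have lead_small: "\<exists>q\<in>?K. degree q \<le> n \<and> coeff q n = c" if "n \<le> N" "c \<in> L n" for n c
    proof -
      have "L n \<subseteq> {coeff p n | p. p \<in> ?K \<and> degree p \<le> n}"
        unfolding T(3)
      proof (rule A.genideal_minimal[OF lead_ideal[OF K_ideal]], rule subsetI)
        fix t assume "t \<in> T n"
        then show "t \<in> {coeff p n | p. p \<in> ?K \<and> degree p \<le> n}"
          using g[of t n] GK \<open>n \<le> N\<close> unfolding G_def by (intro CollectI exI[of _ "g n t"]) auto
      qed
      then show ?thesis using that(2) by blast
    qed
    have lead: "\<exists>q\<in>?K. degree q \<le> n \<and> coeff q n = c" if c: "c \<in> L n" for n c
    proof (cases "n \<le> N")
      case True
      then show ?thesis using lead_small c by blast
    next
      case False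
      then have "c \<in> L N" using N[of n] c by simp
      then obtain q where q: "q \<in> ?K" "degree q \<le> N" "coeff q N = c" using lead_small[OF order_refl] by blast
      have "monom 1 (n - N) * q \<in> ?K" by (rule K'(3)[OF monomA q(1)]) (rule is_subringD(1)[OF A])
      moreover have "degree (monom 1 (n - N) * q) \<le> n"
        using degree_mult_le[of "monom 1 (n - N)" q] q(2) False by (simp add: degree_monom_eq)
      moreover have "coeff (monom 1 (n - N) * q) n = c" using False q(3) by (simp add: coeff_monom_mult)
      ultimately show ?thesis by blast
    qed
    have small: "p \<in> ?K" if "p \<in> J" "\<forall>i\<ge>n. coeff p i = 0" for n p
      using that
    proof (induction n arbitrary: p)
      case 0
      then have "p = 0" by (simp add: poly_eq_iff)
      then show ?case using K'(1) by simp
    next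
      case (Suc n)
      then have "degree p \<le> n" by (intro degree_le) auto
      then obtain q where q: "q \<in> ?K" "degree q \<le> n" "coeff q n = coeff p n"
        using lead LI[OF Suc.prems(1)] by blast
      have "- 1 \<in> A" using is_subringD[OF A] by blast
      then have "[:- 1:] * q \<in> J" 
        using q(1) KJ is_subringD(2)[OF A] by (intro J'(4)) (auto simp: coeff_pCons split: nat.splits)
      then have "p - q \<in> J" using J'(3)[OF Suc.prems(1), of "[:- 1:] * q"] by simp
      moreover have "coeff (p - q) i = 0" if "i \<ge> n" for i
      proof (cases "i = n")
        case False
        then have "i \<ge> Suc n" using that by simp
        then show ?thesis using Suc.prems(2) q(2) coeff_eq_0[of q i] by simp
      qed (use q(3) in simp)
      ultimately have "p - q \<in> ?K" using Suc.IH by blast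
      from K'(2)[OF this q(1)] show ?case by simp
    qed
    have "J \<subseteq> ?K"
    proof
      fix p assume "p \<in> J"
      then show "p \<in> ?K" by (rule small[of _ "Suc (degree p)"]) (simp add: coeff_eq_0)
    qed
    then have "J = ?K" using KJ by blast
    then show "\<exists>B\<subseteq>carrier (ring_on (polys_over A)). finite B \<and> J = Idl\<^bsub>ring_on (polys_over A)\<^esub> B"
      using G by auto
  qed
qed

lemma polynomial_ring_eq: "polynomial_ring V = ring_on (carrier (polynomial_ring V))"
  by (simp add: polynomial_ring_def ring_on_def)

lemma mem_polynomial_ring_iff:
  "p \<in> carrier (polynomial_ring V) \<longleftrightarrow> (\<forall>m\<in>Poly_Mapping.keys p. Poly_Mapping.keys m \<subseteq> V)"
  by (simp add: polynomial_ring_def)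

lemma keys_plus_nat: "Poly_Mapping.keys (m + n) = Poly_Mapping.keys m \<union> Poly_Mapping.keys n"
  for m n :: "'v \<Rightarrow>\<^sub>0 nat"
  by (auto simp: in_keys_iff lookup_add)

lemma is_subring_polynomial_ring:
  "is_subring (carrier (polynomial_ring V :: (('v \<Rightarrow>\<^sub>0 nat) \<Rightarrow>\<^sub>0 'k::field) ring))"
  unfolding is_subring_def
proof (intro conjI ballI; (unfold mem_polynomial_ring_iff)?; (intro ballI)?)
  fix x y :: "('v \<Rightarrow>\<^sub>0 nat) \<Rightarrow>\<^sub>0 'k" and m
  assume x: "\<forall>m\<in>Poly_Mapping.keys x. Poly_Mapping.keys m \<subseteq> V"
    and y: "\<forall>m\<in>Poly_Mapping.keys y. Poly_Mapping.keys m \<subseteq> V"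
  { assume "m \<in> Poly_Mapping.keys (x - y)"
    then have "m \<in> Poly_Mapping.keys x \<or> m \<in> Poly_Mapping.keys y"
      by (auto simp: in_keys_iff lookup_minus)
    with x y show "Poly_Mapping.keys m \<subseteq> V" by (auto simp: mem_polynomial_ring_iff) }
  { assume "m \<in> Poly_Mapping.keys (x * y)"
    then obtain a b where "m = a + b" "a \<in> Poly_Mapping.keys x" "b \<in> Poly_Mapping.keys y"
      using keys_mult[of x y] by blast
    with x y show "Poly_Mapping.keys m \<subseteq> V" by (auto simp: mem_polynomial_ring_iff keys_plus_nat) }
qed auto

lemma poly_mapping_eq_sum_single:
  "p = (\<Sum>m\<in>Poly_Mapping.keys p. Poly_Mapping.single m (Poly_Mapping.lookup p m))"
proof (rule poly_mapping_eqI)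
  fix k
  have "Poly_Mapping.lookup (\<Sum>m\<in>Poly_Mapping.keys p. Poly_Mapping.single m (Poly_Mapping.lookup p m)) k =
      (\<Sum>m\<in>Poly_Mapping.keys p. if m = k then Poly_Mapping.lookup p m else 0)"
    by (simp add: lookup_sum lookup_single when_def)
  also have "\<dots> = Poly_Mapping.lookup p k" by (simp add: in_keys_iff)
  finally show "Poly_Mapping.lookup p k = Poly_Mapping.lookup (\<Sum>m\<in>Poly_Mapping.keys p. Poly_Mapping.single m (Poly_Mapping.lookup p m)) k" ..
qed

lemma variable_power: "variable v ^ n = Poly_Mapping.single (Poly_Mapping.single v n) 1"
  by (induction n) (simp_all add: variable_def mult_single single_add[symmetric])

lemma variable_in_polynomial_ring: "v \<in> V \<Longrightarrow> variable v \<in> carrier (polynomial_ring V)"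
  by (simp add: mem_polynomial_ring_iff variable_def)

text \<open>
  Adjoining the variable \<open>v\<close> is evaluating at \<open>v\<close> the polynomials in one indeterminate over \<open>k[V]\<close>.
\<close>
lemma polynomial_ring_insert:
  "carrier (polynomial_ring (insert v V)) =
     (\<lambda>p. poly p (variable v)) ` polys_over (carrier (polynomial_ring V :: (('v \<Rightarrow>\<^sub>0 nat) \<Rightarrow>\<^sub>0 'k::field) ring))"
    (is "?L = ?h ` polys_over ?A")
proof
  have subL: "is_subring ?L" and subA: "is_subring ?A" by (rule is_subring_polynomial_ring)+
  have AL: "?A \<subseteq> ?L" by (rule subsetI, unfold mem_polynomial_ring_iff) blast
  show "?h ` polys_over ?A \<subseteq> ?L"
  proof (rule image_subsetI)
    fix p assume "p \<in> polys_over ?A"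
    then show "?h p \<in> ?L"
      unfolding poly_altdef using AL variable_in_polynomial_ring[of v "insert v V"]
      by (intro is_subring_sum[OF subL] is_subringD(4)[OF subL] is_subring_power[OF subL]) auto
  qed
  have im: "is_subring (?h ` polys_over ?A)"
    using is_subring_polys_over[OF subA] unfolding is_subring_def
    by (auto simp: poly_diff[symmetric] poly_mult[symmetric] intro!: image_eqI[of _ _ 1] simp del: poly_diff poly_mult)
  show "?L \<subseteq> ?h ` polys_over ?A"
  proof
    fix p :: "('v \<Rightarrow>\<^sub>0 nat) \<Rightarrow>\<^sub>0 'k" assume p: "p \<in> ?L"
    have single: "Poly_Mapping.single m c \<in> ?h ` polys_over ?A" if m: "Poly_Mapping.keys m \<subseteq> insert v V" for m and c :: 'k
    proof -
      define m' where "m' = m - Poly_Mapping.single v (Poly_Mapping.lookup m v)"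
      have m_eq: "m = m' + Poly_Mapping.single v (Poly_Mapping.lookup m v)"
        by (rule poly_mapping_eqI) (simp add: m'_def lookup_add lookup_minus lookup_single when_def)
      have "Poly_Mapping.keys m' \<subseteq> V"
        using m by (auto simp: m'_def in_keys_iff subset_iff lookup_minus lookup_single when_def split: if_splits)
      then have "Poly_Mapping.single m' c \<in> ?A" by (auto simp: mem_polynomial_ring_iff)
      moreover have "0 \<in> ?A" by (simp add: mem_polynomial_ring_iff)
      ultimately have "monom (Poly_Mapping.single m' c) (Poly_Mapping.lookup m v) \<in> polys_over ?A" by simp
      then have "?h (monom (Poly_Mapping.single m' c) (Poly_Mapping.lookup m v)) \<in> ?h ` polys_over ?A"
        by (rule imageI)
      moreover have "?h (monom (Poly_Mapping.single m' c) (Poly_Mapping.lookup m v)) = Poly_Mapping.single m c"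
        by (subst (2) m_eq) (simp add: poly_monom variable_power mult_single)
      ultimately show ?thesis by simp
    qed
    have "(\<Sum>m\<in>Poly_Mapping.keys p. Poly_Mapping.single m (Poly_Mapping.lookup p m)) \<in> ?h ` polys_over ?A"
      using p single by (intro is_subring_sum[OF im]) (auto simp: mem_polynomial_ring_iff)
    then show "p \<in> ?h ` polys_over ?A" using poly_mapping_eq_sum_single[of p] by simp
  qed
qed

lemma noetherian_polynomial_ring:
  assumes "finite V"
  shows "noetherian_ring (polynomial_ring V :: (('v \<Rightarrow>\<^sub>0 nat) \<Rightarrow>\<^sub>0 'k::field) ring)"
  using assms
proof (induction V rule: finite_induct)
  case empty
  let ?A = "carrier (polynomial_ring {}) :: (('v \<Rightarrow>\<^sub>0 nat) \<Rightarrow>\<^sub>0 'k) set"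
  have A: "is_subring ?A" by (rule is_subring_polynomial_ring)
  interpret cring "ring_on ?A" by (rule cring_ring_on[OF A])
  \<comment> \<open>Without variables the ring consists of constants, and its ideals are those of a field.\<close>
  have const: "p = Poly_Mapping.single 0 (Poly_Mapping.lookup p 0)" if "p \<in> ?A" for p :: "('v \<Rightarrow>\<^sub>0 nat) \<Rightarrow>\<^sub>0 'k"
    using that by (intro poly_mapping_eqI) (auto simp: mem_polynomial_ring_iff lookup_single when_def in_keys_iff)
  have "noetherian_ring (ring_on ?A)"
  proof (rule noetherian_ringI)
    fix J assume J: "ideal J (ring_on ?A)"
    have J': "J \<subseteq> ?A" "0 \<in> J" "\<And>a p. a \<in> ?A \<Longrightarrow> p \<in> J \<Longrightarrow> a * p \<in> J"
      using J unfolding ideal_ring_on_iff[OF A] by auto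
    show "\<exists>B\<subseteq>carrier (ring_on ?A). finite B \<and> J = Idl\<^bsub>ring_on ?A\<^esub> B"
    proof (cases "J = {0}")
      case True
      then show ?thesis using genideal_zero is_subringD(2)[OF A] by (intro exI[of _ "{0}"]) auto
    next
      case False
      then obtain p where p: "p \<in> J" "p \<noteq> 0" using J'(2) by blast
      define c where "c = Poly_Mapping.lookup p 0"
      have pc: "p = Poly_Mapping.single 0 c" using const p(1) J'(1) unfolding c_def by blast
      have "c \<noteq> 0" using p(2) pc by auto
      have "Poly_Mapping.single 0 (inverse c) \<in> ?A" by (auto simp: mem_polynomial_ring_iff)
      from J'(3)[OF this p(1)] have "1 \<in> J"
        using \<open>c \<noteq> 0\<close> by (simp add: pc mult_single single_one)
      then have "J = ?A" using ideal.one_imp_carrier[OF J] by simp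
      then show ?thesis using genideal_one is_subringD(1)[OF A] by (intro exI[of _ "{1}"]) auto
    qed
  qed
  then show ?case by (subst polynomial_ring_eq)
next
  case (insert v V)
  let ?A = "carrier (polynomial_ring V) :: (('v \<Rightarrow>\<^sub>0 nat) \<Rightarrow>\<^sub>0 'k) set"
  let ?B = "carrier (polynomial_ring (insert v V)) :: (('v \<Rightarrow>\<^sub>0 nat) \<Rightarrow>\<^sub>0 'k) set"
  have subs: "is_subring ?A" "is_subring ?B" "is_subring (polys_over ?A)"
    by (intro is_subring_polynomial_ring is_subring_polys_over)+
  have "noetherian_ring (ring_on ?A)" using insert.IH by (simp add: polynomial_ring_eq[symmetric])
  then have noeth: "noetherian_ring (ring_on (polys_over ?A))" by (rule hilbert_basis[OF subs(1)])
  have hom: "ring_hom_ring (ring_on (polys_over ?A)) (ring_on ?B) (\<lambda>p. poly p (variable v))"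
  proof (rule ring_hom_ringI2)
    show "(\<lambda>p. poly p (variable v)) \<in> ring_hom (ring_on (polys_over ?A)) (ring_on ?B)"
      by (rule ring_hom_memI) (auto simp: polynomial_ring_insert)
  qed (use cring_ring_on subs in \<open>auto intro: cring.axioms(1)\<close>)
  have "noetherian_ring (ring_on ?B)"
    by (rule noetherian_ring_image[OF hom _ noeth]) (simp add: polynomial_ring_insert)
  then show ?case by (subst polynomial_ring_eq)
qed

section \<open>Ideals of polynomials in two variables\<close>

lemma is_subring_UNIV: "is_subring UNIV"
  by (simp add: is_subring_def)

lemma ideal_ring_on_UNIV_diff:
  assumes J: "ideal J (ring_on UNIV)" and "p \<in> J" "q \<in> J" shows "p - q \<in> J"
proof -
  have *: "\<forall>x\<in>J. \<forall>y\<in>J. x + y \<in> J" "\<forall>a. \<forall>x\<in>J. a * x \<in> J"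
    using J unfolding ideal_ring_on_iff[OF is_subring_UNIV] by auto
  have "(- 1) * q \<in> J" using *(2) assms(3) by blast
  then have "p + (- 1) * q \<in> J" using *(1) assms(2) by blast
  then show ?thesis by simp
qed

text \<open>
  Zariski's lemma for \<open>K = k[X, Y]/J\<close>: the image of \<open>X\<close> is algebraic over \<open>k\<close>. Suppose it is not. Then
  \<open>k[X]\<close> embeds into \<open>K\<close>; take \<open>F \<in> J\<close> nonzero of least degree in \<open>Y\<close>, with leading coefficient
  \<open>c(X)\<close>. Division by \<open>F\<close> needs only powers of \<open>c\<close> as denominators, and remainders of degree below
  that of \<open>F\<close> are independent over \<open>k[X]\<close>. Writing the inverse of \<open>d = 1 + X c\<close> in this way and
  comparing coefficients shows that \<open>d\<close> divides a power of \<open>c\<close>. But \<open>d\<close> is coprime to \<open>c\<close> and not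
  constant.
\<close>
lemma maximal_ideal_contains_univariate:
  fixes J :: "'k::field poly poly set"
  assumes J: "ideal J (ring_on UNIV)" and one: "1 \<notin> J"
    and inv: "\<And>F. F \<notin> J \<Longrightarrow> \<exists>G. F * G - 1 \<in> J"
  shows "\<exists>p. p \<noteq> 0 \<and> [:p:] \<in> J"
proof (rule ccontr)
  assume contra: "\<not> ?thesis"
  have mult: "a * p \<in> J" if "p \<in> J" for a p
    using J that unfolding ideal_ring_on_iff[OF is_subring_UNIV] by auto
  have univ: "p = 0" if "[:p:] \<in> J" for p using contra that by blast
  have "[:[:0, 1:]:] \<notin> J" using univ[of "[:0, 1:]"] by auto
  then obtain G0 where G0: "[:[:0, 1:]:] * G0 - 1 \<in> J" using inv by blast
  \<comment> \<open>\<open>X\<close> is not a unit of \<open>k[X, Y]\<close>, so \<open>J\<close> is not the zero ideal.\<close>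
  have "[:[:0, 1:]:] * G0 - 1 \<noteq> 0"
  proof
    assume "[:[:0, 1:]:] * G0 - 1 = 0"
    then have "poly (coeff ([:[:0, 1:]:] * G0) 0) 0 = poly (coeff 1 0) 0" by simp
    then show False by simp
  qed
  then obtain F where F: "F \<in> J" "F \<noteq> 0"
    and least: "\<And>G. G \<in> J \<Longrightarrow> G \<noteq> 0 \<Longrightarrow> degree F \<le> degree G"
    using ex_has_least_nat[of "\<lambda>F. F \<in> J \<and> F \<noteq> 0" _ degree] G0 by blast
  define c where "c = lead_coeff F"
  have c: "c \<noteq> 0" using F(2) by (simp add: c_def)
  have degF: "degree F > 0"
  proof (rule ccontr)
    assume "\<not> degree F > 0"
    then obtain p where "F = [:p:]" using degree_eq_zeroE by blast
    then show False using univ[of p] F by simp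
  qed
  \<comment> \<open>This is \<open>1 + X c\<close>.\<close>
  define d where "d = pCons 1 c"
  have "[:d:] \<notin> J" using univ[of d] by (auto simp: d_def)
  then obtain G where G: "[:d:] * G - 1 \<in> J" using inv by blast
  define N where "N = Suc (degree G) - degree F"
  obtain Q R where QR: "pseudo_divmod G F = (Q, R)" by fastforce
  have div: "smult (c ^ N) G = F * Q + R" and R: "R = 0 \<or> degree R < degree F"
    using pseudo_divmod[OF F(2) QR] by (auto simp: c_def N_def)
  have "[:d:] * R - [:c ^ N:] = [:c ^ N:] * ([:d:] * G - 1) - ([:d:] * Q) * F"
  proof -
    have "[:c ^ N:] * G = F * Q + R" using div by simp
    then have "[:d:] * R = [:d:] * ([:c ^ N:] * G - F * Q)" by simp
    then show ?thesis by (simp only: algebra_simps mult_1_right mult_1_left)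
  qed
  also have "\<dots> \<in> J" using mult G F(1) ideal_ring_on_UNIV_diff[OF J] by blast
  finally have "[:d:] * R - [:c ^ N:] \<in> J" .
  moreover have "degree ([:d:] * R - [:c ^ N:]) < degree F"
  proof -
    have "degree ([:d:] * R) < degree F" using R degF by (auto intro: le_less_trans[OF degree_smult_le])
    then show ?thesis using degF by (intro degree_diff_less) auto
  qed
  ultimately have "[:d:] * R - [:c ^ N:] = 0" using least by (meson not_le)
  then have "coeff ([:d:] * R) 0 = coeff [:c ^ N:] 0" by simp
  then have "d * coeff R 0 = c ^ N" by simp
  then have "d dvd c ^ N" by (metis dvd_triv_left)
  \<comment> \<open>Modulo \<open>d\<close> the element \<open>X c\<close> is \<open>-1\<close>, so \<open>d\<close> divides a power of \<open>-1\<close>.\<close>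
  then have "d dvd [:0, 1:] ^ N * c ^ N" by simp
  moreover have "[:0, 1:] * c = d - 1" by (simp add: d_def one_pCons)
  ultimately have "d dvd (d - 1) ^ N" by (metis power_mult_distrib)
  moreover have "d dvd (d - 1) ^ N - (- 1) ^ N"
    using power_diff_sumr2[of "d - 1" N "- 1"] by simp
  ultimately have "d dvd (- 1) ^ N" by (metis dvd_diff_commute dvd_diff_right_iff dvd_diffD)
  then have "is_unit d" by (metis dvd_minus_iff dvd_power_same minus_one_power_iff one_dvd power_one)
  then have "degree d = 0" by (simp add: is_unit_iff_degree d_def)
  then show False using c by (simp add: d_def)
qed

text \<open>
  The leading coefficient of \<open>Q h\<close> is a unit times that of \<open>h\<close>, so \<open>p\<close> divides the leading coefficient
  of \<open>h\<close>; subtract the leading term and repeat.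
\<close>
lemma const_dvd_cancel_unit_lead:
  fixes h Q :: "'a::idom poly"
  assumes "lead_coeff Q dvd 1" "[:p:] dvd Q * h"
  shows "[:p:] dvd h"
  using assms(2)
proof (induction "degree h" arbitrary: h rule: less_induct)
  case less
  show ?case
  proof (cases "h = 0")
    case False
    have "p dvd lead_coeff Q * lead_coeff h"
      using less.prems unfolding const_poly_dvd_iff by (metis coeff_mult_degree_sum)
    moreover obtain u where "1 = lead_coeff Q * u" using assms(1) by (rule dvdE)
    then have "lead_coeff h = u * (lead_coeff Q * lead_coeff h)" by (simp add: mult_ac)
    ultimately have p: "p dvd lead_coeff h" by (metis dvd_mult)
    define h' where "h' = h - monom (lead_coeff h) (degree h)"
    have m: "[:p:] dvd monom (lead_coeff h) (degree h)"
      using p by (auto simp: const_poly_dvd_iff)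
    have "Q * h' = Q * h - Q * monom (lead_coeff h) (degree h)" by (simp add: h'_def algebra_simps)
    then have dvd: "[:p:] dvd Q * h'" using less.prems m by (metis dvd_diff dvd_mult)
    have "[:p:] dvd h'"
    proof (cases "degree h = 0")
      case True
      then obtain a where "h = [:a:]" using degree_eq_zeroE by blast
      then show ?thesis by (simp add: h'_def monom_0)
    next
      case False
      have "degree h' < degree h"
      proof -
        have "degree h' \<le> degree h" by (simp add: h'_def degree_monom_le degree_diff_le)
        moreover have "coeff h' (degree h) = 0" by (simp add: h'_def)
        ultimately have "h' = 0 \<or> degree h' < degree h" by (rule eq_zero_or_degree_less)
        then show ?thesis using False by auto
      qed
      then show ?thesis using less.hyps dvd by blast
    qed
    then have "[:p:] dvd h' + monom (lead_coeff h) (degree h)" using m by (rule dvd_add)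
    then show ?thesis by (simp add: h'_def)
  qed simp
qed

text \<open>
  A homogeneous linear system with more unknowns (indexed by \<open>A\<close>) than equations (indexed by \<open>B\<close>) has
  a nonzero solution, by Gaussian elimination.
\<close>
lemma nontrivial_linear_relation:
  fixes M :: "'a \<Rightarrow> 'b \<Rightarrow> 'k::field"
  assumes "finite B" "finite A" "card B < card A"
  shows "\<exists>c. (\<exists>a\<in>A. c a \<noteq> 0) \<and> (\<forall>b\<in>B. (\<Sum>a\<in>A. c a * M a b) = 0)"
  using assms
proof (induction B arbitrary: A M rule: finite_induct)
  case empty
  then have "A \<noteq> {}" by auto
  then show ?case by (intro exI[of _ "\<lambda>_. 1"]) auto
next
  case (insert b B)
  show ?case
  proof (cases "\<forall>a\<in>A. M a b = 0")
    case True
    have "card B < card A" using insert.prems insert.hyps by simp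
    from insert.IH[OF insert.prems(1) this, of M] obtain c where
      c: "\<exists>a\<in>A. c a \<noteq> 0" "\<forall>b\<in>B. (\<Sum>a\<in>A. c a * M a b) = 0" by blast
    moreover have "(\<Sum>a\<in>A. c a * M a b) = 0" using True by (intro sum.neutral) simp
    ultimately show ?thesis by (intro exI[of _ c]) auto
  next
    case False
    then obtain a0 where a0: "a0 \<in> A" "M a0 b \<noteq> 0" by blast
    \<comment> \<open>Eliminate the unknown \<open>a0\<close> by means of equation \<open>b\<close>.\<close>
    define M' where "M' a b' = M a b' - M a b / M a0 b * M a0 b'" for a b'
    have "card B < card (A - {a0})" using insert.prems insert.hyps a0(1) by simp
    from insert.IH[OF _ this, of M'] insert.prems obtain c where
      c: "\<exists>a\<in>A - {a0}. c a \<noteq> 0" "\<forall>b'\<in>B. (\<Sum>a\<in>A - {a0}. c a * M' a b') = 0" by auto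
    define c' where "c' = c(a0 := - (\<Sum>a\<in>A - {a0}. c a * M a b) / M a0 b)"
    have split: "(\<Sum>a\<in>A. c' a * M a b') = c' a0 * M a0 b' + (\<Sum>a\<in>A - {a0}. c a * M a b')" for b'
      using insert.prems(1) a0(1) by (subst sum.remove[of A a0]) (auto simp: c'_def intro!: sum.cong)
    have "(\<Sum>a\<in>A. c' a * M a b) = 0" unfolding split using a0(2) by (simp add: c'_def)
    moreover have "(\<Sum>a\<in>A. c' a * M a b') = 0" if "b' \<in> B" for b'
    proof -
      have "(\<Sum>a\<in>A. c' a * M a b') = (\<Sum>a\<in>A - {a0}. c a * M' a b')"
        unfolding split M'_def
        by (simp add: c'_def algebra_simps sum_subtractf sum_distrib_left sum_distrib_right sum_divide_distrib)
      then show ?thesis using c(2) that by simp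
    qed
    moreover have "\<exists>a\<in>A. c' a \<noteq> 0" using c(1) by (auto simp: c'_def)
    ultimately show ?thesis by (intro exI[of _ c']) auto
  qed
qed

definition bidegree_le :: "nat \<Rightarrow> 'k::comm_ring_1 poly poly \<Rightarrow> bool" where
  "bidegree_le e F \<longleftrightarrow> (\<forall>r s. coeff (coeff F s) r \<noteq> 0 \<longrightarrow> r \<le> e \<and> s \<le> e)"

lemma bidegree_le_ex: "\<exists>e\<ge>n. bidegree_le e F"
proof -
  define e where "e = n + degree F + (\<Sum>s\<le>degree F. degree (coeff F s))"
  have "r \<le> e \<and> s \<le> e" if "coeff (coeff F s) r \<noteq> 0" for r s
  proof -
    have "coeff F s \<noteq> 0" using that by auto
    then have s: "s \<le> degree F" by (rule le_degree)
    have "r \<le> degree (coeff F s)" using that by (rule le_degree)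
    also have "\<dots> \<le> (\<Sum>s\<le>degree F. degree (coeff F s))" using s by (intro member_le_sum) auto
    finally show ?thesis using s by (simp add: e_def)
  qed
  then show ?thesis by (intro exI[of _ e]) (auto simp: bidegree_le_def e_def)
qed

lemma bidegree_le_mono: "bidegree_le e F \<Longrightarrow> e \<le> e' \<Longrightarrow> bidegree_le e' F"
  unfolding bidegree_le_def by (meson order_trans)

lemma bidegree_le_mult:
  assumes "bidegree_le e F" "bidegree_le e' G" shows "bidegree_le (e + e') (F * G)"
  unfolding bidegree_le_def
proof (intro allI impI)
  fix r s assume "coeff (coeff (F * G) s) r \<noteq> 0"
  then have "(\<Sum>i\<le>s. \<Sum>j\<le>r. coeff (coeff F i) j * coeff (coeff G (s - i)) (r - j)) \<noteq> 0"
    by (simp add: coeff_mult coeff_sum)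
  then obtain i where i: "i \<le> s" "(\<Sum>j\<le>r. coeff (coeff F i) j * coeff (coeff G (s - i)) (r - j)) \<noteq> 0"
    by (meson atMost_iff sum.neutral)
  then obtain j where j: "j \<le> r" "coeff (coeff F i) j * coeff (coeff G (s - i)) (r - j) \<noteq> 0"
    by (meson atMost_iff sum.neutral)
  have "coeff (coeff F i) j \<noteq> 0" "coeff (coeff G (s - i)) (r - j) \<noteq> 0" using j(2) by auto
  then have "j \<le> e" "i \<le> e" "r - j \<le> e'" "s - i \<le> e'" using assms unfolding bidegree_le_def by blast+
  then show "r \<le> e + e' \<and> s \<le> e + e'" by linarith
qed

lemma bidegree_le_power:
  assumes "bidegree_le e F" shows "bidegree_le (n * e) (F ^ n)"
proof (induction n)
  case 0
  show ?case by (auto simp: bidegree_le_def one_pCons coeff_pCons split: nat.splits)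
next
  case (Suc n)
  then show ?case using bidegree_le_mult[OF assms Suc] by simp
qed

text \<open>
  The number of monomials \<open>f1\<^sup>i f2\<^sup>j f3\<^sup>l\<close> with exponents up to \<open>D\<close> grows like \<open>D\<^sup>3\<close>, whereas the space
  of polynomials in \<open>X\<close>, \<open>Y\<close> in which they lie has dimension of order \<open>D\<^sup>2\<close>.
\<close>
lemma algebraic_dependence_of_three:
  fixes f1 f2 f3 :: "'k::field poly poly"
  obtains c :: "nat \<Rightarrow> nat \<Rightarrow> nat \<Rightarrow> 'k" and D i0 j0 l0
  where "i0 \<le> D" "j0 \<le> D" "l0 \<le> D" "c i0 j0 l0 \<noteq> 0"
    "(\<Sum>i\<le>D. f1 ^ i * (\<Sum>j\<le>D. f2 ^ j * (\<Sum>l\<le>D. f3 ^ l * [:[:c i j l:]:]))) = 0"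
proof -
  obtain e1 where e1: "1 \<le> e1" "bidegree_le e1 f1" using bidegree_le_ex by blast
  obtain e2 where e2: "e1 \<le> e2" "bidegree_le e2 f2" using bidegree_le_ex by blast
  obtain e where e: "e2 \<le> e" "bidegree_le e f3" using bidegree_le_ex by blast
  have f: "bidegree_le e f1" "bidegree_le e f2" "bidegree_le e f3" and "1 \<le> e"
    using e e1 e2 bidegree_le_mono by (meson order_trans)+
  \<comment> \<open>With \<open>D + 1 = K\<^sup>2\<close> there are \<open>K\<^sup>6\<close> monomials in \<open>f1, f2, f3\<close>, against \<open>(3 D e + 1)\<^sup>2 < (K (D + 1))\<^sup>2 = K\<^sup>6\<close> coefficients.\<close>
  define K where "K = 3 * e + 1"
  define D where "D = K ^ 2 - 1"
  have SD: "D + 1 = K ^ 2" by (simp add: D_def K_def)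
  define A where "A = {..D} \<times> {..D} \<times> {..D}"
  define B where "B = {..3 * D * e} \<times> {..3 * D * e}"
  have "3 * D * e + 1 < K * (D + 1)" using \<open>1 \<le> e\<close> by (simp add: K_def algebra_simps)
  then have "(3 * D * e + 1) * (3 * D * e + 1) < (K * (D + 1)) * (K * (D + 1))"
    by (intro mult_strict_mono') auto
  also have "\<dots> = (D + 1) * ((D + 1) * (D + 1))" unfolding SD by (simp add: power2_eq_square algebra_simps)
  finally have "card B < card A" unfolding A_def B_def by (simp add: card_cartesian_product)
  define f where "f a = (case a of (i, j, l) \<Rightarrow> f1 ^ i * (f2 ^ j * f3 ^ l))" for a
  obtain c where c: "\<exists>a\<in>A. c a \<noteq> 0"
    "\<forall>b\<in>B. (\<Sum>a\<in>A. c a * (case b of (r, s) \<Rightarrow> coeff (coeff (f a) s) r)) = 0"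
    using nontrivial_linear_relation[of B A "\<lambda>a b. case b of (r, s) \<Rightarrow> coeff (coeff (f a) s) r"]
      \<open>card B < card A\<close> by (auto simp: A_def B_def)
  have bd: "bidegree_le (3 * D * e) (f a)" if a: "a \<in> A" for a
  proof -
    obtain i j l where ijl: "a = (i, j, l)" "i \<le> D" "j \<le> D" "l \<le> D" using a by (auto simp: A_def)
    have "bidegree_le (i * e + (j * e + l * e)) (f a)"
      unfolding f_def ijl(1) prod.case by (intro bidegree_le_mult bidegree_le_power f)
    moreover have "i * e + (j * e + l * e) \<le> 3 * D * e"
    proof -
      have "i * e + (j * e + l * e) = (i + j + l) * e" by (simp add: algebra_simps)
      also have "\<dots> \<le> 3 * D * e" using ijl by (intro mult_right_mono) auto
      finally show ?thesis .
    qed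
    ultimately show ?thesis by (rule bidegree_le_mono)
  qed
  have "(\<Sum>a\<in>A. f a * [:[:c a:]:]) = 0"
  proof (intro poly_eqI)
    fix s r
    have "coeff (coeff (\<Sum>a\<in>A. f a * [:[:c a:]:]) s) r = (\<Sum>a\<in>A. c a * coeff (coeff (f a) s) r)"
      by (simp add: coeff_sum mult.commute)
    also have "\<dots> = 0"
    proof (cases "(r, s) \<in> B")
      case True
      then show ?thesis using c(2) by fastforce
    next
      case False
      then have "\<And>a. a \<in> A \<Longrightarrow> coeff (coeff (f a) s) r = 0"
        using bd unfolding bidegree_le_def B_def by fastforce
      then show ?thesis by (intro sum.neutral) simp
    qed
    finally show "coeff (coeff (\<Sum>a\<in>A. f a * [:[:c a:]:]) s) r = coeff (coeff 0 s) r" by simp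
  qed
  moreover have "(\<Sum>a\<in>A. f a * [:[:c a:]:]) =
      (\<Sum>i\<le>D. f1 ^ i * (\<Sum>j\<le>D. f2 ^ j * (\<Sum>l\<le>D. f3 ^ l * [:[:c (i, j, l):]:])))"
    unfolding A_def f_def
    by (simp add: sum.cartesian_product sum_distrib_left mult.assoc case_prod_unfold)
  moreover obtain i0 j0 l0 where "i0 \<le> D" "j0 \<le> D" "l0 \<le> D" "c (i0, j0, l0) \<noteq> 0"
    using c(1) by (auto simp: A_def)
  ultimately show thesis using that[of i0 D j0 l0 "\<lambda>i j l. c (i, j, l)"] by simp
qed

text \<open>
  Divide the sum by the power \<open>f\<^sup>i\<^sup>0\<close>, which is not in the prime \<open>J\<close>: the quotient lies in
  \<open>J \<subseteq> J'\<close> and is \<open>g i0\<close> plus a multiple of \<open>f \<in> J'\<close>.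
\<close>
lemma lowest_coefficient_mem:
  fixes J J' :: "'r::comm_ring_1 set"
  assumes J: "primeideal J (ring_on UNIV)" and J': "ideal J' (ring_on UNIV)" and "J \<subseteq> J'"
    and f: "f \<notin> J" "f \<in> J'" and i0: "i0 \<le> D" "\<And>i. i < i0 \<Longrightarrow> g i = 0"
    and sum: "(\<Sum>i\<le>D. f ^ i * g i) \<in> J"
  shows "g i0 \<in> J'"
proof -
  interpret J: primeideal J "ring_on UNIV" by (rule J)
  have prime: "x \<in> J \<or> y \<in> J" if "x * y \<in> J" for x y using J.I_prime[of x y] that by simp
  have one: "1 \<notin> J" using J.I_notcarr J.one_imp_carrier by auto
  have pow: "f ^ n \<notin> J" for n
    by (induction n) (use one prime f(1) in auto)
  define q where "q = (\<Sum>i=Suc i0..D. f ^ (i - Suc i0) * g i)"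
  have "(\<Sum>i\<le>D. f ^ i * g i) = (\<Sum>i=i0..D. f ^ i * g i)"
    using i0 by (intro sum.mono_neutral_right) auto
  also have "\<dots> = f ^ i0 * g i0 + (\<Sum>i=Suc i0..D. f ^ i * g i)"
    using i0(1) by (rule sum.atLeast_Suc_atMost)
  also have "(\<Sum>i=Suc i0..D. f ^ i * g i) = f ^ Suc i0 * q"
    unfolding q_def sum_distrib_left
  proof (rule sum.cong)
    fix i assume "i \<in> {Suc i0..D}"
    then have "f ^ i = f ^ Suc i0 * f ^ (i - Suc i0)" by (simp only: power_add[symmetric]) simp
    then show "f ^ i * g i = f ^ Suc i0 * (f ^ (i - Suc i0) * g i)" by (simp only: mult.assoc)
  qed simp
  also have "f ^ i0 * g i0 + f ^ Suc i0 * q = f ^ i0 * (g i0 + f * q)" by (simp add: algebra_simps)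
  finally have "g i0 + f * q \<in> J" using sum prime pow by metis
  then have "g i0 + f * q \<in> J'" using \<open>J \<subseteq> J'\<close> by blast
  moreover have "q * f \<in> J'" using J' f(2) unfolding ideal_ring_on_iff[OF is_subring_UNIV] by blast
  ultimately have "(g i0 + f * q) - q * f \<in> J'" by (rule ideal_ring_on_UNIV_diff[OF J'])
  then show ?thesis by (simp add: algebra_simps)
qed

text \<open>
  Given primes \<open>P 0 \<subset> P 1 \<subset> P 2 \<subset> P 3\<close>, choose \<open>f\<^sub>i \<in> P i - P (i - 1)\<close> and a polynomial relation between
  \<open>f\<^sub>1, f\<^sub>2, f\<^sub>3\<close>. Peeling off \<open>f\<^sub>1\<close>, \<open>f\<^sub>2\<close>, \<open>f\<^sub>3\<close> in turn, the coefficient of the lexicographically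
  smallest monomial of the relation ends up in \<open>P 3\<close>, although it is a nonzero constant.
\<close>
lemma krull_dim_bivariate_le: "krull_dim (ring_on (UNIV :: 'k::field poly poly set)) \<le> 2"
  unfolding krull_dim_def
proof (rule Sup_least, clarify)
  fix n and P :: "nat \<Rightarrow> 'k poly poly set"
  let ?R = "ring_on (UNIV :: 'k poly poly set)"
  assume P: "\<forall>i\<le>n. primeideal (P i) ?R" and strict: "\<forall>i<n. P i \<subset> P (Suc i)"
  have "n \<le> 2"
  proof (rule ccontr)
    assume "\<not> n \<le> 2"
    then have pr: "primeideal (P 0) ?R" "primeideal (P 1) ?R" "primeideal (P 2) ?R" "primeideal (P 3) ?R"
      using P by auto
    note id = pr[THEN primeideal.axioms(1)]
    have lt: "P 0 \<subset> P 1" "P 1 \<subset> P 2" "P 2 \<subset> P 3"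
      using strict \<open>\<not> n \<le> 2\<close> by (auto simp: numeral_eq_Suc)
    obtain f1 where f1: "f1 \<in> P 1" "f1 \<notin> P 0" using lt(1) by blast
    obtain f2 where f2: "f2 \<in> P 2" "f2 \<notin> P 1" using lt(2) by blast
    obtain f3 where f3: "f3 \<in> P 3" "f3 \<notin> P 2" using lt(3) by blast
    obtain c :: "nat \<Rightarrow> nat \<Rightarrow> nat \<Rightarrow> 'k" and D i1 j1 l1 where
      ne: "i1 \<le> D" "j1 \<le> D" "l1 \<le> D" "c i1 j1 l1 \<noteq> 0" and
      rel: "(\<Sum>i\<le>D. f1 ^ i * (\<Sum>j\<le>D. f2 ^ j * (\<Sum>l\<le>D. f3 ^ l * [:[:c i j l:]:]))) = 0"
      by (rule algebraic_dependence_of_three)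
    \<comment> \<open>The lexicographically smallest exponent vector \<open>(i0, j0, l0)\<close> with nonzero coefficient.\<close>
    define i0 where "i0 = (LEAST i. \<exists>j\<le>D. \<exists>l\<le>D. c i j l \<noteq> 0)"
    have i0: "\<exists>j\<le>D. \<exists>l\<le>D. c i0 j l \<noteq> 0" unfolding i0_def by (rule LeastI[of _ i1]) (use ne in blast)
    have i0_less: "c i j l = 0" if "i < i0" "j \<le> D" "l \<le> D" for i j l
      using not_less_Least[OF that(1)[unfolded i0_def]] that(2,3) by blast
    have "i0 \<le> i1" unfolding i0_def by (rule Least_le) (use ne in blast)
    define j0 where "j0 = (LEAST j. j \<le> D \<and> (\<exists>l\<le>D. c i0 j l \<noteq> 0))"
    have j0: "j0 \<le> D \<and> (\<exists>l\<le>D. c i0 j0 l \<noteq> 0)" unfolding j0_def using i0 by (rule LeastI_ex)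
    have j0_less: "c i0 j l = 0" if "j < j0" "l \<le> D" for j l
      using not_less_Least[OF that(1)[unfolded j0_def]] that j0 by auto
    define l0 where "l0 = (LEAST l. l \<le> D \<and> c i0 j0 l \<noteq> 0)"
    have l0: "l0 \<le> D \<and> c i0 j0 l0 \<noteq> 0" unfolding l0_def by (rule LeastI_ex) (use j0 in blast)
    have l0_less: "c i0 j0 l = 0" if "l < l0" for l
      using not_less_Least[OF that(1)[unfolded l0_def]] that l0 by auto
    have zero: "0 \<in> P 0" using id(1) unfolding ideal_ring_on_iff[OF is_subring_UNIV] by blast
    have "(\<Sum>j\<le>D. f2 ^ j * (\<Sum>l\<le>D. f3 ^ l * [:[:c i0 j l:]:])) \<in> P 1"
      by (rule lowest_coefficient_mem[OF pr(1) id(2) _ f1(2,1), of i0 D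
            "\<lambda>i. \<Sum>j\<le>D. f2 ^ j * (\<Sum>l\<le>D. f3 ^ l * [:[:c i j l:]:])"])
        (use lt(1) i0_less \<open>i0 \<le> i1\<close> ne(1) rel zero in \<open>auto intro!: sum.neutral\<close>)
    then have "(\<Sum>l\<le>D. f3 ^ l * [:[:c i0 j0 l:]:]) \<in> P 2"
      by (intro lowest_coefficient_mem[OF pr(2) id(3) _ f2(2,1), of j0 D
            "\<lambda>j. \<Sum>l\<le>D. f3 ^ l * [:[:c i0 j l:]:]"])
        (use lt(2) j0_less j0 in \<open>auto intro!: sum.neutral\<close>)
    then have "[:[:c i0 j0 l0:]:] \<in> P 3"
      by (intro lowest_coefficient_mem[OF pr(3) id(4) _ f3(2,1), of l0 D "\<lambda>l. [:[:c i0 j0 l:]:]"])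
        (use lt(3) l0_less l0 in auto)
    then have "[:[:inverse (c i0 j0 l0):]:] * [:[:c i0 j0 l0:]:] \<in> P 3"
      using id(4) unfolding ideal_ring_on_iff[OF is_subring_UNIV] by blast
    then have "\<one>\<^bsub>?R\<^esub> \<in> P 3" using l0 by (simp add: one_pCons)
    then show False
      using ideal.one_imp_carrier[OF id(4)] primeideal.I_notcarr[OF pr(4)] by blast
  qed
  then show "enat n \<le> 2" by (simp add: numeral_eq_enat)
qed

section \<open>Evaluating and restricting polynomials\<close>

definition ring_morphism :: "('r::comm_ring_1 \<Rightarrow> 's::comm_ring_1) \<Rightarrow> bool" where
  "ring_morphism f \<longleftrightarrow> f 1 = 1 \<and> (\<forall>x y. f (x + y) = f x + f y) \<and> (\<forall>x y. f (x * y) = f x * f y)"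

lemma ring_morphismD:
  assumes "ring_morphism f"
  shows "f 1 = 1" "f (x + y) = f x + f y" "f (x * y) = f x * f y" "f 0 = 0" "f (- x) = - f x"
    "f (x - y) = f x - f y" "f (sum g B) = (\<Sum>b\<in>B. f (g b))"
proof -
  show *: "f 1 = 1" "\<And>x y. f (x + y) = f x + f y" "\<And>x y. f (x * y) = f x * f y"
    using assms by (auto simp: ring_morphism_def)
  have "f 0 + f 0 = f 0 + 0" using *(2)[of 0 0] by simp
  then show 0: "f 0 = 0" by (rule add_left_imp_eq)
  have "f (- x) + f x = 0" for x using *(2)[of "- x" x] 0 by simp
  then show neg: "\<And>x. f (- x) = - f x" by (rule eq_neg_iff_add_eq_0[THEN iffD2])
  show "f (x - y) = f x - f y" using *(2)[of x "- y"] neg by simp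
  show "f (sum g B) = (\<Sum>b\<in>B. f (g b))"
    by (induction B rule: infinite_finite_induct) (simp_all add: 0 *)
qed

definition poly_eval :: "('r::comm_ring_1 \<Rightarrow> 's::comm_ring_1) \<Rightarrow> 's \<Rightarrow> 'r poly \<Rightarrow> 's" where
  "poly_eval \<kappa> t p = poly (map_poly \<kappa> p) t"

context
  fixes \<kappa> :: "'r::comm_ring_1 \<Rightarrow> 's::comm_ring_1"
  assumes \<kappa>: "ring_morphism \<kappa>"
begin

lemma poly_eval_0: "poly_eval \<kappa> t 0 = 0"
  by (simp add: poly_eval_def)

lemma poly_eval_pCons: "poly_eval \<kappa> t (pCons c p) = \<kappa> c + t * poly_eval \<kappa> t p"
  by (simp add: poly_eval_def map_poly_pCons ring_morphismD(4)[OF \<kappa>])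

lemma poly_eval_morphism: "ring_morphism (poly_eval \<kappa> t)"
proof -
  have add: "poly_eval \<kappa> t (p + q) = poly_eval \<kappa> t p + poly_eval \<kappa> t q" for p q
    by (induction p q rule: poly_induct2)
      (simp_all add: poly_eval_0 poly_eval_pCons ring_morphismD[OF \<kappa>] algebra_simps)
  have smult: "poly_eval \<kappa> t (smult c q) = \<kappa> c * poly_eval \<kappa> t q" for c q
    by (induction q) (simp_all add: poly_eval_0 poly_eval_pCons ring_morphismD[OF \<kappa>] algebra_simps)
  have mult: "poly_eval \<kappa> t (p * q) = poly_eval \<kappa> t p * poly_eval \<kappa> t q" for p q
    by (induction p)
      (simp_all add: poly_eval_0 poly_eval_pCons add smult ring_morphismD[OF \<kappa>] algebra_simps)
  show ?thesis unfolding ring_morphism_def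
    by (simp add: add mult one_pCons poly_eval_0 poly_eval_pCons ring_morphismD[OF \<kappa>])
qed

lemma poly_eval_const: "poly_eval \<kappa> t [:c:] = \<kappa> c"
  by (simp add: poly_eval_0 poly_eval_pCons)

lemma poly_eval_var: "poly_eval \<kappa> t [:0, 1:] = t"
  by (simp add: poly_eval_0 poly_eval_pCons ring_morphismD[OF \<kappa>])

lemma morphism_poly_eval:
  assumes f: "ring_morphism f"
  shows "f (poly_eval \<kappa> t p) = poly_eval (\<lambda>c. f (\<kappa> c)) (f t) p"
proof -
  have "ring_morphism (\<lambda>c. f (\<kappa> c))"
    unfolding ring_morphism_def by (simp add: ring_morphismD[OF \<kappa>] ring_morphismD[OF f])
  then show ?thesis
    by (induction p) (simp_all add: poly_eval_def map_poly_pCons ring_morphismD[OF f] ring_morphismD[OF \<kappa>])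
qed

lemma poly_eval_mem:
  assumes "is_subring A" "\<And>c. \<kappa> c \<in> A" "t \<in> A" shows "poly_eval \<kappa> t p \<in> A"
  by (induction p) (simp_all add: poly_eval_0 poly_eval_pCons is_subringD[OF assms(1)] assms(2,3))

end

lemma ring_morphism_const_poly: "ring_morphism (\<lambda>c. [:c:])"
  by (simp add: ring_morphism_def one_pCons)

lemma poly_eval_const_var: "poly_eval (\<lambda>c. [:c:]) [:0, 1:] p = p"
  by (induction p) (simp_all add: poly_eval_0 poly_eval_pCons ring_morphism_const_poly)

lemma poly_eval_const_var_map: "poly_eval (\<lambda>c. [:[:c:]:]) [:0, 1:] p = map_poly (\<lambda>c. [:c:]) p"
proof -
  have m: "ring_morphism (\<lambda>c. [:[:c:]:])" by (simp add: ring_morphism_def one_pCons)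
  show ?thesis by (induction p) (simp_all add: poly_eval_0[OF m] poly_eval_pCons[OF m] map_poly_pCons)
qed

lemma poly_eval_const_const_var: "poly_eval (\<lambda>c. [:[:c:]:]) [:[:0, 1:]:] p = [:p:]"
  using morphism_poly_eval[OF ring_morphism_const_poly ring_morphism_const_poly, of "[:0, 1:]" p]
  by (simp add: poly_eval_const_var)

abbreviation const_mpoly :: "'k::field \<Rightarrow> ('v \<Rightarrow>\<^sub>0 nat) \<Rightarrow>\<^sub>0 'k" where
  "const_mpoly c \<equiv> Poly_Mapping.single 0 c"

lemma ring_morphism_const_mpoly: "ring_morphism const_mpoly"
  by (simp add: ring_morphism_def single_add mult_single)

text \<open>
  The image of \<open>p\<close> under the substitution \<open>v \<mapsto> X\<close>, \<open>w \<mapsto> Y\<close> and all other variables to zero, where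
  \<open>X\<close> is the inner and \<open>Y\<close> the outer indeterminate of \<open>k[X][Y]\<close>.
\<close>
definition face_poly :: "'v \<Rightarrow> 'v \<Rightarrow> (('v \<Rightarrow>\<^sub>0 nat) \<Rightarrow>\<^sub>0 'k::field) \<Rightarrow> 'k poly poly" where
  "face_poly v w p = (\<Sum>m\<in>Poly_Mapping.keys p. if Poly_Mapping.keys m \<subseteq> {v, w}
     then monom (monom (Poly_Mapping.lookup p m) (Poly_Mapping.lookup m v)) (Poly_Mapping.lookup m w) else 0)"

abbreviation edge_monomial :: "'v \<Rightarrow> nat \<Rightarrow> 'v \<Rightarrow> nat \<Rightarrow> 'v \<Rightarrow>\<^sub>0 nat" where
  "edge_monomial v r w s \<equiv> Poly_Mapping.single v r + Poly_Mapping.single w s"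

context
  fixes v w :: 'v
  assumes vw: "v \<noteq> w"
begin

lemma edge_monomial_eq_iff:
  "m = edge_monomial v r w s \<longleftrightarrow>
    Poly_Mapping.keys m \<subseteq> {v, w} \<and> Poly_Mapping.lookup m v = r \<and> Poly_Mapping.lookup m w = s"
proof
  assume R: "Poly_Mapping.keys m \<subseteq> {v, w} \<and> Poly_Mapping.lookup m v = r \<and> Poly_Mapping.lookup m w = s"
  show "m = edge_monomial v r w s"
  proof (rule poly_mapping_eqI)
    fix u
    have "u \<in> {v, w} \<or> Poly_Mapping.lookup m u = 0" using R by (auto simp: in_keys_iff subset_iff)
    then show "Poly_Mapping.lookup m u = Poly_Mapping.lookup (edge_monomial v r w s) u"
      using R vw by (auto simp: lookup_add lookup_single when_def)
  qed
qed (use vw in \<open>auto simp: lookup_add lookup_single when_def in_keys_iff split: if_splits\<close>)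

lemma coeff_face_poly: "coeff (coeff (face_poly v w p) s) r = Poly_Mapping.lookup p (edge_monomial v r w s)"
proof -
  have "coeff (coeff (face_poly v w p) s) r =
      (\<Sum>m\<in>Poly_Mapping.keys p. if m = edge_monomial v r w s then Poly_Mapping.lookup p m else 0)"
    unfolding face_poly_def coeff_sum edge_monomial_eq_iff
    by (intro sum.cong) auto
  then show ?thesis by (simp add: in_keys_iff)
qed

lemma face_poly_add: "face_poly v w (p + q) = face_poly v w p + face_poly v w q"
  by (intro poly_eqI) (simp add: coeff_face_poly lookup_add)

lemma face_poly_0: "face_poly v w 0 = 0"
  by (simp add: face_poly_def)

lemma face_poly_sum: "face_poly v w (sum f B) = (\<Sum>b\<in>B. face_poly v w (f b))"
  by (induction B rule: infinite_finite_induct) (simp_all add: face_poly_0 face_poly_add)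

lemma face_poly_single:
  "face_poly v w (Poly_Mapping.single m c) = (if Poly_Mapping.keys m \<subseteq> {v, w}
     then monom (monom c (Poly_Mapping.lookup m v)) (Poly_Mapping.lookup m w) else 0)"
  by (cases "c = 0") (simp_all add: face_poly_def)

lemma face_poly_mult_single:
  "face_poly v w (Poly_Mapping.single m c * Poly_Mapping.single n d) =
     face_poly v w (Poly_Mapping.single m c) * face_poly v w (Poly_Mapping.single n d)"
  by (auto simp: mult_single face_poly_single keys_plus_nat mult_monom lookup_add)

lemma face_poly_mult: "face_poly v w (p * q) = face_poly v w p * face_poly v w q"
proof -
  let ?s = "\<lambda>p m. Poly_Mapping.single m (Poly_Mapping.lookup p m)"
  have "p * q = (\<Sum>m\<in>Poly_Mapping.keys p. ?s p m) * (\<Sum>n\<in>Poly_Mapping.keys q. ?s q n)"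
    by (simp add: poly_mapping_eq_sum_single[symmetric])
  also have "face_poly v w \<dots> = (\<Sum>m\<in>Poly_Mapping.keys p. face_poly v w (?s p m)) *
      (\<Sum>n\<in>Poly_Mapping.keys q. face_poly v w (?s q n))"
    by (simp only: sum_product face_poly_sum face_poly_mult_single)
  also have "\<dots> = face_poly v w p * face_poly v w q"
    by (simp add: face_poly_sum[symmetric] poly_mapping_eq_sum_single[symmetric])
  finally show ?thesis .
qed

lemma face_poly_const: "face_poly v w (const_mpoly c) = [:[:c:]:]"
  by (simp add: face_poly_single monom_0)

lemma face_poly_morphism: "ring_morphism (face_poly v w)"
  unfolding ring_morphism_def
  using face_poly_const[of 1] by (simp add: face_poly_add face_poly_mult one_pCons)

lemma face_poly_variable:
  "face_poly v w (variable u) = (if u = v then [:[:0, 1:]:] else if u = w then [:0, 1:] else 0)"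
  using vw by (auto simp: variable_def face_poly_single lookup_single when_def monom_0 monom_Suc one_pCons)

lemma face_poly_eq_0_iff:
  "face_poly v w p = 0 \<longleftrightarrow> (\<forall>m\<in>Poly_Mapping.keys p. \<not> Poly_Mapping.keys m \<subseteq> {v, w})"
proof
  assume 0: "face_poly v w p = 0"
  show "\<forall>m\<in>Poly_Mapping.keys p. \<not> Poly_Mapping.keys m \<subseteq> {v, w}"
  proof (intro ballI notI)
    fix m assume m: "m \<in> Poly_Mapping.keys p" "Poly_Mapping.keys m \<subseteq> {v, w}"
    then have "m = edge_monomial v (Poly_Mapping.lookup m v) w (Poly_Mapping.lookup m w)"
      unfolding edge_monomial_eq_iff by simp
    then have "Poly_Mapping.lookup p m = 0" using 0 coeff_face_poly by (metis coeff_0)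
    then show False using m(1) by (simp add: in_keys_iff)
  qed
qed (auto simp: face_poly_def intro!: sum.neutral)

end

section \<open>Stanley-Reisner ideals\<close>

lemma polynomial_ring_simps [simp]:
  "mult (polynomial_ring V) = (*)" "one (polynomial_ring V) = 1"
  "zero (polynomial_ring V) = 0" "add (polynomial_ring V) = (+)"
  by (simp_all add: polynomial_ring_def)

lemma cring_polynomial_ring: "cring (polynomial_ring V)"
  by (subst polynomial_ring_eq) (rule cring_ring_on[OF is_subring_polynomial_ring])

lemma ideal_polynomial_ring_iff:
  "ideal J (polynomial_ring V) \<longleftrightarrow> J \<subseteq> carrier (polynomial_ring V) \<and> 0 \<in> J \<and>
    (\<forall>x\<in>J. \<forall>y\<in>J. x + y \<in> J) \<and> (\<forall>a\<in>carrier (polynomial_ring V). \<forall>x\<in>J. a * x \<in> J)"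
  by (subst polynomial_ring_eq) (rule ideal_ring_on_iff[OF is_subring_polynomial_ring])

lemma ideal_polynomial_ring_sum:
  assumes "ideal J (polynomial_ring V)" "\<And>i. i \<in> B \<Longrightarrow> f i \<in> J"
  shows "sum f B \<in> J"
  using assms(2) assms(1)[unfolded ideal_polynomial_ring_iff]
  by (induction B rule: infinite_finite_induct) auto

lemma prod_single:
  "(\<Prod>i\<in>B. Poly_Mapping.single (f i) (1 :: 'k::comm_ring_1)) =
     Poly_Mapping.single (\<Sum>i\<in>B. f i :: 'v \<Rightarrow>\<^sub>0 nat) 1"
  by (induction B rule: infinite_finite_induct) (simp_all add: mult_single)

lemma single_eq_const_times_variables:
  "Poly_Mapping.single m c =
     const_mpoly c * (\<Prod>v\<in>Poly_Mapping.keys m. variable v ^ Poly_Mapping.lookup m v)"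
  by (simp add: variable_power prod_single mult_single poly_mapping_eq_sum_single[symmetric])

lemma lookup_sum_single_1:
  assumes "finite F"
  shows "Poly_Mapping.lookup (\<Sum>v\<in>F. Poly_Mapping.single v (Suc 0)) u = (if u \<in> F then 1 else 0)"
  using assms by (simp add: lookup_sum lookup_single when_def)

text \<open>
  The Stanley-Reisner ideal is spanned by the monomials whose support is not a face: these monomials
  absorb multiplication because \<open>\<Delta>\<close> is closed under subsets, and each of them is a multiple of the
  squarefree monomial on its support.
\<close>
lemma mem_stanley_reisner_ideal_iff:
  fixes p :: "('v \<Rightarrow>\<^sub>0 nat) \<Rightarrow>\<^sub>0 'k::field"
  assumes down: "\<And>F F'. F \<in> \<Delta> \<Longrightarrow> F' \<subseteq> F \<Longrightarrow> F' \<in> \<Delta>"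
  shows "p \<in> stanley_reisner_ideal V \<Delta> \<longleftrightarrow>
    p \<in> carrier (polynomial_ring V) \<and> (\<forall>m\<in>Poly_Mapping.keys p. Poly_Mapping.keys m \<notin> \<Delta>)"
proof -
  let ?A = "polynomial_ring V :: (('v \<Rightarrow>\<^sub>0 nat) \<Rightarrow>\<^sub>0 'k) ring"
  let ?G = "{\<Prod>v\<in>F. variable v :: ('v \<Rightarrow>\<^sub>0 nat) \<Rightarrow>\<^sub>0 'k | F. finite F \<and> F \<subseteq> V \<and> F \<notin> \<Delta>}"
  let ?K = "{p \<in> carrier ?A. \<forall>m\<in>Poly_Mapping.keys p. Poly_Mapping.keys m \<notin> \<Delta>}"
  interpret A: cring ?A by (rule cring_polynomial_ring)
  have G: "?G \<subseteq> carrier ?A"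
    by (auto intro!: is_subring_prod[OF is_subring_polynomial_ring] variable_in_polynomial_ring)
  have prod: "(\<Prod>v\<in>F. variable v :: ('v \<Rightarrow>\<^sub>0 nat) \<Rightarrow>\<^sub>0 'k) =
      Poly_Mapping.single (\<Sum>v\<in>F. Poly_Mapping.single v 1) 1" for F
    by (simp add: variable_def prod_single)
  have "ideal ?K ?A"
    unfolding ideal_polynomial_ring_iff
  proof (intro conjI ballI)
    show "0 \<in> ?K" by (simp add: is_subringD(2)[OF is_subring_polynomial_ring])
  next
    fix x y assume "x \<in> ?K" "y \<in> ?K"
    then show "x + y \<in> ?K"
      using keys_add[of x y] by (auto intro: is_subringD(6)[OF is_subring_polynomial_ring])
  next
    fix a x assume a: "a \<in> carrier ?A" and x: "x \<in> ?K"
    have "Poly_Mapping.keys m \<notin> \<Delta>" if "m \<in> Poly_Mapping.keys (a * x)" for m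
    proof -
      obtain m1 m2 where m: "m = m1 + m2" "m2 \<in> Poly_Mapping.keys x" using keys_mult[of a x] \<open>m \<in> _\<close> by blast
      then have "Poly_Mapping.keys m2 \<notin> \<Delta>" using x by blast
      then show ?thesis using down[of "Poly_Mapping.keys m" "Poly_Mapping.keys m2"] m(1) by (auto simp: keys_plus_nat)
    qed
    then show "a * x \<in> ?K" using a x by (auto intro: is_subringD(4)[OF is_subring_polynomial_ring])
  qed auto
  moreover have "?G \<subseteq> ?K"
  proof
    fix g assume g: "g \<in> ?G"
    then obtain F where F: "finite F" "F \<notin> \<Delta>" "g = (\<Prod>v\<in>F. variable v)" by blast
    have "Poly_Mapping.keys (\<Sum>v\<in>F. Poly_Mapping.single v (1::nat)) = F"
      using F(1) by (auto simp: in_keys_iff lookup_sum_single_1 split: if_splits)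
    then show "g \<in> ?K" using G g F by (auto simp: prod)
  qed
  ultimately have "stanley_reisner_ideal V \<Delta> \<subseteq> ?K"
    unfolding stanley_reisner_ideal_def by (rule A.genideal_minimal)
  moreover have "?K \<subseteq> stanley_reisner_ideal V \<Delta>"
  proof
    fix p assume p: "p \<in> ?K"
    have I: "ideal (stanley_reisner_ideal V \<Delta>) ?A"
      unfolding stanley_reisner_ideal_def by (rule A.genideal_ideal[OF G])
    have gen: "?G \<subseteq> stanley_reisner_ideal V \<Delta>"
      unfolding stanley_reisner_ideal_def by (rule A.genideal_self[OF G])
    have "Poly_Mapping.single m c \<in> stanley_reisner_ideal V \<Delta>"
      if m: "Poly_Mapping.keys m \<subseteq> V" "Poly_Mapping.keys m \<notin> \<Delta>" for m and c :: 'k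
    proof -
      let ?e = "\<Sum>v\<in>Poly_Mapping.keys m. Poly_Mapping.single v (1::nat)"
      have "m = (m - ?e) + ?e"
        by (rule poly_mapping_eqI) (auto simp: lookup_add lookup_minus lookup_sum_single_1 in_keys_iff)
      then have eq: "Poly_Mapping.single m c = Poly_Mapping.single (m - ?e) c * (\<Prod>v\<in>Poly_Mapping.keys m. variable v)"
        unfolding prod by (simp add: mult_single)
      have "(\<Prod>v\<in>Poly_Mapping.keys m. variable v :: ('v \<Rightarrow>\<^sub>0 nat) \<Rightarrow>\<^sub>0 'k) \<in> stanley_reisner_ideal V \<Delta>"
        by (rule subsetD[OF gen], intro CollectI exI[of _ "Poly_Mapping.keys m"] conjI refl) (use m in simp_all)
      moreover have "Poly_Mapping.single (m - ?e) c \<in> carrier ?A"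
        using m(1) by (auto simp: mem_polynomial_ring_iff in_keys_iff lookup_minus subset_iff)
      ultimately show ?thesis unfolding eq using I[unfolded ideal_polynomial_ring_iff] by blast
    qed
    then have "(\<Sum>m\<in>Poly_Mapping.keys p. Poly_Mapping.single m (Poly_Mapping.lookup p m)) \<in> stanley_reisner_ideal V \<Delta>"
      using p by (intro ideal_polynomial_ring_sum[OF I]) (auto simp: mem_polynomial_ring_iff)
    then show "p \<in> stanley_reisner_ideal V \<Delta>" by (simp add: poly_mapping_eq_sum_single[symmetric])
  qed
  ultimately show ?thesis by blast
qed

lemma uminus_ring_on:
  assumes A: "is_subring A" and "x \<in> A" shows "\<ominus>\<^bsub>ring_on A\<^esub> x = - x"
proof -
  interpret cring "ring_on A" by (rule cring_ring_on[OF A])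
  show ?thesis using assms is_subringD(5)[OF A] by (intro minus_equality) auto
qed

lemma minus_polynomial_ring:
  assumes "x \<in> carrier (polynomial_ring V)" "y \<in> carrier (polynomial_ring V)"
  shows "x \<ominus>\<^bsub>polynomial_ring V\<^esub> y = x - y"
  using uminus_ring_on[OF is_subring_polynomial_ring assms(2)]
  by (simp add: a_minus_def polynomial_ring_eq[symmetric])

lemma polynomial_ring_generated:
  fixes S :: "(('v \<Rightarrow>\<^sub>0 nat) \<Rightarrow>\<^sub>0 'k::field) set"
  assumes S: "is_subring S" and const: "\<And>c. const_mpoly c \<in> S" and var: "\<And>v. v \<in> V \<Longrightarrow> variable v \<in> S"
  shows "carrier (polynomial_ring V) \<subseteq> S"
proof
  fix p :: "('v \<Rightarrow>\<^sub>0 nat) \<Rightarrow>\<^sub>0 'k" assume p: "p \<in> carrier (polynomial_ring V)"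
  have "(\<Sum>m\<in>Poly_Mapping.keys p. Poly_Mapping.single m (Poly_Mapping.lookup p m)) \<in> S"
  proof (rule is_subring_sum[OF S])
    fix m assume m: "m \<in> Poly_Mapping.keys p"
    then have "Poly_Mapping.keys m \<subseteq> V" using p by (simp add: mem_polynomial_ring_iff)
    then show "Poly_Mapping.single m (Poly_Mapping.lookup p m) \<in> S"
      unfolding single_eq_const_times_variables[of m]
      by (intro is_subringD(4)[OF S] const is_subring_prod[OF S] is_subring_power[OF S] var) blast
  qed
  then show "p \<in> S" by (simp add: poly_mapping_eq_sum_single[symmetric])
qed

section \<open>The Stanley-Reisner ring of the crown graph\<close>

definition row_sum :: "'a set \<Rightarrow> 'c \<Rightarrow> ('a \<times> 'c \<Rightarrow>\<^sub>0 nat) \<Rightarrow>\<^sub>0 'k::field" where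
  "row_sum U h = (\<Sum>u\<in>U. variable (u, h))"

definition crown_vertices :: "'a set \<Rightarrow> 'c \<Rightarrow> 'c \<Rightarrow> ('a \<times> 'c) set" where
  "crown_vertices U h0 h1 = U \<times> {h0, h1}"

text \<open>
  The crown graph as a simplicial complex of dimension one, given by its facets.
\<close>
definition crown_complex :: "'a set \<Rightarrow> 'c \<Rightarrow> 'c \<Rightarrow> ('a \<times> 'c) set set" where
  "crown_complex U h0 h1 = {F. \<exists>i\<in>U. \<exists>j\<in>U. i \<noteq> j \<and> F \<subseteq> {(i, h0), (j, h1)}}"

locale crown =
  fixes U :: "'a set" and h0 h1 :: 'c
  assumes finite_U: "finite U" and card_U: "3 \<le> card U" and h01: "h0 \<noteq> h1"
begin

abbreviation V :: "('a \<times> 'c) set" where "V \<equiv> crown_vertices U h0 h1"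
abbreviation A :: "(('a \<times> 'c \<Rightarrow>\<^sub>0 nat) \<Rightarrow>\<^sub>0 'k::field) set" where "A \<equiv> carrier (polynomial_ring V)"
abbreviation I :: "(('a \<times> 'c \<Rightarrow>\<^sub>0 nat) \<Rightarrow>\<^sub>0 'k::field) set"
  where "I \<equiv> stanley_reisner_ideal V (crown_complex U h0 h1)"
abbreviation fp :: "'a \<Rightarrow> 'a \<Rightarrow> (('a \<times> 'c \<Rightarrow>\<^sub>0 nat) \<Rightarrow>\<^sub>0 'k::field) \<Rightarrow> 'k poly poly"
  where "fp i j \<equiv> face_poly (i, h0) (j, h1)"

lemma ex_avoiding: "\<exists>k\<in>U. k \<noteq> i \<and> k \<noteq> j"
proof (rule ccontr)
  assume "\<not> ?thesis"
  then have "U \<subseteq> {i, j}" by blast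
  then have "card U \<le> card {i, j}" by (intro card_mono) auto
  also have "\<dots> \<le> 2" by (simp add: card_insert_if)
  finally show False using card_U by simp
qed

lemma xy: "(i, h0) \<noteq> (j, h1)"
  using h01 by simp

lemmas fp_morphism = ring_morphismD[OF face_poly_morphism[OF xy]]

lemma A_subring: "is_subring (A :: (('a \<times> 'c \<Rightarrow>\<^sub>0 nat) \<Rightarrow>\<^sub>0 'k::field) set)"
  by (rule is_subring_polynomial_ring)

lemma mem_I_iff:
  "p \<in> I \<longleftrightarrow> p \<in> A \<and> (\<forall>i\<in>U. \<forall>j\<in>U. i \<noteq> j \<longrightarrow> fp i j p = 0)"
proof -
  have "p \<in> I \<longleftrightarrow> p \<in> A \<and> (\<forall>m\<in>Poly_Mapping.keys p. Poly_Mapping.keys m \<notin> crown_complex U h0 h1)"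
    by (rule mem_stanley_reisner_ideal_iff) (force simp: crown_complex_def)
  then show ?thesis
    unfolding face_poly_eq_0_iff[OF xy] crown_complex_def by blast
qed

lemma ideal_I: "ideal (I :: (('a \<times> 'c \<Rightarrow>\<^sub>0 nat) \<Rightarrow>\<^sub>0 'k::field) set) (polynomial_ring V)"
  unfolding ideal_polynomial_ring_iff mem_I_iff
  using is_subringD[OF A_subring[where ?'k = 'k]]
  by (auto simp: mem_I_iff fp_morphism)

text \<open>
  Two vertices of one row never lie in a common facet.
\<close>
lemma same_row_in_I:
  assumes "u \<in> U" "u' \<in> U" "u \<noteq> u'" "h \<in> {h0, h1}"
  shows "variable (u, h) * variable (u', h) \<in> I"
  unfolding mem_I_iff
proof (intro conjI ballI impI)
  have "variable (w, h) \<in> A" if "w \<in> U" for w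
    using assms(4) that by (intro variable_in_polynomial_ring) (simp add: crown_vertices_def)
  then show "variable (u, h) * variable (u', h) \<in> A" using assms(1,2) by (intro is_subringD(4)[OF A_subring])
  fix i j
  show "fp i j (variable (u, h) * variable (u', h)) = 0"
    using assms(3,4) h01 by (auto simp: fp_morphism face_poly_variable[OF xy])
qed

lemma row_sum_in_A: "h \<in> {h0, h1} \<Longrightarrow> row_sum U h \<in> A"
  unfolding row_sum_def
  by (intro is_subring_sum[OF A_subring] variable_in_polynomial_ring) (auto simp: crown_vertices_def)

lemma fp_row_sum:
  assumes "i \<in> U" "j \<in> U"
  shows "fp i j (row_sum U h0) = [:[:0, 1:]:]" "fp i j (row_sum U h1) = [:0, 1:]"
proof -
  have "fp i j (row_sum U h0) = (\<Sum>u\<in>U. if u = i then [:[:0, 1:]:] else 0)"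
    unfolding row_sum_def fp_morphism using h01 by (intro sum.cong) (auto simp: face_poly_variable[OF xy])
  then show "fp i j (row_sum U h0) = [:[:0, 1:]:]" using assms finite_U by simp
  have "fp i j (row_sum U h1) = (\<Sum>u\<in>U. if u = j then [:0, 1:] else 0)"
    unfolding row_sum_def fp_morphism using h01 by (intro sum.cong) (auto simp: face_poly_variable[OF xy])
  then show "fp i j (row_sum U h1) = [:0, 1:]" using assms finite_U by simp
qed

text \<open>
  The compatibility conditions say that two members of the family agree on the monomials supported
  on the intersection of their facets, which is a vertex when they share a row entry. If the facets
  are disjoint, only the constant terms have to agree, and those are compared through facets that
  share vertices successively. With the coefficients of a monomial being the same on all facets that
  contain its support, they can be collected into one polynomial.
\<close>
lemma ex_polynomial_with_restrictions:
  fixes w :: "'a \<Rightarrow> 'a \<Rightarrow> 'k::field poly poly"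
  assumes X: "\<And>i j j'. \<lbrakk>i \<in> U; j \<in> U; j' \<in> U; i \<noteq> j; i \<noteq> j'\<rbrakk> \<Longrightarrow> coeff (w i j) 0 = coeff (w i j') 0"
    and Y: "\<And>i i' j s. \<lbrakk>i \<in> U; i' \<in> U; j \<in> U; i \<noteq> j; i' \<noteq> j\<rbrakk> \<Longrightarrow>
      coeff (coeff (w i j) s) 0 = coeff (coeff (w i' j) s) 0"
  shows "\<exists>p\<in>A. \<forall>i\<in>U. \<forall>j\<in>U. i \<noteq> j \<longrightarrow> fp i j p = w i j"
proof -
  define val where "val i j m = coeff (coeff (w i j) (Poly_Mapping.lookup m (j, h1))) (Poly_Mapping.lookup m (i, h0))"
    for i j and m :: "'a \<times> 'c \<Rightarrow>\<^sub>0 nat"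
  have const: "coeff (coeff (w i j) 0) 0 = coeff (coeff (w i' j') 0) 0"
    if ij: "i \<in> U" "j \<in> U" "i \<noteq> j" and ij': "i' \<in> U" "j' \<in> U" "i' \<noteq> j'" for i j i' j'
  proof -
    \<comment> \<open>The facets of \<open>(i, j)\<close> and \<open>(i\', j\')\<close> are joined through \<open>(i, k)\<close> and \<open>(i\', k)\<close>; a third element of \<open>U\<close> is needed.\<close>
    obtain k where k: "k \<in> U" "k \<noteq> i" "k \<noteq> i'" using ex_avoiding by blast
    have "coeff (coeff (w i j) 0) 0 = coeff (coeff (w i k) 0) 0" using X[of i j k] ij k by simp
    also have "\<dots> = coeff (coeff (w i' k) 0) 0" using Y[of i i' k 0] ij ij' k by simp
    also have "\<dots> = coeff (coeff (w i' j') 0) 0" using X[of i' k j'] ij' k by simp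
    finally show ?thesis .
  qed
  have val_eq: "val i j m = val i' j' m"
    if ij: "i \<in> U" "j \<in> U" "i \<noteq> j" "Poly_Mapping.keys m \<subseteq> {(i, h0), (j, h1)}"
      and ij': "i' \<in> U" "j' \<in> U" "i' \<noteq> j'" "Poly_Mapping.keys m \<subseteq> {(i', h0), (j', h1)}" for i j i' j' m
  proof -
    have outside: "Poly_Mapping.lookup m v = 0" if "v \<notin> {(i, h0), (j, h1)} \<inter> {(i', h0), (j', h1)}" for v
    proof -
      have "v \<notin> Poly_Mapping.keys m" using that ij(4) ij'(4) by blast
      then show ?thesis by (simp add: in_keys_iff)
    qed
    show ?thesis
    proof (cases "i = i'"; cases "j = j'")
      assume "i = i'" "j \<noteq> j'"
      then show ?thesis using outside[of "(j, h1)"] outside[of "(j', h1)"] X[of i j j'] ij ij' h01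
        by (simp add: val_def)
    next
      assume "i \<noteq> i'" "j = j'"
      then show ?thesis using outside[of "(i, h0)"] outside[of "(i', h0)"] Y[of i i' j] ij ij' h01
        by (simp add: val_def)
    next
      assume "i \<noteq> i'" "j \<noteq> j'"
      then show ?thesis using outside[of "(i, h0)"] outside[of "(i', h0)"]
          outside[of "(j, h1)"] outside[of "(j', h1)"] const[of i j i' j'] ij ij' h01
        by (simp add: val_def)
    qed (simp add: val_def)
  qed
  define face where "face m i j \<longleftrightarrow> i \<in> U \<and> j \<in> U \<and> i \<noteq> j \<and> Poly_Mapping.keys m \<subseteq> {(i, h0), (j, h1)}"
    for m :: "'a \<times> 'c \<Rightarrow>\<^sub>0 nat" and i j
  define c where "c m = (SOME z. \<exists>i j. face m i j \<and> z = val i j m)" for m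
  have c: "c m = val i j m" if f: "face m i j" for i j m
  proof -
    have "\<exists>i j. face m i j \<and> c m = val i j m"
      unfolding c_def by (rule someI_ex) (use f in blast)
    then obtain i' j' where f': "face m i' j'" "c m = val i' j' m" by (elim exE conjE)
    have "val i' j' m = val i j m" by (rule val_eq) (use f f'(1) in \<open>simp_all add: face_def\<close>)
    then show ?thesis using f'(2) by simp
  qed
  \<comment> \<open>The finitely many monomials that occur in some member of the family.\<close>
  define M where "M = (\<Union>i\<in>U. \<Union>j\<in>U. \<Union>s\<in>{..degree (w i j)}. \<Union>r\<in>{..degree (coeff (w i j) s)}.
    {m. face m i j \<and> m = edge_monomial (i, h0) r (j, h1) s})"
  have "finite M" unfolding M_def using finite_U by (intro finite_UN_I) auto
  define p where "p = (\<Sum>m\<in>M. Poly_Mapping.single m (c m))"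
  have lookup_p: "Poly_Mapping.lookup p m = (if m \<in> M then c m else 0)" for m
    using \<open>finite M\<close> by (simp add: p_def lookup_sum lookup_single when_def)
  have "p \<in> A"
    unfolding p_def
  proof (rule is_subring_sum[OF A_subring])
    fix m assume "m \<in> M"
    then have "Poly_Mapping.keys m \<subseteq> V" by (force simp: M_def face_def crown_vertices_def)
    then show "Poly_Mapping.single m (c m) \<in> A" by (auto simp: mem_polynomial_ring_iff)
  qed
  moreover have "fp i j p = w i j" if ij: "i \<in> U" "j \<in> U" "i \<noteq> j" for i j
  proof (intro poly_eqI)
    fix s r
    let ?m = "edge_monomial (i, h0) r (j, h1) s"
    have m: "Poly_Mapping.keys ?m \<subseteq> {(i, h0), (j, h1)} \<and>
        Poly_Mapping.lookup ?m (i, h0) = r \<and> Poly_Mapping.lookup ?m (j, h1) = s"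
      using edge_monomial_eq_iff[OF xy, of ?m i r j s] by simp
    then have f: "face ?m i j" using ij by (simp add: face_def)
    have val: "val i j ?m = coeff (coeff (w i j) s) r" using m by (simp add: val_def)
    have "Poly_Mapping.lookup p ?m = coeff (coeff (w i j) s) r"
    proof (cases "?m \<in> M")
      case True
      then show ?thesis using c[OF f] val lookup_p by simp
    next
      case False
      have "coeff (coeff (w i j) s) r = 0"
      proof (rule ccontr)
        assume nz: "coeff (coeff (w i j) s) r \<noteq> 0"
        then have "coeff (w i j) s \<noteq> 0" by auto
        then have "s \<le> degree (w i j)" "r \<le> degree (coeff (w i j) s)" using nz by (auto intro: le_degree)
        then have "?m \<in> M" unfolding M_def using ij f by blast
        with False show False ..
      qed
      then show ?thesis using False lookup_p by simp
    qed
    then show "coeff (coeff (fp i j p) s) r = coeff (coeff (w i j) s) r"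
      by (simp add: coeff_face_poly[OF xy])
  qed
  ultimately show ?thesis by blast
qed

end

text \<open>
  The ideal generated by \<open>I\<close> and \<open>x\<close> is the whole ring.
\<close>
lemma (in maximalideal) ex_inverse_mod:
  assumes R: "cring R" and x: "x \<in> carrier R" "x \<notin> I"
  shows "\<exists>r\<in>carrier R. \<exists>m\<in>I. \<one> = m \<oplus> r \<otimes> x"
proof -
  interpret cring R by (rule R)
  let ?J = "I <+>\<^bsub>R\<^esub> PIdl x"
  have J: "ideal ?J R" by (rule add_ideals[OF is_ideal cgenideal_ideal[OF x(1)]])
  have mem: "p \<oplus> q \<in> ?J" if "p \<in> I" "q \<in> PIdl x" for p q
    using that unfolding set_add_def' by blast
  have "\<zero> \<in> PIdl x" using cgenideal_ideal[OF x(1)]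
    by (simp add: additive_subgroup.zero_closed ideal.axioms(1))
  then have sub: "I \<subseteq> ?J" using mem[of _ \<zero>] Icarr by fastforce
  have "x \<in> ?J" using mem[of \<zero> x] cgenideal_self[OF x(1)] x(1) by simp
  then have "?J = carrier R" using I_maximal[OF J sub] x(2) ideal.Icarr[OF J] by blast
  then have "\<one> \<in> ?J" by simp
  then obtain m q where "m \<in> I" "q \<in> PIdl x" "\<one> = m \<oplus> q" unfolding set_add_def' by blast
  then show ?thesis unfolding cgenideal_def by blast
qed

text \<open>
  The substitution \<open>F(X, Y) \<mapsto> F(0, Y)\<close>.
\<close>
definition at_zero :: "'k::comm_ring_1 poly poly \<Rightarrow> 'k poly" where
  "at_zero F = map_poly (\<lambda>c. coeff c 0) F"

lemma coeff_at_zero: "coeff (at_zero F) s = coeff (coeff F s) 0"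
  by (simp add: at_zero_def coeff_map_poly)

lemma at_zero_mult: "at_zero (F * G) = at_zero F * at_zero G"
  by (rule poly_eqI) (simp add: coeff_at_zero coeff_mult coeff_sum)

lemma at_zero_map_const: "at_zero (map_poly (\<lambda>c. [:c:]) q) = q"
  by (rule poly_eqI) (simp add: coeff_at_zero coeff_map_poly)

context crown
begin

abbreviation RA :: "(('a \<times> 'c \<Rightarrow>\<^sub>0 nat) \<Rightarrow>\<^sub>0 'k::field) ring" where "RA \<equiv> polynomial_ring V"

abbreviation poly_at :: "'c \<Rightarrow> 'k::field poly \<Rightarrow> ('a \<times> 'c \<Rightarrow>\<^sub>0 nat) \<Rightarrow>\<^sub>0 'k" where
  "poly_at h \<equiv> poly_eval const_mpoly (row_sum U h)"

lemma poly_at_in_A: "h \<in> {h0, h1} \<Longrightarrow> poly_at h p \<in> A"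
  by (rule poly_eval_mem[OF ring_morphism_const_mpoly A_subring _ row_sum_in_A])
    (auto simp: mem_polynomial_ring_iff)

lemma fp_poly_at:
  assumes "i \<in> U" "j \<in> U"
  shows "fp i j (poly_at h0 p) = [:p:]" "fp i j (poly_at h1 p) = map_poly (\<lambda>c. [:c:]) p"
  by (simp_all add: morphism_poly_eval[OF ring_morphism_const_mpoly face_poly_morphism[OF xy]]
      face_poly_const[OF xy] fp_row_sum[OF assms] poly_eval_const_const_var poly_eval_const_var_map)

lemma poly_at_h0_cancel:
  assumes "p \<noteq> 0" "h \<in> A" "poly_at h0 p * h \<in> I" shows "h \<in> I"
  unfolding mem_I_iff
proof (intro conjI ballI impI)
  fix i j assume ij: "i \<in> U" "j \<in> U" "i \<noteq> j"
  then have "[:p:] * fp i j h = 0"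
    using assms(3) unfolding mem_I_iff by (simp add: fp_morphism(3) fp_poly_at)
  then show "fp i j h = 0" using assms(1) by simp
qed (rule assms(2))

text \<open>
  On each facet the hypothesis reads \<open>q(Y) h = p(X) u\<close>, hence \<open>h = p(X) w\<close> and \<open>u = q(Y) w\<close>. The
  family \<open>w\<close> is compatible: cancel \<open>p(X)\<close> in the condition for \<open>h\<close> at \<open>Y = 0\<close>, and \<open>q(Y)\<close> in the
  condition for \<open>u\<close> at \<open>X = 0\<close>. So \<open>w\<close> consists of the restrictions of one polynomial \<open>v\<close>.
\<close>
lemma poly_at_h1_cancel_mod_poly_at_h0:
  fixes p q :: "'k::field poly"
  assumes p: "p \<noteq> 0" and q: "q \<noteq> 0" and h: "h \<in> A" and u: "u \<in> A"
    and eq: "poly_at h1 q * h - poly_at h0 p * u \<in> I"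
  shows "\<exists>v\<in>A. h - poly_at h0 p * v \<in> I"
proof -
  let ?Q = "map_poly (\<lambda>c. [:c:]) q"
  have Q0: "?Q \<noteq> 0" using q by (metis at_zero_map_const at_zero_def map_poly_0)
  have lead: "lead_coeff ?Q dvd 1"
  proof -
    have "degree ?Q = degree q" by (rule degree_map_poly) simp
    then have "lead_coeff ?Q = [:lead_coeff q:]" by (simp add: coeff_map_poly)
    then show ?thesis using q by (simp add: is_unit_const_poly_iff dvd_field_iff)
  qed
  have rel: "?Q * fp i j h = [:p:] * fp i j u" if "i \<in> U" "j \<in> U" "i \<noteq> j" for i j
    using eq that unfolding mem_I_iff by (simp add: fp_morphism(3,6) fp_poly_at)
  have "\<exists>v. fp i j h = [:p:] * v" if "i \<in> U" "j \<in> U" "i \<noteq> j" for i j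
  proof -
    have "[:p:] dvd ?Q * fp i j h" unfolding rel[OF that] by (rule dvd_triv_left)
    then show ?thesis using const_dvd_cancel_unit_lead[OF lead] by (simp add: dvd_def)
  qed
  then obtain w where w: "\<And>i j. \<lbrakk>i \<in> U; j \<in> U; i \<noteq> j\<rbrakk> \<Longrightarrow> fp i j h = [:p:] * w i j" by metis
  have wu: "fp i j u = ?Q * w i j" if "i \<in> U" "j \<in> U" "i \<noteq> j" for i j
  proof -
    have "[:p:] * fp i j u = [:p:] * (?Q * w i j)" using rel[OF that] w[OF that] by (simp add: mult_ac)
    then show ?thesis using p mult_left_cancel[of "[:p:]"] by (metis pCons_eq_0_iff)
  qed
  have "\<exists>v\<in>A. \<forall>i\<in>U. \<forall>j\<in>U. i \<noteq> j \<longrightarrow> fp i j v = w i j"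
  proof (rule ex_polynomial_with_restrictions)
    fix i j j' assume ij: "i \<in> U" "j \<in> U" "j' \<in> U" "i \<noteq> j" "i \<noteq> j'"
    have "coeff (fp i j h) 0 = coeff (fp i j' h) 0"
      by (rule poly_eqI) (simp add: coeff_face_poly[OF xy])
    then have "p * coeff (w i j) 0 = p * coeff (w i j') 0" using w ij by simp
    then show "coeff (w i j) 0 = coeff (w i j') 0" using p by simp
  next
    fix i i' j s assume ij: "i \<in> U" "i' \<in> U" "j \<in> U" "i \<noteq> j" "i' \<noteq> j"
    have "at_zero (fp i j u) = at_zero (fp i' j u)"
      by (rule poly_eqI) (simp add: coeff_at_zero coeff_face_poly[OF xy])
    then have "q * at_zero (w i j) = q * at_zero (w i' j)"
      using wu ij by (simp add: at_zero_mult at_zero_map_const)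
    then have "at_zero (w i j) = at_zero (w i' j)" using q by simp
    then show "coeff (coeff (w i j) s) 0 = coeff (coeff (w i' j) s) 0"
      by (metis coeff_at_zero)
  qed
  then obtain v where v: "v \<in> A" "\<And>i j. \<lbrakk>i \<in> U; j \<in> U; i \<noteq> j\<rbrakk> \<Longrightarrow> fp i j v = w i j" by blast
  have "h - poly_at h0 p * v \<in> I"
    unfolding mem_I_iff
  proof (intro conjI ballI impI)
    show "h - poly_at h0 p * v \<in> A"
      using h v(1) poly_at_in_A[of h0 p] by (intro is_subringD(3,4)[OF A_subring]) auto
  qed (simp add: fp_morphism(3,6) fp_poly_at w v(2))
  then show ?thesis using v(1) by blast
qed

text \<open>
  At most one variable of a row lies outside \<open>Q\<close>, because products of two of them lie in \<open>I\<close>. So modulo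
  \<open>Q\<close> every variable is zero or equal to the sum of its row.
\<close>
lemma congruent_mod_prime:
  fixes Q :: "(('a \<times> 'c \<Rightarrow>\<^sub>0 nat) \<Rightarrow>\<^sub>0 'k::field) set"
  assumes Q: "primeideal Q RA" "I \<subseteq> Q" and S: "is_subring S" "S \<subseteq> A" "\<And>c. const_mpoly c \<in> S"
    "row_sum U h0 \<in> S" "row_sum U h1 \<in> S"
  shows "\<forall>p\<in>A. \<exists>s\<in>S. p - s \<in> Q"
proof -
  interpret Q: primeideal Q RA by (rule Q(1))
  have Q': "Q \<subseteq> A" "0 \<in> Q" "\<And>x y. x \<in> Q \<Longrightarrow> y \<in> Q \<Longrightarrow> x + y \<in> Q" "\<And>a x. a \<in> A \<Longrightarrow> x \<in> Q \<Longrightarrow> a * x \<in> Q"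
    using Q.is_ideal unfolding ideal_polynomial_ring_iff by auto
  have Qneg: "- x \<in> Q" if "x \<in> Q" for x
  proof -
    have "(- 1) * x \<in> Q"
      by (rule Q'(4)[OF _ that]) (intro is_subringD(5,1)[OF A_subring])
    then show ?thesis by simp
  qed
  let ?T = "{p \<in> A. \<exists>s\<in>S. p - s \<in> Q}"
  have "is_subring ?T"
    unfolding is_subring_def
  proof (intro conjI ballI)
    show "1 \<in> ?T" using is_subringD(1)[OF A_subring] is_subringD(1)[OF S(1)] Q'(2) by force
  next
    fix x y assume "x \<in> ?T" "y \<in> ?T"
    then obtain s t where x: "x \<in> A" "s \<in> S" "x - s \<in> Q" and y: "y \<in> A" "t \<in> S" "y - t \<in> Q" by blast
    have "(x - s) + - (y - t) \<in> Q" by (rule Q'(3)[OF x(3) Qneg[OF y(3)]])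
    then have "(x - y) - (s - t) \<in> Q" by (simp add: algebra_simps)
    then show "x - y \<in> ?T" using x y is_subringD(3)[OF A_subring] is_subringD(3)[OF S(1)] by blast
    have "x * (y - t) + t * (x - s) \<in> Q" using x y S(2) by (intro Q'(3,4)) auto
    then have "x * y - s * t \<in> Q" by (simp add: algebra_simps)
    then show "x * y \<in> ?T" using x y is_subringD(4)[OF A_subring] is_subringD(4)[OF S(1)] by blast
  qed
  then have "A \<subseteq> ?T"
  proof (rule polynomial_ring_generated)
    fix c :: 'k
    have "const_mpoly c - const_mpoly c \<in> Q" using Q'(2) by simp
    then show "const_mpoly c \<in> ?T" using S(2,3) by blast
  next
    fix v assume "v \<in> V"
    then obtain u h where v: "v = (u, h)" "u \<in> U" "h \<in> {h0, h1}" by (auto simp: crown_vertices_def)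
    have var: "variable (l, h) \<in> A" if "l \<in> U" for l
      using v(3) that by (intro variable_in_polynomial_ring) (simp add: crown_vertices_def)
    have "\<exists>s\<in>S. variable (u, h) - s \<in> Q"
    proof (cases "variable (u, h) \<in> Q")
      case True
      then show ?thesis using is_subringD(2)[OF S(1)] by (intro bexI[of _ 0]) auto
    next
      case False
      have "variable (l, h) \<in> Q" if l: "l \<in> U" "l \<noteq> u" for l
      proof -
        have "variable (u, h) * variable (l, h) \<in> Q"
          using Q(2) same_row_in_I[OF v(2) l(1) l(2)[symmetric] v(3)] by blast
        then show ?thesis using Q.I_prime[OF var[OF v(2)] var[OF l(1)]] False by simp
      qed
      then have "(\<Sum>l\<in>U - {u}. variable (l, h)) \<in> Q"
        by (intro ideal_polynomial_ring_sum[OF Q.is_ideal]) blast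
      from Qneg[OF this] have "variable (u, h) - row_sum U h \<in> Q"
        using finite_U v(2) by (simp add: row_sum_def sum.remove)
      then show ?thesis using v(3) S(4,5) by blast
    qed
    then show "variable v \<in> ?T" using var[OF v(2)] v(1) by blast
  qed
  then show ?thesis by blast
qed

end

lemma (in ring) Idl_empty: "Idl {} = {\<zero>}"
proof
  show "Idl {} \<subseteq> {\<zero>}" by (rule genideal_minimal[OF zeroideal]) simp
  interpret ideal "Idl {}" R by (rule genideal_ideal) simp
  show "{\<zero>} \<subseteq> Idl {}" using additive_subgroup.zero_closed[OF is_additive_subgroup] by simp
qed

context crown
begin

abbreviation SR :: "(('a \<times> 'c \<Rightarrow>\<^sub>0 nat) \<Rightarrow>\<^sub>0 'k::field) set ring" where "SR \<equiv> RA Quot I"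
abbreviation proj :: "(('a \<times> 'c \<Rightarrow>\<^sub>0 nat) \<Rightarrow>\<^sub>0 'k::field) \<Rightarrow> (('a \<times> 'c \<Rightarrow>\<^sub>0 nat) \<Rightarrow>\<^sub>0 'k) set"
  where "proj p \<equiv> I +>\<^bsub>RA\<^esub> p"

lemma cring_SR: "cring SR"
  by (rule ideal.quotient_is_cring[OF ideal_I cring_polynomial_ring])

lemma proj_hom: "ring_hom_ring RA SR proj"
  by (rule ideal.rcos_ring_hom_ring[OF ideal_I])

lemma carrier_SR: "carrier SR = proj ` A"
  by (rule carrier_Quot)

lemma proj_closed: "p \<in> A \<Longrightarrow> proj p \<in> carrier SR"
  by (simp add: carrier_SR)

lemma proj_eq_iff: "p \<in> A \<Longrightarrow> q \<in> A \<Longrightarrow> proj p = proj q \<longleftrightarrow> p - q \<in> I"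
  using ring.quotient_eq_iff_same_a_r_cos[OF cring.axioms(1)[OF cring_polynomial_ring] ideal_I, of p q]
  by (simp add: minus_polynomial_ring)

lemmas proj_in_ring_hom = ring_hom_ring.homh[OF proj_hom]

lemma proj_1: "proj 1 = \<one>\<^bsub>SR\<^esub>"
  using ring_hom_one[OF proj_in_ring_hom] by simp

lemma proj_0: "proj 0 = \<zero>\<^bsub>SR\<^esub>"
  using ring_hom_zero[OF proj_in_ring_hom cring.axioms(1)[OF cring_polynomial_ring] cring.axioms(1)[OF cring_SR]]
  by simp

lemma proj_mult: "p \<in> A \<Longrightarrow> q \<in> A \<Longrightarrow> proj p \<otimes>\<^bsub>SR\<^esub> proj q = proj (p * q)"
  using ring_hom_mult[OF proj_in_ring_hom, of p q] by simp

lemma proj_add: "p \<in> A \<Longrightarrow> q \<in> A \<Longrightarrow> proj p \<oplus>\<^bsub>SR\<^esub> proj q = proj (p + q)"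
  using ring_hom_add[OF proj_in_ring_hom, of p q] by simp

lemma noetherian_SR: "noetherian_ring (SR :: (('a \<times> 'c \<Rightarrow>\<^sub>0 nat) \<Rightarrow>\<^sub>0 'k::field) set ring)"
proof (rule noetherian_ring_image[OF proj_hom carrier_SR[symmetric]])
  show "noetherian_ring (RA :: (('a \<times> 'c \<Rightarrow>\<^sub>0 nat) \<Rightarrow>\<^sub>0 'k) ring)"
    using finite_U by (intro noetherian_polynomial_ring) (simp add: crown_vertices_def)
qed

text \<open>
  Primes of the quotient are studied through their preimages in the polynomial ring.
\<close>
lemma contracted_prime:
  fixes P :: "(('a \<times> 'c \<Rightarrow>\<^sub>0 nat) \<Rightarrow>\<^sub>0 'k::field) set set"
  assumes P: "primeideal P SR"
  shows "primeideal {p \<in> A. proj p \<in> P} RA" "I \<subseteq> {p \<in> A. proj p \<in> P}"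
proof -
  interpret proj: ring_hom_ring RA SR proj by (rule proj_hom)
  show "primeideal {p \<in> A. proj p \<in> P} RA"
    by (rule proj.primeideal_vimage[OF cring_polynomial_ring P])
  have zero: "\<zero>\<^bsub>SR\<^esub> \<in> P"
    by (rule additive_subgroup.zero_closed[OF ideal.axioms(1)[OF primeideal.axioms(1)[OF P]]])
  show "I \<subseteq> {p \<in> A. proj p \<in> P}"
  proof
    fix p :: "('a \<times> 'c \<Rightarrow>\<^sub>0 nat) \<Rightarrow>\<^sub>0 'k" assume p: "p \<in> I"
    then have "p \<in> A" by (simp add: mem_I_iff)
    moreover have "proj p = proj 0"
      using p \<open>p \<in> A\<close> is_subringD(2)[OF A_subring] by (subst proj_eq_iff) simp_all
    ultimately show "p \<in> {p \<in> A. proj p \<in> P}" using zero by (simp add: proj_0)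
  qed
qed

abbreviation bivariate_at :: "'c \<Rightarrow> 'c \<Rightarrow> 'k::field poly poly \<Rightarrow> ('a \<times> 'c \<Rightarrow>\<^sub>0 nat) \<Rightarrow>\<^sub>0 'k" where
  "bivariate_at h h' \<equiv> poly_eval (poly_at h) (row_sum U h')"

lemma poly_at_morphism: "ring_morphism (poly_at h)"
  by (rule poly_eval_morphism[OF ring_morphism_const_mpoly])

lemma bivariate_at_morphism: "ring_morphism (bivariate_at h h')"
  by (rule poly_eval_morphism[OF poly_at_morphism])

lemma bivariate_at_in_A:
  assumes "h \<in> {h0, h1}" "h' \<in> {h0, h1}" shows "bivariate_at h h' F \<in> A"
  by (rule poly_eval_mem[OF poly_at_morphism A_subring poly_at_in_A[OF assms(1)] row_sum_in_A[OF assms(2)]])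

lemma bivariate_at_const: "bivariate_at h h' [:p:] = poly_at h p"
  by (rule poly_eval_const[OF poly_at_morphism])

lemma bivariate_at_hom:
  assumes "h \<in> {h0, h1}" "h' \<in> {h0, h1}"
  shows "ring_hom_ring (ring_on (UNIV :: 'k::field poly poly set)) SR (\<lambda>F. proj (bivariate_at h h' F))"
proof (rule ring_hom_ringI2)
  show "ring (ring_on (UNIV :: 'k poly poly set))" "ring (SR :: (('a \<times> 'c \<Rightarrow>\<^sub>0 nat) \<Rightarrow>\<^sub>0 'k) set ring)"
    by (rule cring.axioms(1)[OF cring_ring_on[OF is_subring_UNIV]], rule cring.axioms(1)[OF cring_SR])
  note mem = bivariate_at_in_A[OF assms]
  show "(\<lambda>F. proj (bivariate_at h h' F)) \<in> ring_hom (ring_on (UNIV :: 'k poly poly set)) SR"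
    by (rule ring_hom_memI)
      (simp_all add: proj_closed mem proj_mult proj_add proj_1 ring_morphismD[OF bivariate_at_morphism])
qed

text \<open>
  Modulo a prime, every element is a polynomial in the two row sums. The rows may be taken in either
  order, which provides the symmetry between \<open>h0\<close> and \<open>h1\<close> needed for \<open>maximal_contains_poly_at\<close>.
\<close>
lemma congruent_bivariate:
  fixes P :: "(('a \<times> 'c \<Rightarrow>\<^sub>0 nat) \<Rightarrow>\<^sub>0 'k::field) set set"
  assumes P: "primeideal P SR" and h: "{h, h'} = {h0, h1}" and p: "p \<in> A"
  shows "\<exists>F. p - bivariate_at h h' F \<in> {p \<in> A. proj p \<in> P}"
proof -
  have hh: "h \<in> {h0, h1}" "h' \<in> {h0, h1}" using h by blast+
  let ?S = "range (bivariate_at h h' :: 'k poly poly \<Rightarrow> _)"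
  have "\<forall>p\<in>A. \<exists>s\<in>?S. p - s \<in> {p \<in> A. proj p \<in> P}"
  proof (rule congruent_mod_prime[OF contracted_prime[OF P]])
    show "is_subring (?S)"
      unfolding is_subring_def
    proof (intro conjI ballI)
      show "1 \<in> ?S"
        using ring_morphismD(1)[OF bivariate_at_morphism] by (rule range_eqI[OF sym])
    next
      fix x y assume "x \<in> ?S" "y \<in> ?S"
      then obtain F G where "x = bivariate_at h h' F" "y = bivariate_at h h' G" by blast
      then have "x - y = bivariate_at h h' (F - G)" "x * y = bivariate_at h h' (F * G)"
        by (simp_all add: ring_morphismD[OF bivariate_at_morphism])
      then show "x - y \<in> ?S" "x * y \<in> ?S" by simp_all
    qed
    show "?S \<subseteq> A" using bivariate_at_in_A[OF hh] by blast
    have "const_mpoly c = bivariate_at h h' [:[:c:]:]" for c :: 'k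
      by (simp only: bivariate_at_const poly_eval_const[OF ring_morphism_const_mpoly])
    then show "const_mpoly c \<in> ?S" for c :: 'k by (rule range_eqI)
    have "row_sum U h = bivariate_at h h' [:[:0, 1::'k:]:]"
      by (simp only: bivariate_at_const poly_eval_var[OF ring_morphism_const_mpoly])
    moreover have "row_sum U h' = bivariate_at h h' [:0, 1::'k poly:]"
      by (simp only: poly_eval_var[OF poly_at_morphism])
    ultimately have "row_sum U h \<in> ?S" "row_sum U h' \<in> ?S" by (blast intro: range_eqI)+
    then have "row_sum U k \<in> ?S" if "k \<in> {h, h'}" for k using that by blast
    then show "row_sum U h0 \<in> ?S" "row_sum U h1 \<in> ?S"
      unfolding h by simp_all
  qed
  then show ?thesis using p by blast
qed

text \<open>
  If \<open>x \<in> Q - P\<close> for primes \<open>P \<subset> Q\<close>, then a polynomial in the row sums congruent to \<open>x\<close> modulo \<open>P\<close> also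
  lies in \<open>Q - P\<close>. So the contractions to \<open>k[X, Y]\<close> stay distinct.
\<close>
lemma krull_dim_SR: "krull_dim (SR :: (('a \<times> 'c \<Rightarrow>\<^sub>0 nat) \<Rightarrow>\<^sub>0 'k::field) set ring) \<le> 2"
proof -
  let ?\<psi> = "\<lambda>F :: 'k poly poly. proj (bivariate_at h0 h1 F)"
  have "krull_dim (SR :: (('a \<times> 'c \<Rightarrow>\<^sub>0 nat) \<Rightarrow>\<^sub>0 'k) set ring) \<le> krull_dim (ring_on (UNIV :: 'k poly poly set))"
  proof (rule krull_dim_le_if_contractions_strict[OF bivariate_at_hom cring_ring_on[OF is_subring_UNIV], of h0 h1])
    fix P Q :: "(('a \<times> 'c \<Rightarrow>\<^sub>0 nat) \<Rightarrow>\<^sub>0 'k) set set"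
    assume P: "primeideal P SR" and Q: "primeideal Q SR" and PQ: "P \<subset> Q"
    interpret P: primeideal P SR by (rule P)
    obtain x where x: "x \<in> Q" "x \<notin> P" using PQ by blast
    then have "x \<in> carrier SR" using ideal.Icarr[OF primeideal.axioms(1)[OF Q]] by blast
    then obtain p where p: "p \<in> A" "x = proj p" unfolding carrier_SR by (rule imageE) simp
    obtain F where F: "p - bivariate_at h0 h1 F \<in> {p \<in> A. proj p \<in> P}"
      using congruent_bivariate[OF P refl p(1)] by (elim exE)
    have FA: "bivariate_at h0 h1 F \<in> A" by (rule bivariate_at_in_A) simp_all
    let ?d = "p - bivariate_at h0 h1 F"
    have sum: "proj p = proj ?d \<oplus>\<^bsub>SR\<^esub> ?\<psi> F" using F FA by (simp add: proj_add)
    have iff: "?\<psi> F \<in> K \<longleftrightarrow> proj p \<in> K" if K: "ideal K SR" "P \<subseteq> K" for K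
    proof -
      interpret K: ideal K SR by (rule K(1))
      have d: "proj ?d \<in> K" using F K(2) by blast
      show ?thesis
      proof
        assume "?\<psi> F \<in> K"
        then show "proj p \<in> K" unfolding sum by (rule K.a_closed[OF d])
      next
        assume "proj p \<in> K"
        then have "\<ominus>\<^bsub>SR\<^esub> proj ?d \<oplus>\<^bsub>SR\<^esub> proj p \<in> K" by (rule K.a_closed[OF K.a_inv_closed[OF d]])
        moreover have "\<ominus>\<^bsub>SR\<^esub> proj ?d \<oplus>\<^bsub>SR\<^esub> proj p = ?\<psi> F"
          unfolding sum using F FA by (intro P.r_neg1) (simp_all add: proj_closed)
        ultimately show "?\<psi> F \<in> K" by simp
      qed
    qed
    have "?\<psi> F \<in> Q \<and> ?\<psi> F \<notin> P"
      using iff[OF P.is_ideal order_refl] iff[OF primeideal.axioms(1)[OF Q]] PQ x p(2) by blast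
    then show "\<exists>F\<in>carrier (ring_on UNIV). ?\<psi> F \<in> Q \<and> ?\<psi> F \<notin> P" by (intro bexI[of _ F]) simp_all
  qed simp_all
  also have "\<dots> \<le> 2" by (rule krull_dim_bivariate_le)
  finally show ?thesis .
qed

text \<open>
  The contraction of \<open>M\<close> to \<open>k[X, Y]\<close> has the inverses required by
  \<open>maximal_ideal_contains_univariate\<close>: an inverse modulo \<open>M\<close> is itself congruent to a polynomial in the
  row sums.
\<close>
lemma maximal_contains_poly_at:
  fixes M :: "(('a \<times> 'c \<Rightarrow>\<^sub>0 nat) \<Rightarrow>\<^sub>0 'k::field) set set"
  assumes M: "maximalideal M SR" and h: "{h, h'} = {h0, h1}"
  shows "\<exists>p. p \<noteq> 0 \<and> proj (poly_at h p) \<in> M"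
proof -
  let ?\<psi> = "\<lambda>F :: 'k poly poly. proj (bivariate_at h h' F)"
  have hh: "h \<in> {h0, h1}" "h' \<in> {h0, h1}" using h by blast+
  interpret SR: cring "SR :: (('a \<times> 'c \<Rightarrow>\<^sub>0 nat) \<Rightarrow>\<^sub>0 'k) set ring" by (rule cring_SR)
  interpret M: maximalideal M SR by (rule M)
  have prime: "primeideal M SR" by (rule SR.maximalideal_prime[OF M])
  interpret \<psi>: ring_hom_ring "ring_on (UNIV :: 'k poly poly set)" SR ?\<psi>
    by (rule bivariate_at_hom[OF hh])
  let ?Q = "{p \<in> A. proj p \<in> M}"
  have Qp: "primeideal ?Q RA" and IQ: "I \<subseteq> ?Q" using contracted_prime[OF prime] .
  have Q': "0 \<in> ?Q" "\<And>x y. x \<in> ?Q \<Longrightarrow> y \<in> ?Q \<Longrightarrow> x + y \<in> ?Q" "\<And>a x. a \<in> A \<Longrightarrow> x \<in> ?Q \<Longrightarrow> a * x \<in> ?Q"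
    using primeideal.axioms(1)[OF Qp] unfolding ideal_polynomial_ring_iff by blast+
  have FA: "bivariate_at h h' F \<in> A" for F by (rule bivariate_at_in_A[OF hh])
  have "\<exists>p. p \<noteq> 0 \<and> [:p:] \<in> {F \<in> carrier (ring_on UNIV). ?\<psi> F \<in> M}"
  proof (rule maximal_ideal_contains_univariate[OF \<psi>.ideal_vimage[OF M.is_ideal]])
    have "\<one>\<^bsub>SR\<^esub> \<notin> M" using M.one_imp_carrier M.I_notcarr by auto
    then show "1 \<notin> {F \<in> carrier (ring_on UNIV). ?\<psi> F \<in> M}"
      by (simp add: ring_morphismD[OF bivariate_at_morphism] proj_1)
  next
    fix F assume "F \<notin> {F \<in> carrier (ring_on UNIV). ?\<psi> F \<in> M}"
    then have nF: "?\<psi> F \<notin> M" by simp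
    obtain r m where r: "r \<in> carrier SR" and m: "m \<in> M" and eq: "\<one>\<^bsub>SR\<^esub> = m \<oplus>\<^bsub>SR\<^esub> r \<otimes>\<^bsub>SR\<^esub> ?\<psi> F"
      using M.ex_inverse_mod[OF cring_SR proj_closed[OF FA] nF] by (elim bexE)
    obtain p where p: "p \<in> A" "r = proj p" using r unfolding carrier_SR by (rule imageE) simp
    have "m \<in> carrier SR" by (rule M.Icarr[OF m])
    then obtain \<mu> where \<mu>: "\<mu> \<in> A" "m = proj \<mu>" unfolding carrier_SR by (rule imageE) simp
    have pF: "p * bivariate_at h h' F \<in> A" by (rule is_subringD(4)[OF A_subring p(1) FA])
    have "proj 1 = proj (\<mu> + p * bivariate_at h h' F)"
      using eq unfolding \<mu>(2) p(2) proj_mult[OF p(1) FA] proj_add[OF \<mu>(1) pF] proj_1 .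
    then have "1 - (\<mu> + p * bivariate_at h h' F) \<in> I"
      using proj_eq_iff[OF is_subringD(1)[OF A_subring] is_subringD(6)[OF A_subring \<mu>(1) pF]] by simp
    then have 1: "1 - (\<mu> + p * bivariate_at h h' F) \<in> ?Q" by (rule subsetD[OF IQ])
    have 2: "\<mu> \<in> ?Q" using \<mu> m by simp
    obtain G where G: "p - bivariate_at h h' G \<in> ?Q"
      using congruent_bivariate[OF prime h p(1)] by (elim exE)
    have 3: "bivariate_at h h' F * (p - bivariate_at h h' G) \<in> ?Q" by (rule Q'(3)[OF FA G])
    have "(1 - (\<mu> + p * bivariate_at h h' F)) + \<mu> + bivariate_at h h' F * (p - bivariate_at h h' G) \<in> ?Q"
      by (rule Q'(2)[OF Q'(2)[OF 1 2] 3])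
    then have 4: "1 - bivariate_at h h' F * bivariate_at h h' G \<in> ?Q" by (simp add: algebra_simps)
    have "- 1 \<in> A" by (intro is_subringD(5,1)[OF A_subring])
    from Q'(3)[OF this 4] have "bivariate_at h h' F * bivariate_at h h' G - 1 \<in> ?Q" by simp
    then have "F * G - 1 \<in> {F \<in> carrier (ring_on UNIV). ?\<psi> F \<in> M}"
      by (simp add: ring_morphismD[OF bivariate_at_morphism])
    then show "\<exists>G. F * G - 1 \<in> {F \<in> carrier (ring_on UNIV). ?\<psi> F \<in> M}" by blast
  qed
  then show ?thesis by (simp add: bivariate_at_const)
qed

lemma regular_sequence_SR:
  fixes p q :: "'k::field poly"
  assumes p: "p \<noteq> 0" and q: "q \<noteq> 0"
    and M: "ideal M SR" "M \<noteq> carrier SR" "proj (poly_at h0 p) \<in> M" "proj (poly_at h1 q) \<in> M"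
  shows "regular_sequence SR [proj (poly_at h0 p), proj (poly_at h1 q)]"
proof -
  interpret SR: cring "SR :: (('a \<times> 'c \<Rightarrow>\<^sub>0 nat) \<Rightarrow>\<^sub>0 'k) set ring" by (rule cring_SR)
  let ?f = "poly_at h0 p" and ?g = "poly_at h1 q"
  have f: "?f \<in> A" and g: "?g \<in> A" by (rule poly_at_in_A; simp)+
  have first: "r \<in> Idl\<^bsub>SR\<^esub> {}" if r: "r \<in> carrier SR" "proj ?f \<otimes>\<^bsub>SR\<^esub> r \<in> Idl\<^bsub>SR\<^esub> {}" for r
  proof -
    obtain h where h: "h \<in> A" "r = proj h" using r(1) unfolding carrier_SR by (rule imageE) simp
    have fh: "?f * h \<in> A" by (rule is_subringD(4)[OF A_subring f h(1)])
    have "proj (?f * h) = proj 0" using r(2) h f by (simp add: SR.Idl_empty proj_mult proj_0)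
    then have "?f * h \<in> I" using proj_eq_iff[OF fh is_subringD(2)[OF A_subring]] by simp
    then have "h \<in> I" by (rule poly_at_h0_cancel[OF p h(1)])
    then have "r = proj 0" using proj_eq_iff[OF h(1) is_subringD(2)[OF A_subring]] h(2) by simp
    then show ?thesis by (simp add: SR.Idl_empty proj_0)
  qed
  have Idl_f: "Idl\<^bsub>SR\<^esub> {proj ?f} = PIdl\<^bsub>SR\<^esub> (proj ?f)"
    by (rule SR.cgenideal_eq_genideal[OF proj_closed[OF f], symmetric])
  have second: "r \<in> Idl\<^bsub>SR\<^esub> {proj ?f}"
    if r: "r \<in> carrier SR" "proj ?g \<otimes>\<^bsub>SR\<^esub> r \<in> Idl\<^bsub>SR\<^esub> {proj ?f}" for r
  proof -
    obtain h where h: "h \<in> A" "r = proj h" using r(1) unfolding carrier_SR by (rule imageE) simp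
    obtain y where y: "y \<in> carrier SR" "proj ?g \<otimes>\<^bsub>SR\<^esub> r = y \<otimes>\<^bsub>SR\<^esub> proj ?f"
      using r(2) unfolding Idl_f cgenideal_def by blast
    obtain u where u: "u \<in> A" "y = proj u" using y(1) unfolding carrier_SR by (rule imageE) simp
    have gh: "?g * h \<in> A" and fu: "?f * u \<in> A"
      by (rule is_subringD(4)[OF A_subring]; fact f g h(1) u(1))+
    have "proj (?g * h) = proj (?f * u)"
      using y(2) f g h u by (simp add: proj_mult mult.commute)
    then have "?g * h - ?f * u \<in> I" using proj_eq_iff[OF gh fu] by simp
    from poly_at_h1_cancel_mod_poly_at_h0[OF p q h(1) u(1) this]
    obtain v where v: "v \<in> A" "h - ?f * v \<in> I" by (elim bexE)
    have "r = proj (v * ?f)"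
      using proj_eq_iff[OF h(1) is_subringD(4)[OF A_subring f v(1)]] v(2) h(2) by (simp add: mult.commute)
    then have "r = proj v \<otimes>\<^bsub>SR\<^esub> proj ?f" using v(1) f by (simp add: proj_mult)
    then show ?thesis unfolding Idl_f cgenideal_def using proj_closed[OF v(1)] by blast
  qed
  show ?thesis
    unfolding SR.regular_sequence_iff
  proof (intro conjI allI impI ballI)
    show "set [proj ?f, proj ?g] \<subseteq> carrier SR" using proj_closed[OF f] proj_closed[OF g] by simp
    have "Idl\<^bsub>SR\<^esub> (set [proj ?f, proj ?g]) \<subseteq> M"
      by (rule SR.genideal_minimal[OF M(1)]) (use M(3,4) in simp)
    then show "Idl\<^bsub>SR\<^esub> (set [proj ?f, proj ?g]) \<noteq> carrier SR"
      using M(2) ideal.Icarr[OF M(1)] by blast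
  next
    fix i r assume i: "i < length [proj ?f, proj ?g]" and r: "r \<in> carrier SR"
      "[proj ?f, proj ?g] ! i \<otimes>\<^bsub>SR\<^esub> r \<in> Idl\<^bsub>SR\<^esub> (set (take i [proj ?f, proj ?g]))"
    from i have "i = 0 \<or> i = 1" by auto
    then show "r \<in> Idl\<^bsub>SR\<^esub> (set (take i [proj ?f, proj ?g]))"
      using r first[OF r(1)] second[OF r(1)] by auto
  qed
qed

theorem cohen_macaulay_SR: "cohen_macaulay_ring (SR :: (('a \<times> 'c \<Rightarrow>\<^sub>0 nat) \<Rightarrow>\<^sub>0 'k::field) set ring)"
proof -
  interpret SR: cring "SR :: (('a \<times> 'c \<Rightarrow>\<^sub>0 nat) \<Rightarrow>\<^sub>0 'k) set ring" by (rule cring_SR)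
  show ?thesis
  proof (rule SR.cohen_macaulay_ringI[OF noetherian_SR, of 2])
    show "krull_dim (SR :: (('a \<times> 'c \<Rightarrow>\<^sub>0 nat) \<Rightarrow>\<^sub>0 'k) set ring) \<le> enat 2"
      using krull_dim_SR by (simp add: numeral_eq_enat)
    fix M assume M: "maximalideal M (SR :: (('a \<times> 'c \<Rightarrow>\<^sub>0 nat) \<Rightarrow>\<^sub>0 'k) set ring)"
    obtain p where p: "p \<noteq> 0" "proj (poly_at h0 p) \<in> M"
      using maximal_contains_poly_at[OF M, of h0 h1] by auto
    obtain q where q: "q \<noteq> 0" "proj (poly_at h1 q) \<in> M"
      using maximal_contains_poly_at[OF M, of h1 h0] by auto
    have "regular_sequence SR [proj (poly_at h0 p), proj (poly_at h1 q)]"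
      by (rule regular_sequence_SR[OF p(1) q(1) maximalideal.axioms(1)[OF M]
            maximalideal.I_notcarr[OF M, symmetric] p(2) q(2)])
    then show "\<exists>as. length as = 2 \<and> set as \<subseteq> M \<and> regular_sequence SR as"
      using p(2) q(2) by (intro exI[of _ "[proj (poly_at h0 p), proj (poly_at h1 q)]"]) simp
  qed
qed

end

section \<open>The product of a complete graph with an edge\<close>

lemma arcs_ends_induce_subgraph: "arcs_ends (P \<restriction> W) = arcs_ends P \<inter> W \<times> W"
  by (auto simp: arcs_ends_conv)

lemma delete_verts_induce_subgraph: "delete_verts (P \<restriction> W) S = P \<restriction> (W - S)"
  by (auto simp: delete_verts_def induce_subgraph_def)

text \<open>
  The graph \<open>K\<^sub>m \<box> K\<^sub>2\<close>, described by its adjacency relation only. The description is symmetric in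
  \<open>h0\<close> and \<open>h1\<close>, so results on the first row carry over to the second one by \<open>swap\<close>.
\<close>
locale complete_prism = crown U h0 h1 for U :: "'a set" and h0 h1 :: 'c +
  fixes P :: "('a \<times> 'c, 'e) pre_digraph"
  assumes verts_P: "verts P = crown_vertices U h0 h1"
    and arcs_ends_P: "arcs_ends P = {((u, h), (v, h')) | u h v h'. u \<in> U \<and> v \<in> U \<and>
      h \<in> {h0, h1} \<and> h' \<in> {h0, h1} \<and> (u = v \<and> h \<noteq> h' \<or> h = h' \<and> u \<noteq> v)}"

lemma (in complete_prism) swap: "complete_prism U h1 h0 P"
proof
  show "verts P = crown_vertices U h1 h0"
    by (simp add: verts_P crown_vertices_def insert_commute)
  show "arcs_ends P = {((u, h), (v, h')) | u h v h'. u \<in> U \<and> v \<in> U \<and>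
      h \<in> {h1, h0} \<and> h' \<in> {h1, h0} \<and> (u = v \<and> h \<noteq> h' \<or> h = h' \<and> u \<noteq> v)}"
    by (simp add: arcs_ends_P insert_commute)
qed (use finite_U card_U h01 in auto)

context complete_prism
begin

lemma adjacent_iff:
  "(u, h) \<rightarrow>\<^bsub>P\<^esub> (v, h') \<longleftrightarrow> u \<in> U \<and> v \<in> U \<and> h \<in> {h0, h1} \<and> h' \<in> {h0, h1} \<and>
    (u = v \<and> h \<noteq> h' \<or> h = h' \<and> u \<noteq> v)"
  by (simp add: arcs_ends_P)

lemma induce_subgraph_V: "P \<restriction> V = P"
proof -
  have "arcs_ends P \<subseteq> V \<times> V" by (auto simp: arcs_ends_P crown_vertices_def)
  then have "{e \<in> arcs P. tail P e \<in> V \<and> head P e \<in> V} = arcs P"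
    by (auto simp: arcs_ends_conv)
  then show ?thesis unfolding induce_subgraph_def using verts_P by simp
qed

lemma nonadjacent_iff_crown_complex:
  assumes F: "F \<subseteq> V"
  shows "(\<forall>x\<in>F. \<forall>y\<in>F. \<not> x \<rightarrow>\<^bsub>P\<^esub> y) \<longleftrightarrow> F \<in> crown_complex U h0 h1"
proof
  assume ind: "\<forall>x\<in>F. \<forall>y\<in>F. \<not> x \<rightarrow>\<^bsub>P\<^esub> y"
  have ind': "u = v \<longleftrightarrow> h = h'" if "(u, h) \<in> F" "(v, h') \<in> F" for u v h h'
    using ind that F adjacent_iff[of u h v h'] by (auto simp: crown_vertices_def)
  have row: "F \<subseteq> {(i, h0), (j, h1)}"
    if "\<And>u. (u, h0) \<in> F \<Longrightarrow> u = i" "\<And>u. (u, h1) \<in> F \<Longrightarrow> u = j" for i j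
  proof
    fix x assume "x \<in> F"
    then show "x \<in> {(i, h0), (j, h1)}" using that F by (cases x) (auto simp: crown_vertices_def)
  qed
  have in_U: "u \<in> U" if "(u, h) \<in> F" for u h using that F by (auto simp: crown_vertices_def)
  have "\<exists>i\<in>U. \<exists>j\<in>U. i \<noteq> j \<and> F \<subseteq> {(i, h0), (j, h1)}"
  proof (cases "\<exists>i. (i, h0) \<in> F")
    case True
    then obtain i where i: "(i, h0) \<in> F" by blast
    show ?thesis
    proof (cases "\<exists>j. (j, h1) \<in> F")
      case True
      then obtain j where j: "(j, h1) \<in> F" by blast
      then show ?thesis
        using row[of i j] ind' i j in_U h01 by (intro bexI[of _ i] bexI[of _ j]) auto
    next
      case False
      obtain j where "j \<in> U" "j \<noteq> i" using ex_avoiding by blast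
      then show ?thesis
        using row[of i j] ind' i False in_U by (intro bexI[of _ i] bexI[of _ j]) auto
    qed
  next
    case False
    obtain j where j: "j \<in> U" "\<And>u. (u, h1) \<in> F \<Longrightarrow> u = j"
      using ind' in_U ex_avoiding by (cases "\<exists>j. (j, h1) \<in> F") blast+
    obtain i where "i \<in> U" "i \<noteq> j" using ex_avoiding by blast
    then show ?thesis
      using row[of i j] j False by (intro bexI[of _ i] bexI[of _ j]) auto
  qed
  then show "F \<in> crown_complex U h0 h1" by (simp add: crown_complex_def)
next
  assume "F \<in> crown_complex U h0 h1"
  then obtain i j where ij: "i \<noteq> j" "F \<subseteq> {(i, h0), (j, h1)}" by (auto simp: crown_complex_def)
  show "\<forall>x\<in>F. \<forall>y\<in>F. \<not> x \<rightarrow>\<^bsub>P\<^esub> y"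
  proof (intro ballI)
    fix x y assume "x \<in> F" "y \<in> F"
    then have "x \<in> {(i, h0), (j, h1)}" "y \<in> {(i, h0), (j, h1)}" using ij(2) by blast+
    then show "\<not> x \<rightarrow>\<^bsub>P\<^esub> y" using ij(1) h01 by (auto simp: adjacent_iff)
  qed
qed

lemma independent_induced_iff:
  assumes "W \<subseteq> V"
  shows "independent_set (P \<restriction> W) F \<longleftrightarrow> F \<subseteq> W \<and> F \<in> crown_complex U h0 h1"
proof -
  have "independent_set (P \<restriction> W) F \<longleftrightarrow> F \<subseteq> W \<and> (\<forall>x\<in>F. \<forall>y\<in>F. \<not> x \<rightarrow>\<^bsub>P\<^esub> y)"
    unfolding independent_set_def arcs_ends_induce_subgraph induce_subgraph_verts by blast
  then show ?thesis using nonadjacent_iff_crown_complex assms by (meson order_trans)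
qed

lemma crown_complex_sub_V: "F \<in> crown_complex U h0 h1 \<Longrightarrow> F \<subseteq> V"
  by (force simp: crown_complex_def crown_vertices_def)

lemma independent_iff: "independent_set P F \<longleftrightarrow> F \<in> crown_complex U h0 h1"
  using independent_induced_iff[OF order_refl, of F] crown_complex_sub_V[of F]
  unfolding induce_subgraph_V by blast

lemma independence_complex_P: "independence_complex P = crown_complex U h0 h1"
  by (simp add: independence_complex_def independent_iff)

lemma unmixed_P: "unmixed P"
proof -
  have "card S = 2" if S: "maximal_independent_set P S" for S
  proof -
    obtain i j where ij: "i \<in> U" "j \<in> U" "i \<noteq> j" "S \<subseteq> {(i, h0), (j, h1)}"
      using S unfolding maximal_independent_set_def independent_iff crown_complex_def by blast
    then have "{(i, h0), (j, h1)} \<in> crown_complex U h0 h1" by (auto simp: crown_complex_def)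
    then have "S = {(i, h0), (j, h1)}"
      using S ij(4) unfolding maximal_independent_set_def independent_iff by blast
    then show ?thesis using h01 by simp
  qed
  then show ?thesis by (simp add: unmixed_def)
qed

abbreviation rows :: "'a set \<Rightarrow> 'a set \<Rightarrow> ('a \<times> 'c) set" where
  "rows X Y \<equiv> X \<times> {h0} \<union> Y \<times> {h1}"

lemma rows_sub_V: "X \<subseteq> U \<Longrightarrow> Y \<subseteq> U \<Longrightarrow> rows X Y \<subseteq> V"
  by (auto simp: crown_vertices_def)

lemma delete_vertex_rows: "delete_verts (P \<restriction> rows X Y) {(u, h0)} = P \<restriction> rows (X - {u}) Y"
  unfolding delete_verts_induce_subgraph using h01 by (intro arg_cong[where f = "induce_subgraph P"]) auto

text \<open>
  The closed neighbourhood of \<open>(u, h0)\<close> is its entire row together with \<open>(u, h1)\<close>.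
\<close>
lemma delete_closed_neighbours_rows:
  assumes "X \<subseteq> U" "Y \<subseteq> U" "u \<in> X"
  shows "delete_verts (P \<restriction> rows X Y) (closed_neighbours (P \<restriction> rows X Y) (u, h0)) =
    P \<restriction> rows {} (Y - {u})"
  unfolding delete_verts_induce_subgraph closed_neighbours_def neighbours_def
    arcs_ends_induce_subgraph induce_subgraph_verts
  using assms h01 by (intro arg_cong[where f = "induce_subgraph P"]) (auto simp: adjacent_iff)

text \<open>
  An independent set \<open>S\<close> of the second row without \<open>u\<close> has at most one vertex \<open>(v, h1)\<close>. The vertex
  \<open>(w, h0)\<close> provided by the hypotheses is not adjacent to it, so \<open>S\<close> is not maximal after deleting only
  \<open>(u, h0)\<close>.
\<close>
lemma shedding_rows:
  assumes XY: "X \<subseteq> U" "Y \<subseteq> U" and u: "u \<in> X" "X - {u} \<noteq> {}"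
    and avoid: "\<And>v. v \<in> Y - {u} \<Longrightarrow> \<exists>w\<in>X - {u}. w \<noteq> v"
  shows "shedding_vertex (P \<restriction> rows X Y) (u, h0)"
  unfolding shedding_vertex_def delete_vertex_rows delete_closed_neighbours_rows[OF XY u(1)]
proof (intro conjI notI)
  show "(u, h0) \<in> verts (P \<restriction> rows X Y)" using u(1) by simp
  have sub: "rows {} (Y - {u}) \<subseteq> V" "rows (X - {u}) Y \<subseteq> V" using XY by (intro rows_sub_V; blast)+
  assume "\<exists>S. independent_set (P \<restriction> rows {} (Y - {u})) S \<and>
    maximal_independent_set (P \<restriction> rows (X - {u}) Y) S"
  then obtain S where ind: "independent_set (P \<restriction> rows {} (Y - {u})) S"
    and maximal: "maximal_independent_set (P \<restriction> rows (X - {u}) Y) S" by (elim exE conjE)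
  have S: "S \<subseteq> rows {} (Y - {u})" "S \<in> crown_complex U h0 h1"
    using ind independent_induced_iff[OF sub(1)] by simp_all
  have max: "T = S" if "T \<subseteq> rows (X - {u}) Y" "T \<in> crown_complex U h0 h1" "S \<subseteq> T" for T
    using maximal that independent_induced_iff[OF sub(2), of T] unfolding maximal_independent_set_def by simp
  obtain j where j: "S \<subseteq> {(j, h1)}"
    using S h01 unfolding crown_complex_def by blast
  obtain w j' where w: "w \<in> X - {u}" and j': "j' \<in> U" "j' \<noteq> w" "S \<subseteq> {(j', h1)}"
  proof (cases "S = {}")
    case True
    obtain w where "w \<in> X - {u}" using u(2) by blast
    moreover obtain k where "k \<in> U" "k \<noteq> w" using ex_avoiding by blast
    ultimately show thesis using that True by blast
  next
    case False
    then have "j \<in> Y - {u}" using S(1) j by auto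
    then show thesis using that avoid j XY(2) by blast
  qed
  let ?T = "insert (w, h0) S"
  have "?T \<in> crown_complex U h0 h1"
    unfolding crown_complex_def using w j' XY(1) by (intro CollectI bexI[of _ w] bexI[of _ j']) auto
  moreover have "?T \<subseteq> rows (X - {u}) Y" using S(1) w by auto
  ultimately have "?T = S" using max by blast
  then have "(w, h0) \<in> S" by blast
  then show False using S(1) h01 by auto
qed

lemma vertex_decomposable_row:
  assumes "X \<subseteq> U" shows "vertex_decomposable (P \<restriction> rows X {})"
proof -
  have "finite X" using assms finite_U by (rule finite_subset)
  then show ?thesis using assms
  proof (induction X rule: finite_induct)
    case empty
    show ?case by (rule totally_disconnected) simp
  next
    case (insert u X)
    show ?case
    proof (cases "X = {}")
      case True
      have "arcs_ends (P \<restriction> rows (insert u X) {}) = {}"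
        unfolding arcs_ends_induce_subgraph using True by (auto simp: arcs_ends_P)
      then show ?thesis by (intro totally_disconnected) (auto simp: arcs_ends_def)
    next
      case False
      show ?thesis
      proof (rule shedding)
        show "shedding_vertex (P \<restriction> rows (insert u X) {}) (u, h0)"
          by (rule shedding_rows) (use insert False in auto)
        show "vertex_decomposable (delete_verts (P \<restriction> rows (insert u X) {}) {(u, h0)})"
          unfolding delete_vertex_rows using insert by simp
        show "vertex_decomposable (delete_verts (P \<restriction> rows (insert u X) {})
            (closed_neighbours (P \<restriction> rows (insert u X) {}) (u, h0)))"
          by (subst delete_closed_neighbours_rows)
            (use insert.prems in \<open>auto intro: totally_disconnected\<close>)
      qed
    qed
  qed
qed

end

lemma (in complete_prism) vertex_decomposable_delete_step:
  assumes XY: "X \<subseteq> U" "Y \<subseteq> U" and u: "u \<in> X" "X - {u} \<noteq> {}"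
    and avoid: "\<And>v. v \<in> Y - {u} \<Longrightarrow> \<exists>w\<in>X - {u}. w \<noteq> v"
    and IH: "vertex_decomposable (P \<restriction> rows (X - {u}) Y)"
  shows "vertex_decomposable (P \<restriction> rows X Y)"
proof (rule shedding)
  interpret swap: complete_prism U h1 h0 P by (rule swap)
  show "shedding_vertex (P \<restriction> rows X Y) (u, h0)" by (rule shedding_rows[OF XY u avoid])
  show "vertex_decomposable (delete_verts (P \<restriction> rows X Y) {(u, h0)})"
    unfolding delete_vertex_rows by (rule IH)
  have "vertex_decomposable (P \<restriction> rows {} (Y - {u}))"
    using swap.vertex_decomposable_row[of "Y - {u}"] XY(2) by (simp add: Un_commute) blast
  then show "vertex_decomposable (delete_verts (P \<restriction> rows X Y)
      (closed_neighbours (P \<restriction> rows X Y) (u, h0)))"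
    unfolding delete_closed_neighbours_rows[OF XY u(1)] .
qed

context complete_prism
begin

text \<open>
  Delete the vertices of the first row other than \<open>a\<close>, \<open>b\<close>; each is shedding because for any \<open>v\<close> one of
  \<open>a\<close>, \<open>b\<close> differs from \<open>v\<close>. Then delete the vertices of the second row other than \<open>c\<close>, where \<open>c\<close>
  differs from all that remains in the first row. Deleting \<open>a\<close> from \<open>{a, b}\<close> and \<open>{c}\<close> finally leaves
  the two nonadjacent vertices \<open>(b, h0)\<close> and \<open>(c, h1)\<close>.
\<close>
lemma vertex_decomposable_rows:
  assumes "X \<subseteq> U" "Y \<subseteq> U" and ab: "a \<in> X" "b \<in> X" "c \<in> Y" "a \<noteq> b" "c \<noteq> a" "c \<noteq> b"
  shows "vertex_decomposable (P \<restriction> rows X Y)"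
  using assms(1,2) ab(1-3)
proof (induction "card X + card Y" arbitrary: X Y rule: less_induct)
  case less
  interpret swap: complete_prism U h1 h0 P by (rule swap)
  have fin: "finite X" "finite Y" using less.prems(1,2) finite_U finite_subset by blast+
  consider u where "u \<in> X" "u \<noteq> a" "u \<noteq> b" | v where "X = {a, b}" "v \<in> Y" "v \<noteq> c"
    | "X = {a, b}" "Y = {c}"
    using less.prems(3-5) by blast
  then show ?case
  proof cases
    case 1
    show ?thesis
    proof (rule vertex_decomposable_delete_step[OF less.prems(1,2) 1(1)])
      show "X - {u} \<noteq> {}" using less.prems(3) 1(2) by blast
      show "\<exists>w\<in>X - {u}. w \<noteq> v" for v
        using less.prems(3,4) 1(2,3) ab(4) by (cases "v = a") (auto intro: bexI[of _ a] bexI[of _ b])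
      have "card (X - {u}) < card X" using fin(1) 1(1) by (rule card_Diff1_less)
      then show "vertex_decomposable (P \<restriction> rows (X - {u}) Y)"
        using less.prems 1 by (intro less.hyps) auto
    qed
  next
    case 2
    have "vertex_decomposable (P \<restriction> swap.rows Y X)"
    proof (rule swap.vertex_decomposable_delete_step[OF less.prems(2,1) 2(2)])
      show "Y - {v} \<noteq> {}" using less.prems(5) 2(3) by blast
      show "\<exists>w\<in>Y - {v}. w \<noteq> x" if "x \<in> X - {v}" for x
        using less.prems(5) 2(1,3) ab(5,6) that by (intro bexI[of _ c]) auto
      have "card (Y - {v}) < card Y" using fin(2) 2(2) by (rule card_Diff1_less)
      then have "vertex_decomposable (P \<restriction> rows X (Y - {v}))"
        using less.prems 2 by (intro less.hyps) auto
      then show "vertex_decomposable (P \<restriction> swap.rows (Y - {v}) X)" by (simp only: Un_commute)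
    qed
    then show ?thesis by (simp only: Un_commute)
  next
    case 3
    have "vertex_decomposable (P \<restriction> rows (X - {a}) Y)"
    proof (rule totally_disconnected)
      have "arcs_ends (P \<restriction> rows (X - {a}) Y) = {}"
        unfolding arcs_ends_induce_subgraph using 3 ab h01 by (auto simp: adjacent_iff)
      then show "arcs (P \<restriction> rows (X - {a}) Y) = {}" unfolding arcs_ends_def image_is_empty .
    qed
    then show ?thesis
      using 3 ab by (intro vertex_decomposable_delete_step[OF less.prems(1,2) less.prems(3)]) auto
  qed
qed

lemma vertex_decomposable_P: "vertex_decomposable P"
proof -
  obtain a where a: "a \<in> U" using ex_avoiding by blast
  obtain b where b: "b \<in> U" "b \<noteq> a" using ex_avoiding by blast
  obtain c where c: "c \<in> U" "c \<noteq> a" "c \<noteq> b" using ex_avoiding by blast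
  have "vertex_decomposable (P \<restriction> rows U U)"
    by (rule vertex_decomposable_rows[of U U a b c]) (use a b c in auto)
  moreover have "rows U U = V" by (auto simp: crown_vertices_def)
  ultimately show ?thesis by (simp add: induce_subgraph_V)
qed

lemma cohen_macaulay_P: "cohen_macaulay_graph TYPE('k::field) P"
  unfolding cohen_macaulay_graph_def cohen_macaulay_complex_def stanley_reisner_ring_def
    independence_complex_P verts_P by (rule cohen_macaulay_SR)

end

lemma complete_prism_product:
  assumes "m \<ge> 3" and G: "K\<^bsub>m\<^esub> G" and H: "verts H = {h0, h1}" "h0 \<noteq> h1" "K\<^bsub>2\<^esub> H"
  shows "complete_prism (verts G) h0 h1 (G \<box> H)"
proof
  interpret G: graph G using G by (simp add: complete_digraph_def)
  show "finite (verts G)" by simp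
  show "3 \<le> card (verts G)" "h0 \<noteq> h1" using assms by (simp_all add: complete_digraph_def)
  show "verts (G \<box> H) = crown_vertices (verts G) h0 h1"
    by (simp add: cartesian_product_def crown_vertices_def H(1))
  have "arcs_ends (G \<box> H) = arcs (G \<box> H)" by (simp add: arcs_ends_conv cartesian_product_def)
  moreover have "arcs_ends G = {(u, v). (u, v) \<in> verts G \<times> verts G \<and> u \<noteq> v}"
    "arcs_ends H = {(u, v). (u, v) \<in> verts H \<times> verts H \<and> u \<noteq> v}"
    using G H by (simp_all add: complete_digraph_def)
  ultimately show "arcs_ends (G \<box> H) = {((u, h), (v, h')) | u h v h'. u \<in> verts G \<and> v \<in> verts G \<and>
      h \<in> {h0, h1} \<and> h' \<in> {h0, h1} \<and> (u = v \<and> h \<noteq> h' \<or> h = h' \<and> u \<noteq> v)}"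
    by (simp add: cartesian_product_def H(1)) blast
qed

theorem proposition2p8:
  fixes m :: nat
    and G :: "('a, 'b) pre_digraph"
    and H :: "('c, 'd) pre_digraph"
  assumes "m \<ge> 3"
    and "K\<^bsub>m\<^esub> G"
    and "K\<^bsub>2\<^esub> H"
  shows "unmixed (G \<box> H) \<and> vertex_decomposable (G \<box> H) \<and>
    cohen_macaulay_graph TYPE('k::field) (G \<box> H)"
proof -
  have "card (verts H) = 2" using assms(3) by (simp add: complete_digraph_def)
  then obtain h0 h1 where "verts H = {h0, h1}" "h0 \<noteq> h1" by (auto simp: card_2_iff)
  then interpret complete_prism "verts G" h0 h1 "G \<box> H"
    using assms by (intro complete_prism_product)
  show ?thesis using unmixed_P vertex_decomposable_P cohen_macaulay_P by blast
qed

end
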